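(* Let $n\ge 1$, $\xi\in\partial\mathbb B_n$, $\alpha>-1$, $\beta>0$ and $0<p\le q<\infty$. Suppose $\mu$ is a positive Borel measure on $[0,1)$, and put $$\lambda=\beta+(n+1+\alpha)\Big(\frac1p-\frac1q\Big).$$ Then $\mathcal C_{\mu,\beta}^{\xi}:A_\alpha^p(\mathbb B_n)\to A_\alpha^q(\mathbb B_n)$ is bounded if and only if $\mu$ is a $\lambda$-Carleson measure on $[0,1)$, that is, $$\sup_{r\in[0,1)}\frac{\hat\mu(r)}{(1-r)^\lambda}<\infty .$$
   Context: $\mathbb B_n=\{z\in\mathbb C^n:|z|<1\}$ is the open unit ball, $\langle z,w\rangle=\sum_{k=1}^n z_k\overline{w_k}$, $|z|=\sqrt{\langle z,z\rangle}$, and $\partial\mathbb B_n$ is the unit sphere. $dv$ is the normalized volume measure on $\mathbb B_n$ and $dv_\alpha(z)=c_\alpha(1-|z|^2)^\alpha dv(z)$ with $c_\alpha=\frac{\Gamma(n+1+\alpha)}{n!\,\Gamma(\alpha+1)}$, so that $v_\alpha(\mathbb B_n)=1$. $H(\mathbb B_n)$ is the space of holomorphic functions on $\mathbb B_n$. For $0<p<\infty$, $A_\alpha^p(\mathbb B_n)$ is the weighted Bergman space of all $f\in H(\mathbb B_n)$ with $\|f\|_{p,\alpha}=\left(\int_{\mathbb B_n}|f|^p\,dv_\alpha\right)^{1/p}<\infty$. For a positive Borel measure $\mu$ on $[0,1)$, $\hat\mu(r)=\mu([r,1))$ for $r\in[0,1)$. The weighted Ces\`aro type operator is $$\mathcal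 C_{\mu,\beta}^{\xi}f(z)=\int_{[0,1)}\frac{f(tz)}{(1-t\langle z,\xi\rangle)^\beta}\,d\mu(t),\qquad z\in\mathbb B_n,$$ (principal branch of the power). It is bounded from $X$ to $Y$ if $\mathcal C_{\mu,\beta}^{\xi}f$ is well defined and lies in $Y$ for all $f\in X$ and $\|\mathcal C_{\mu,\beta}^{\xi}f\|_Y\le C\|f\|_X$ with $C$ independent of $f$. *)

theory Defs
  imports "HOL-Analysis.Analysis"
begin

text \<open>
  \<open>\<complex>\<^sup>n\<close> is \<^typ>\<open>complex ^ 'n\<close> with \<open>n = CARD('n)\<close>; its library norm is the Hermitian
  norm \<open>|z|\<close>, and \<^term>\<open>lborel\<close> on it is Lebesgue measure on \<open>\<real>\<^sup>2\<^sup>n\<close>. Functions on the unit ball are total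
  functions whose values outside the ball are irrelevant.
\<close>

abbreviation unit_ball :: "(complex ^ 'n) set" where
  "unit_ball \<equiv> ball 0 1"

definition herm :: "complex ^ 'n \<Rightarrow> complex ^ 'n \<Rightarrow> complex" where
  "herm z w = (\<Sum>k\<in>UNIV. z $ k * cnj (w $ k))"

lemma norm_eq_sqrt_herm: "complex_of_real (norm z) = csqrt (herm z z)"
proof -
  have "herm z z = complex_of_real ((norm z)\<^sup>2)"
    unfolding herm_def norm_vec_def L2_set_def
    by (simp add: sum_nonneg flip: complex_norm_square)
  then show ?thesis
    by (simp add: csqrt_of_real_nonneg del: of_real_power)
qed

text \<open>Holomorphy: the (real) Frechet derivative exists at every point of the ball and is
  complex linear.\<close>

definition holomorphic_ball :: "(complex ^ 'n \<Rightarrow> complex) \<Rightarrow> bool" where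
  "holomorphic_ball f \<longleftrightarrow>
    (\<forall>z\<in>unit_ball. \<exists>D. (f has_derivative D) (at z) \<and> Vector_Spaces.linear (*s) (*) D)"

text \<open>The measures live on the ball itself (not on the whole space), so that a function that is
  continuous on the ball is measurable whatever its values outside.\<close>

definition ball_volume :: "(complex ^ 'n) measure" where
  "ball_volume = restrict_space (uniform_measure lborel unit_ball) unit_ball"

definition weight_const :: "nat \<Rightarrow> real \<Rightarrow> real" where
  "weight_const n \<alpha> = Gamma (real n + 1 + \<alpha>) / (fact n * Gamma (\<alpha> + 1))"

definition weighted_volume :: "real \<Rightarrow> (complex ^ 'n) measure" where
  "weighted_volume \<alpha> = density ball_volume
     (\<lambda>z. ennreal (weight_const CARD('n) \<alpha> * (1 - (norm z)\<^sup>2) powr \<alpha>))"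

definition bergman_space :: "real \<Rightarrow> real \<Rightarrow> (complex ^ 'n \<Rightarrow> complex) set" where
  "bergman_space p \<alpha> =
     {f. holomorphic_ball f \<and> integrable (weighted_volume \<alpha>) (\<lambda>z. norm (f z) powr p)}"

definition bergman_norm :: "real \<Rightarrow> real \<Rightarrow> (complex ^ 'n \<Rightarrow> complex) \<Rightarrow> real" where
  "bergman_norm p \<alpha> f = (LINT z|weighted_volume \<alpha>. norm (f z) powr p) powr (1 / p)"

definition cesaro_kernel ::
  "real \<Rightarrow> complex ^ 'n \<Rightarrow> (complex ^ 'n \<Rightarrow> complex) \<Rightarrow> complex ^ 'n \<Rightarrow> real \<Rightarrow> complex" where
  "cesaro_kernel \<beta> \<xi> f z t =
     f (t *\<^sub>R z) / (1 - complex_of_real t * herm z \<xi>) powr complex_of_real \<beta>"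

definition cesaro ::
  "real measure \<Rightarrow> real \<Rightarrow> complex ^ 'n \<Rightarrow> (complex ^ 'n \<Rightarrow> complex) \<Rightarrow> complex ^ 'n \<Rightarrow> complex" where
  "cesaro \<mu> \<beta> \<xi> f z = (LINT t|\<mu>. cesaro_kernel \<beta> \<xi> f z t)"

text \<open>The Bochner integral is \<open>0\<close> for non-integrable functions, so that the operator is well
  defined on \<open>f\<close> has to be required separately.\<close>

definition cesaro_well_defined ::
  "real measure \<Rightarrow> real \<Rightarrow> complex ^ 'n \<Rightarrow> (complex ^ 'n \<Rightarrow> complex) \<Rightarrow> bool" where
  "cesaro_well_defined \<mu> \<beta> \<xi> f \<longleftrightarrow> (\<forall>z\<in>unit_ball. integrable \<mu> (cesaro_kernel \<beta> \<xi> f z))"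

definition cesaro_bounded ::
  "real measure \<Rightarrow> real \<Rightarrow> complex ^ 'n \<Rightarrow> real \<Rightarrow> real \<Rightarrow> real \<Rightarrow> bool" where
  "cesaro_bounded \<mu> \<beta> \<xi> \<alpha> p q \<longleftrightarrow>
     (\<forall>f\<in>bergman_space p \<alpha>. cesaro_well_defined \<mu> \<beta> \<xi> f \<and> cesaro \<mu> \<beta> \<xi> f \<in> bergman_space q \<alpha>) \<and>
     (\<exists>C. \<forall>f\<in>bergman_space p \<alpha>. bergman_norm q \<alpha> (cesaro \<mu> \<beta> \<xi> f) \<le> C * bergman_norm p \<alpha> f)"

text \<open>Only the Borel sets of \<open>[0,1)\<close> are prescribed: \<open>\<mu>\<close> may be infinite.\<close>

definition borel_measure_01 :: "real measure \<Rightarrow> bool" where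
  "borel_measure_01 \<mu> \<longleftrightarrow> sets \<mu> = sets (restrict_space borel {0..<1})"

definition carleson_measure :: "real \<Rightarrow> real measure \<Rightarrow> bool" where
  "carleson_measure s \<mu> \<longleftrightarrow>
     (SUP r\<in>{0..<1}. emeasure \<mu> {r..<1} / ennreal ((1 - r) powr s)) < \<infinity>"

end

theory Submission
  imports Defs "HOL-Complex_Analysis.Complex_Analysis"
begin

text \<open>
  Write \<open>N = n + 1 + \<alpha>\<close> and \<open>d(z) = |1 - \<langle>z,\<xi>\<rangle>|\<close>. Two facts carry the argument: \<open>v\<^sub>\<alpha>{d \<le> s}\<close> is at most a
  constant times \<open>s\<^sup>N\<close>, and \<open>|f|\<^sup>p\<close> has the submean value property on the anisotropic ellipsoids
  of size \<open>R = 1 - |w|\<close> in the direction of \<open>w\<close> and \<open>\<surd>R\<close> across it, so that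
  \<open>|f(w)|\<^sup>p R\<^sup>N\<close> is controlled by the integral of \<open>|f|\<^sup>p\<close> over the ellipsoid.

  Necessity: apply the operator to \<open>f(z) = (1 - a\<langle>z,\<xi>\<rangle>)\<close> to the power \<open>-s\<close>, evaluate at the point \<open>a\<xi>\<close>,
  where the kernel is positive, and compare with the growth bound in the target space.

  Sufficiency: normalize \<open>\<integral>|f|\<^sup>p \<le> 1\<close> and cut \<open>[0,1)\<close> into the dyadic pieces \<open>1 - t \<approx> x\<^sub>k\<close>, where \<open>x\<^sub>k\<close> is the
  \<open>k\<close>-th power of \<open>1/2\<close>. If \<open>x\<^sub>k \<ge> d(z)\<close>, the points \<open>tz\<close> lie in the \<open>k\<close>-th of a sequence of boundedly
  overlapping regions at \<open>\<xi>\<close>, and a discrete Hardy inequality sums the contributions. On the other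
  pieces the kernel supplies geometric decay; there the growth bound reduces \<open>|f(tz)|\<close> to its \<open>p/q\<close>-th
  power, and \<open>|f(tz)|\<^sup>p\<close> is dominated, for all \<open>t\<close> at once, by an area integral of \<open>|f|\<^sup>p\<close> whose integral
  Tonelli computes.
\<close>

section \<open>Lebesgue measure under linear isometries\<close>

text \<open>Exponents below 1 are allowed, so neither duality nor Minkowski's inequality is
  available; every bound is pointwise in terms of |f|^p, and the submean value property for small
  exponents is the analytic core. The exponent \<lambda> can be read off from sizes. For 1 - t of
  order x_k the kernel has size max(x_k, d)^(-\<beta>), which uses up x_k^\<beta> of the mass of
  \<mu>. The growth |f| <= C x_k^(-N/p), used to pass from |f| to |f|^(p/q), costs x_k^(-N(1/p -
  1/q)), which uses up the rest. Nothing is left over, and this shapes the proof: for x_k >= d there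
  is no decay in k, and a majorant of |f(tz)| uniform in t would be counted once per k, a loss of
  log(1/d). Hence the localization at \<xi>, where the masses of |f|^p are summable. For x_k < d the
  points tz are close to z rather than to \<xi>, but (x_k/d)^\<beta> decays and one uniform majorant
  is enough. For \<alpha> < 0 the weight is unbounded at the sphere, so weighted volumes do not
  follow from Lebesgue volumes by estimating the density.\<close>

lemma linear_isometry_surj:
  fixes T :: "'a::euclidean_space \<Rightarrow> 'a"
  assumes "linear T" "\<And>x. norm (T x) = norm x"
  shows "surj T"
proof -
  have "inj T"
    using assms by (simp add: linear_injective_0) (metis norm_eq_zero)
  then show ?thesis using assms(1) linear_injective_imp_surjective by blast
qed

lemma nn_integral_lborel_translate:
  fixes f :: "'a::euclidean_space \<Rightarrow> ennreal"
  assumes [measurable]: "f \<in> borel_measurable borel"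
  shows "(\<integral>\<^sup>+x. f (a + x) \<partial>lborel) = (\<integral>\<^sup>+x. f x \<partial>lborel)"
proof -
  have "(\<integral>\<^sup>+x. f x \<partial>distr lborel borel ((+) a)) = (\<integral>\<^sup>+x. f (a + x) \<partial>lborel)"
    by (subst nn_integral_distr) auto
  then show ?thesis by (simp add: lborel_distr_plus)
qed

text \<open>Uniqueness of Haar measure: for translation invariant \<open>\<nu>\<close>, Fubini gives
  \<open>\<nu>(A) \<lambda>(B) = \<lambda>(A) \<nu>(-B)\<close>; take \<open>\<nu>\<close> to be the image measure and \<open>B\<close> a ball.\<close>
lemma distr_lborel_linear_isometry:
  fixes T :: "'a::euclidean_space \<Rightarrow> 'a"
  assumes lin: "linear T" and iso: "\<And>x. norm (T x) = norm x"
  shows "distr lborel borel T = lborel"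
proof (rule measure_eqI)
  show "sets (distr lborel borel T) = sets lborel" by simp
  fix A assume "A \<in> sets (distr lborel borel T)"
  then have [measurable]: "A \<in> sets borel" by simp
  have [measurable]: "T \<in> borel_measurable borel"
    using lin by (intro borel_measurable_continuous_onI linear_continuous_on linear_conv_bounded_linear[THEN iffD1])
  let ?B = "ball (0::'a) 1"
  have [measurable]: "?B \<in> sets borel" by simp
  have multc: "(\<integral>\<^sup>+x. indicator S x * c \<partial>lborel) = emeasure lborel S * c"
    if "S \<in> sets borel" for S :: "'a set" and c :: ennreal
    using nn_integral_cmult_indicator[of S lborel c] that by (simp add: mult.commute)
  have T_add: "T (x + y) = T x + T y" for x y using lin by (simp add: linear_add)
  have "emeasure lborel ?B * emeasure lborel (T -` A)
      = (\<integral>\<^sup>+y. indicator ?B y * (\<integral>\<^sup>+x. indicator A (T x) \<partial>lborel) \<partial>lborel)"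
  proof -
    have [measurable]: "T -` A \<in> sets borel"
      by (rule measurable_sets_borel[of T borel A]) measurable
    have *: "(\<integral>\<^sup>+x. indicator A (T x) \<partial>lborel) = emeasure lborel (T -` A)"
    proof -
      have "(\<lambda>x. indicator A (T x) :: ennreal) = indicator (T -` A)"
        by (auto simp: indicator_def fun_eq_iff)
      then show ?thesis by simp
    qed
    show ?thesis unfolding * by (simp add: multc)
  qed
  also have "\<dots> = (\<integral>\<^sup>+y. indicator ?B y * (\<integral>\<^sup>+x. indicator A (y + T x) \<partial>lborel) \<partial>lborel)"
  proof (rule nn_integral_cong)
    fix y :: 'a
    obtain y' where y: "y = T y'" using linear_isometry_surj[OF lin iso] by (metis surjD)
    show "indicator ?B y * (\<integral>\<^sup>+x. indicator A (T x) \<partial>lborel)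
        = indicator ?B y * (\<integral>\<^sup>+x. indicator A (y + T x) \<partial>lborel)"
      using nn_integral_lborel_translate[of "\<lambda>x. indicator A (T x)" y'] by (simp add: y T_add)
  qed
  also have "\<dots> = (\<integral>\<^sup>+y. (\<integral>\<^sup>+x. indicator ?B y * indicator A (y + T x) \<partial>lborel) \<partial>lborel)"
    by (intro nn_integral_cong nn_integral_cmult[symmetric]) auto
  also have "\<dots> = (\<integral>\<^sup>+x. (\<integral>\<^sup>+y. indicator ?B y * indicator A (y + T x) \<partial>lborel) \<partial>lborel)"
    by (rule lborel_pair.Fubini') measurable
  also have "\<dots> = (\<integral>\<^sup>+x. (\<integral>\<^sup>+y. indicator ?B (y - T x) * indicator A y \<partial>lborel) \<partial>lborel)"
  proof (rule nn_integral_cong)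
    fix x
    show "(\<integral>\<^sup>+y. indicator ?B y * indicator A (y + T x) \<partial>lborel)
        = (\<integral>\<^sup>+y. indicator ?B (y - T x) * indicator A y \<partial>lborel)"
      by (subst nn_integral_lborel_translate[of "\<lambda>y. indicator ?B (y - T x) * indicator A y" "T x", symmetric])
         (auto simp: add.commute intro!: nn_integral_cong)
  qed
  also have "\<dots> = (\<integral>\<^sup>+y. (\<integral>\<^sup>+x. indicator ?B (y - T x) * indicator A y \<partial>lborel) \<partial>lborel)"
    by (rule lborel_pair.Fubini') measurable
  also have "\<dots> = (\<integral>\<^sup>+y. indicator A y * emeasure lborel ?B \<partial>lborel)"
  proof (rule nn_integral_cong)
    fix y :: 'a
    obtain y' where y: "y = T y'" using linear_isometry_surj[OF lin iso] by (metis surjD)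
    \<comment> \<open>The x with y - T x in the unit ball form the unit ball about the preimage of
      y, so their measure does not depend on y.\<close>
    have "indicator ?B (y - T x) = (indicator (ball y' 1) x :: ennreal)" for x
      using iso[of "x - y'"] norm_minus_commute[of x y'] by (auto simp: y indicator_def dist_norm linear_diff[OF lin])
    then have "(\<integral>\<^sup>+x. indicator ?B (y - T x) * indicator A y \<partial>lborel) = emeasure lborel (ball y' 1) * indicator A y"
      by (simp add: multc)
    then show "(\<integral>\<^sup>+x. indicator ?B (y - T x) * indicator A y \<partial>lborel) = indicator A y * emeasure lborel ?B"
      by (simp add: emeasure_ball mult.commute)
  qed
  also have "\<dots> = emeasure lborel A * emeasure lborel ?B"
    by (simp add: multc)
  finally have "emeasure lborel (T -` A) * emeasure lborel ?B = emeasure lborel A * emeasure lborel ?B"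
    by (simp add: mult.commute)
  moreover have "emeasure lborel ?B \<noteq> 0" "emeasure lborel ?B \<noteq> \<infinity>"
    by (auto simp: emeasure_ball unit_ball_vol_pos less_imp_neq[symmetric])
  ultimately have "emeasure lborel (T -` A) = emeasure lborel A"
    by (metis ennreal_mult_cancel_left infinity_ennreal_def mult.commute)
  then show "emeasure (distr lborel borel T) A = emeasure lborel A"
    by (simp add: emeasure_distr)
qed

lemma nn_integral_linear_isometry:
  fixes T :: "'a::euclidean_space \<Rightarrow> 'a" and f :: "'a \<Rightarrow> ennreal"
  assumes "linear T" "\<And>x. norm (T x) = norm x" and [measurable]: "f \<in> borel_measurable borel"
  shows "(\<integral>\<^sup>+x. f (T x) \<partial>lborel) = (\<integral>\<^sup>+x. f x \<partial>lborel)"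
proof -
  have [measurable]: "T \<in> borel_measurable borel"
    using assms(1) by (intro borel_measurable_continuous_onI linear_continuous_on linear_conv_bounded_linear[THEN iffD1])
  have "(\<integral>\<^sup>+x. f x \<partial>distr lborel borel T) = (\<integral>\<^sup>+x. f (T x) \<partial>lborel)"
    by (subst nn_integral_distr) auto
  then show ?thesis by (simp add: distr_lborel_linear_isometry[OF assms(1,2)])
qed

lemma nn_integral_lborel_scale:
  fixes f :: "'a::euclidean_space \<Rightarrow> ennreal"
  assumes [measurable]: "f \<in> borel_measurable borel" and "c > 0"
  shows "(\<integral>\<^sup>+x. f x \<partial>lborel) = ennreal (c ^ DIM('a)) * (\<integral>\<^sup>+x. f (t + c *\<^sub>R x) \<partial>lborel)"
  using assms(2) by (subst lborel_affine[of c t]) (auto simp: nn_integral_density nn_integral_distr nn_integral_cmult)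

section \<open>The Hermitian form and anisotropic dilations\<close>

unbundle no fps_syntax

lemma herm_add_left: "herm (x + y) w = herm x w + herm y w"
  and herm_diff_left: "herm (x - y) w = herm x w - herm y w"
  and herm_scale_left: "herm (c *s x) w = c * herm x w"
  and herm_diff_right: "herm w (x - y) = herm w x - herm w y"
  and herm_scale_right: "herm w (c *s x) = cnj c * herm w x"
  and cnj_herm: "cnj (herm x w) = herm w x"
  and herm_zero_left [simp]: "herm 0 w = 0"
  unfolding herm_def
  by (simp_all add: algebra_simps sum.distrib sum_subtractf sum_distrib_left)

lemma scaleR_eq_vector_scalar_mult: "r *\<^sub>R (x :: complex ^ 'n) = complex_of_real r *s x"
  unfolding vec_eq_iff vector_scaleR_component vector_smult_component
  by (simp add: scaleR_conv_of_real)

lemma herm_scaleR_left: "herm (r *\<^sub>R x) w = of_real r * herm x w"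
  by (simp add: scaleR_eq_vector_scalar_mult herm_scale_left)

lemma herm_self: "herm x x = complex_of_real ((norm x)\<^sup>2)"
  unfolding herm_def norm_vec_def L2_set_def
  by (simp add: sum_nonneg flip: complex_norm_square)

lemma inner_eq_Re_herm: "inner x y = Re (herm x y)"
  by (simp add: herm_def inner_vec_def inner_complex_def)

lemma norm_vector_scalar_mult: "norm (c *s (x :: complex ^ 'n)) = norm c * norm x"
proof -
  have "complex_of_real ((norm (c *s x))\<^sup>2) = (c * cnj c) * herm x x"
    by (simp only: herm_self[symmetric] herm_scale_left herm_scale_right mult_ac)
  also have "\<dots> = of_real ((norm c * norm x)\<^sup>2)"
    by (simp only: herm_self complex_norm_square[symmetric] of_real_mult power_mult_distrib)
  finally have "complex_of_real ((norm (c *s x))\<^sup>2) = of_real ((norm c * norm x)\<^sup>2)" .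
  then have "(norm (c *s x))\<^sup>2 = (norm c * norm x)\<^sup>2" by (simp only: of_real_eq_iff)
  then show ?thesis by (simp add: power2_eq_iff_nonneg)
qed

text \<open>The real inner product is the real part of \<open>herm\<close>. A phase c that makes the
  form real and nonnegative reduces the claim to the real Cauchy-Schwarz inequality.\<close>

lemma norm_herm_le: "norm (herm x y) \<le> norm x * norm y"
proof -
  define c where "c = (if herm x y = 0 then 1 else cnj (sgn (herm x y)))"
  have c: "norm c \<le> 1"
    by (simp add: c_def norm_sgn)
  have "cnj (sgn w) * w = of_real (norm w)" for w :: complex
  proof -
    have "cnj (sgn w) * w = of_real ((norm w)\<^sup>2) / of_real (norm w)"
      unfolding complex_norm_square by (simp add: sgn_eq mult.commute)
    then show ?thesis by (simp add: power2_eq_square)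
  qed
  then have c2: "c * herm x y = of_real (norm (herm x y))"
    by (simp add: c_def)
  have "norm (herm x y) = Re (c * herm x y)" by (simp add: c2)
  also have "\<dots> = inner (c *s x) y" by (simp add: inner_eq_Re_herm herm_scale_left)
  also have "\<dots> \<le> norm (c *s x) * norm y" by (rule norm_cauchy_schwarz)
  also have "\<dots> \<le> norm x * norm y"
    using c by (intro mult_right_mono) (auto simp: norm_vector_scalar_mult intro: mult_left_le_one_le)
  finally show ?thesis .
qed

text \<open>Pythagoras: the vector subtracted from z is its orthogonal projection to the complex
  line of u.\<close>

lemma norm_sq_decomp:
  assumes "norm u = 1"
  shows "(norm (z - herm z u *s u))\<^sup>2 = (norm z)\<^sup>2 - (norm (herm z u))\<^sup>2"
proof -
  have "complex_of_real ((norm (z - herm z u *s u))\<^sup>2) = herm z z - herm z u * cnj (herm z u)"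
    unfolding herm_self[of "z - herm z u *s u", symmetric]
    by (simp add: herm_diff_left herm_diff_right herm_scale_left herm_scale_right herm_self[of u] assms
        cnj_herm)
  also have "\<dots> = of_real ((norm z)\<^sup>2 - (norm (herm z u))\<^sup>2)"
    by (simp only: herm_self complex_norm_square[symmetric] of_real_diff)
  finally have "complex_of_real ((norm (z - herm z u *s u))\<^sup>2) = of_real ((norm z)\<^sup>2 - (norm (herm z u))\<^sup>2)" .
  then show ?thesis by (simp only: of_real_eq_iff)
qed

lemma continuous_on_herm_left [continuous_intros]:
  "continuous_on S f \<Longrightarrow> continuous_on S (\<lambda>x. herm (f x) w)"
  unfolding herm_def by (intro continuous_intros)

lemma continuous_on_vector_scalar_mult [continuous_intros]:
  fixes g :: "'a::topological_space \<Rightarrow> complex ^ 'n"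
  shows "continuous_on S c \<Longrightarrow> continuous_on S g \<Longrightarrow> continuous_on S (\<lambda>x. c x *s g x)"
  unfolding vector_scalar_mult_def by (intro continuous_intros)

lemma measurable_herm_left [measurable (raw)]:
  "f \<in> borel_measurable M \<Longrightarrow> (\<lambda>x. herm (f x) w) \<in> borel_measurable M"
  using measurable_compose[of f M borel "\<lambda>x. herm x w" borel]
  by (simp add: borel_measurable_continuous_onI continuous_on_herm_left)

text \<open>U is the reflection in the complex hyperplane orthogonal to v = \<xi> - e. It takes
  \<xi> to e because their Hermitian product is real, which is arranged by giving e the phase
  \<theta> of the i-th coordinate of \<xi>. Its use is to turn dilations along \<xi> into diagonal
  ones.\<close>

lemma householder:
  fixes \<xi> :: "complex ^ 'n" and i :: 'n
  assumes "norm \<xi> = 1"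
  obtains U \<theta> where "norm \<theta> = 1" "U \<xi> = axis i \<theta>" "\<And>x y. U (x + y) = U x + U y"
    "\<And>c x. U (c *s x) = c *s U x" "\<And>x. norm (U x) = norm x"
    "\<And>x y. herm (U x) y = herm x (U y)" "\<And>x. U (U x) = x"
proof -
  define \<theta> where "\<theta> = (if \<xi> $ i = 0 then 1 else sgn (\<xi> $ i))"
  have \<theta>: "norm \<theta> = 1" by (auto simp: \<theta>_def norm_sgn)
  have \<theta>': "\<theta> * cnj \<theta> = 1" using \<theta> by (simp flip: complex_norm_square)
  define r where "r = norm (\<xi> $ i)"
  have \<theta>r: "\<xi> $ i = of_real r * \<theta>" by (auto simp: r_def \<theta>_def sgn_div_norm scaleR_conv_of_real)
  define e :: "complex ^ 'n" where "e = axis i \<theta>"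
  have he: "herm x e = x $ i * cnj \<theta>" for x
    unfolding herm_def e_def axis_def
    by (subst sum.remove[of _ i]) (auto intro!: sum.neutral)
  define v where "v = \<xi> - e"
  have ei: "e $ i = \<theta>" by (simp add: e_def)
  have h1: "herm \<xi> e = of_real r" "herm e \<xi> = of_real r"
    using \<theta>' by (simp_all add: he \<theta>r mult.commute flip: cnj_herm[of \<xi> e])
  have h2: "herm e e = 1" "herm \<xi> \<xi> = 1" using \<theta>' he[of e] by (simp_all add: ei herm_self[of \<xi>] assms)
  have hv: "herm v v = 2 * (1 - of_real r)" "herm \<xi> v = 1 - of_real r"
    by (simp_all add: v_def herm_diff_left herm_diff_right h1 h2 algebra_simps)
  \<comment> \<open>For v = 0 the correction vanishes and U is the identity, as it should be since
    then \<xi> = e.\<close>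
  define U where "U x = x - (2 * herm x v / herm v v) *s v" for x
  have hvc: "cnj (herm v v) = herm v v" by (rule cnj_herm)
  have adj: "herm (U x) y = herm x (U y)" for x y
    by (simp add: U_def herm_diff_left herm_diff_right herm_scale_left herm_scale_right hvc cnj_herm)
  have inv: "U (U x) = x" for x
  proof (cases "v = 0")
    case False
    then have "herm v v \<noteq> 0" by (simp add: herm_self)
    then show ?thesis
      by (simp add: U_def herm_diff_left herm_scale_left vec_eq_iff field_simps)
  qed (simp add: U_def)
  have U\<xi>: "U \<xi> = e"
  proof (cases "v = 0")
    case True then show ?thesis by (simp add: U_def v_def)
  next
    case False
    then have "herm v v \<noteq> 0" by (simp add: herm_self)
    then have "2 * herm \<xi> v / herm v v = 1" unfolding hv by simp
    then show ?thesis by (simp add: U_def v_def)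
  qed
  have nrm: "norm (U x) = norm x" for x
  proof -
    have "herm (U x) (U x) = herm x x" using adj inv by metis
    then have "(norm (U x))\<^sup>2 = (norm x)\<^sup>2" unfolding herm_self by (simp only: of_real_eq_iff)
    then show ?thesis by (simp add: power2_eq_iff_nonneg)
  qed
  show thesis
  proof (rule that[of \<theta> U])
    show "U (x + y) = U x + U y" for x y
      by (simp add: U_def herm_add_left vec_eq_iff field_simps add_divide_distrib)
    show "U (c *s x) = c *s U x" for c x
      by (simp add: U_def herm_scale_left vec_eq_iff field_simps)
  qed (use \<theta> U\<xi> nrm adj inv in \<open>auto simp: e_def\<close>)
qed

text \<open>Scales the complex line through the unit vector \<open>u\<close> by \<open>R\<close> and its orthogonal complement by \<open>\<surd>R\<close>.\<close>
definition aniso :: "real \<Rightarrow> complex ^ 'n \<Rightarrow> complex ^ 'n \<Rightarrow> complex ^ 'n" where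
  "aniso R u z = of_real (sqrt R) *s z + (of_real (R - sqrt R) * herm z u) *s u"

text \<open>In real coordinates the map is diagonal, with entry R on the two real directions of
  coordinate i and \<open>sqrt R\<close> on the remaining 2n - 2. Its Jacobian is R^2 times R^(n -
  1).\<close>

lemma nn_integral_aniso_axis:
  fixes f :: "complex ^ 'n \<Rightarrow> ennreal"
  assumes [measurable]: "f \<in> borel_measurable borel" and R: "R > 0" and \<theta>: "norm \<theta> = 1"
  shows "(\<integral>\<^sup>+x. f x \<partial>lborel) = ennreal (R ^ (CARD('n) + 1)) * (\<integral>\<^sup>+x. f (aniso R (axis i \<theta>) x) \<partial>lborel)"
proof -
  define c :: "complex ^ 'n \<Rightarrow> real" where "c b = (if b $ i \<noteq> 0 then R else sqrt R)" for b
  have \<theta>': "\<theta> * cnj \<theta> = 1" using \<theta> by (simp flip: complex_norm_square)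
  have T: "(\<Sum>j\<in>Basis. (c j * (x \<bullet> j)) *\<^sub>R j) = aniso R (axis i \<theta>) x" for x
  proof (rule euclidean_eqI)
    fix b :: "complex ^ 'n" assume b: "b \<in> Basis"
    have he: "herm x (axis i \<theta>) = x $ i * cnj \<theta>"
      unfolding herm_def axis_def by (subst sum.remove[of _ i]) (auto intro!: sum.neutral)
    have comp: "aniso R (axis i \<theta>) x $ j = (if j = i then R else sqrt R) *\<^sub>R (x $ j)" for j
    proof -
      have "aniso R (axis i \<theta>) x $ j
          = of_real (sqrt R) * x $ j + (if j = i then of_real (R - sqrt R) * x $ i else 0)"
        using \<theta>' unfolding aniso_def he by (simp add: axis_def mult.commute del: of_real_diff)
      then show ?thesis
        by (simp add: scaleR_conv_of_real ring_distribs)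
    qed
    obtain j a where ja: "b = axis j a" "a \<in> Basis" using b by (auto simp: Basis_vec_def)
    then have "c b = (if j = i then R else sqrt R)" by (auto simp: c_def axis_def)
    then have "aniso R (axis i \<theta>) x \<bullet> b = c b * (x \<bullet> b)"
      by (simp add: ja inner_axis comp)
    then show "(\<Sum>j\<in>Basis. (c j * (x \<bullet> j)) *\<^sub>R j) \<bullet> b = aniso R (axis i \<theta>) x \<bullet> b"
      using b by (simp add: inner_sum_left inner_Basis if_distrib cong: if_cong)
  qed
  have "(\<Prod>b\<in>Basis. \<bar>c b\<bar>) = (\<Prod>j\<in>(UNIV::'n set). \<Prod>a\<in>(Basis::complex set). if j = i then R else sqrt R)"
  proof -
    have "(\<Prod>b\<in>(Basis::(complex^'n) set). \<bar>c b\<bar>) = (\<Prod>(j,a)\<in>UNIV \<times> Basis. \<bar>c (axis j a)\<bar>)"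
    proof -
      have eq: "(Basis::(complex^'n) set) = (\<lambda>(j,a). axis j a) ` (UNIV \<times> Basis)"
        by (auto simp: Basis_vec_def)
      have inj: "inj_on (\<lambda>(j,a). axis j a :: complex ^ 'n) (UNIV \<times> Basis)"
        by (auto simp: inj_on_def axis_eq_axis)
      have "(\<Prod>b\<in>(Basis::(complex^'n) set). \<bar>c b\<bar>)
          = prod ((\<lambda>b. \<bar>c b\<bar>) \<circ> (\<lambda>(j,a). axis j a)) (UNIV \<times> Basis)"
        unfolding eq by (rule prod.reindex[OF inj])
      then show ?thesis by (simp add: case_prod_beta o_def)
    qed
    also have "\<dots> = (\<Prod>j\<in>UNIV. \<Prod>a\<in>Basis. \<bar>c (axis j a)\<bar>)"
      by (subst prod.cartesian_product) simp
    also have "\<dots> = (\<Prod>j\<in>(UNIV::'n set). \<Prod>a\<in>(Basis::complex set). if j = i then R else sqrt R)"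
      using R by (intro prod.cong refl) (auto simp: c_def axis_def Basis_complex_def)
    finally show ?thesis .
  qed
  also have "\<dots> = (\<Prod>j\<in>(UNIV::'n set). if j = i then R\<^sup>2 else R)"
    using R by (intro prod.cong refl) (auto simp: Basis_complex_def power2_eq_square)
  also have "\<dots> = R\<^sup>2 * (\<Prod>j\<in>UNIV - {i}. R)"
    by (subst prod.remove[of _ i]) auto
  also have "\<dots> = R ^ (CARD('n) + 1)"
    by (simp add: card_Diff_singleton power_add[symmetric] Suc_leI)
  finally have pr: "(\<Prod>b\<in>Basis. \<bar>c b\<bar>) = R ^ (CARD('n) + 1)" .
  have "c b \<noteq> 0" for b using R by (auto simp: c_def)
  then have eq: "lborel = density (distr lborel borel (aniso R (axis i \<theta>))) (\<lambda>_. ennreal (R ^ (CARD('n) + 1)))"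
    using lborel_affine_euclidean[of c 0] by (simp add: T pr)
  have [measurable]: "aniso R (axis i \<theta>) \<in> borel_measurable borel"
    unfolding aniso_def by (intro borel_measurable_continuous_onI continuous_intros)
  show ?thesis
    by (subst eq) (simp add: nn_integral_density nn_integral_distr nn_integral_cmult)
qed

text \<open>A unitary reflection taking u to a coordinate axis conjugates the dilation into the
  diagonal one and preserves Lebesgue measure.\<close>

lemma nn_integral_aniso:
  fixes f :: "complex ^ 'n \<Rightarrow> ennreal"
  assumes [measurable]: "f \<in> borel_measurable borel" and R: "R > 0" and u: "norm u = 1"
  shows "(\<integral>\<^sup>+x. f x \<partial>lborel) = ennreal (R ^ (CARD('n) + 1)) * (\<integral>\<^sup>+x. f (aniso R u x) \<partial>lborel)"
proof -
  fix i :: 'n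
  obtain U \<theta> where U: "norm \<theta> = 1" "U u = axis i \<theta>" "\<And>x y. U (x + y) = U x + U y"
    "\<And>c x. U (c *s x) = c *s U x" "\<And>x. norm (U x) = norm x"
    "\<And>x y. herm (U x) y = herm x (U y)" "\<And>x. U (U x) = x"
    using householder[OF u, of i thesis] by metis
  have lin: "linear U" by (rule linearI) (auto simp: U scaleR_eq_vector_scalar_mult)
  then have [measurable]: "U \<in> borel_measurable borel"
    by (intro borel_measurable_continuous_onI linear_continuous_on linear_conv_bounded_linear[THEN iffD1])
  have [measurable]: "aniso R v \<in> borel_measurable borel" for v :: "complex ^ 'n"
    unfolding aniso_def by (intro borel_measurable_continuous_onI continuous_intros)
  have *: "aniso R u (U x) = U (aniso R (axis i \<theta>) x)" for x
    by (simp add: aniso_def U(3,4,6)) (metis U(2,7))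
  have "(\<integral>\<^sup>+x. f (aniso R u x) \<partial>lborel) = (\<integral>\<^sup>+x. f (aniso R u (U x)) \<partial>lborel)"
    by (rule nn_integral_linear_isometry[OF lin U(5), symmetric]) measurable
  also have "\<dots> = (\<integral>\<^sup>+x. f (U (aniso R (axis i \<theta>) x)) \<partial>lborel)" by (simp add: *)
  finally have "ennreal (R ^ (CARD('n) + 1)) * (\<integral>\<^sup>+x. f (aniso R u x) \<partial>lborel) = (\<integral>\<^sup>+x. f (U x) \<partial>lborel)"
    using nn_integral_aniso_axis[of "\<lambda>x. f (U x)" R \<theta> i] R U(1) by simp
  also have "\<dots> = (\<integral>\<^sup>+x. f x \<partial>lborel)"
    by (rule nn_integral_linear_isometry[OF lin U(5)]) measurable
  finally show ?thesis by simp
qed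

section \<open>Holomorphic functions on open sets of \<open>\<complex>\<^sup>n\<close>\<close>

lemma complex_linear_iff:
  fixes D :: "complex ^ 'n \<Rightarrow> complex"
  shows "Vector_Spaces.linear (*s) (*) D \<longleftrightarrow>
    (\<forall>x y. D (x + y) = D x + D y) \<and> (\<forall>c x. D (c *s x) = c * D x)"
proof -
  have "vector_space ((*s) :: complex \<Rightarrow> complex ^ 'n \<Rightarrow> complex ^ 'n)"
    by unfold_locales (simp_all add: vec_eq_iff algebra_simps)
  moreover have "vector_space ((*) :: complex \<Rightarrow> complex \<Rightarrow> complex)"
    by unfold_locales (simp_all add: algebra_simps)
  ultimately show ?thesis unfolding Vector_Spaces.linear_iff by blast
qed

text \<open>Rescaling and recentering lead from the unit ball to other balls, hence the arbitrary
  set.\<close>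

definition holo_on :: "(complex ^ 'n \<Rightarrow> complex) \<Rightarrow> (complex ^ 'n) set \<Rightarrow> bool" where
  "holo_on f S \<longleftrightarrow> (\<forall>z\<in>S. \<exists>D. (f has_derivative D) (at z)
      \<and> (\<forall>x y. D (x + y) = D x + D y) \<and> (\<forall>c x. D (c *s x) = c * D x))"

lemma holomorphic_ball_iff_holo_on: "holomorphic_ball f \<longleftrightarrow> holo_on f (ball 0 1)"
  by (simp add: holomorphic_ball_def holo_on_def complex_linear_iff)

lemma holo_on_subset: "holo_on f S \<Longrightarrow> T \<subseteq> S \<Longrightarrow> holo_on f T"
  by (auto simp: holo_on_def)

lemma holo_on_imp_continuous_on: "holo_on f S \<Longrightarrow> continuous_on S f"
  unfolding holo_on_def
  by (meson continuous_at_imp_continuous_on has_derivative_continuous)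

text \<open>The values of f outside S are arbitrary, so measurability on the whole space is claimed
  for the cut-off function.\<close>

lemma holo_on_imp_measurable:
  assumes "holo_on f S" "S \<in> sets borel"
  shows "(\<lambda>x. indicator S x *\<^sub>R f x) \<in> borel_measurable borel"
  by (intro borel_measurable_continuous_on_indicator holo_on_imp_continuous_on assms)

lemma holo_on_mult:
  assumes "holo_on f S" "holo_on g S"
  shows "holo_on (\<lambda>z. f z * g z) S"
  unfolding holo_on_def
proof
  fix z assume "z \<in> S"
  obtain D where D: "(f has_derivative D) (at z)" "\<And>x y. D (x + y) = D x + D y" "\<And>c x. D (c *s x) = c * D x"
    using assms(1) \<open>z \<in> S\<close> unfolding holo_on_def by metis
  obtain E where E: "(g has_derivative E) (at z)" "\<And>x y. E (x + y) = E x + E y" "\<And>c x. E (c *s x) = c * E x"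
    using assms(2) \<open>z \<in> S\<close> unfolding holo_on_def by metis
  show "\<exists>D. ((\<lambda>z. f z * g z) has_derivative D) (at z)
      \<and> (\<forall>x y. D (x + y) = D x + D y) \<and> (\<forall>c x. D (c *s x) = c * D x)"
    by (rule exI[of _ "\<lambda>h. f z * E h + D h * g z"])
       (use has_derivative_mult[OF D(1) E(1)] in \<open>simp add: D E algebra_simps\<close>)
qed

lemma holo_on_const: "holo_on (\<lambda>_. c) S"
  unfolding holo_on_def by (rule ballI, rule exI[of _ "\<lambda>_. 0"]) auto

lemma holo_on_power: "holo_on f S \<Longrightarrow> holo_on (\<lambda>z. f z ^ k) S"
  by (induction k) (auto intro: holo_on_mult holo_on_const)

lemma holo_on_affine:
  fixes L :: "complex ^ 'm \<Rightarrow> complex ^ 'n"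
  assumes f: "holo_on f S" and add: "\<And>x y. L (x + y) = L x + L y" and sc: "\<And>c x. L (c *s x) = c *s L x"
    and sub: "\<And>x. x \<in> T \<Longrightarrow> a + L x \<in> S"
  shows "holo_on (\<lambda>x. f (a + L x)) T"
  unfolding holo_on_def
proof
  fix z assume "z \<in> T"
  then obtain D where D: "(f has_derivative D) (at (a + L z))"
    "\<And>x y. D (x + y) = D x + D y" "\<And>c x. D (c *s x) = c * D x"
    using f sub unfolding holo_on_def by metis
  have "linear L" by (rule linearI) (auto simp: add sc scaleR_eq_vector_scalar_mult)
  then have "((\<lambda>x. a + L x) has_derivative L) (at z)"
    by (auto intro!: derivative_eq_intros bounded_linear_imp_has_derivative simp: linear_conv_bounded_linear)
  from diff_chain_at[OF this D(1)]
  show "\<exists>D. ((\<lambda>x. f (a + L x)) has_derivative D) (at z)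
      \<and> (\<forall>x y. D (x + y) = D x + D y) \<and> (\<forall>c x. D (c *s x) = c * D x)"
    by (intro exI[of _ "D \<circ> L"]) (auto simp: o_def D add sc)
qed

lemma holo_on_comp_holomorphic:
  assumes f: "holo_on f S" and g: "g holomorphic_on T" "open T" and sub: "\<And>x. x \<in> S \<Longrightarrow> f x \<in> T"
  shows "holo_on (\<lambda>x. g (f x)) S"
  unfolding holo_on_def
proof
  fix z assume "z \<in> S"
  then obtain D where D: "(f has_derivative D) (at z)"
    "\<And>x y. D (x + y) = D x + D y" "\<And>c x. D (c *s x) = c * D x"
    using f unfolding holo_on_def by metis
  have "(g has_field_derivative deriv g (f z)) (at (f z))"
    using g sub[OF \<open>z \<in> S\<close>] by (simp add: holomorphic_derivI)
  then have "(g has_derivative (*) (deriv g (f z))) (at (f z))" by (simp add: has_field_derivative_def)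
  from diff_chain_at[OF D(1) this]
  show "\<exists>D. ((\<lambda>x. g (f x)) has_derivative D) (at z)
      \<and> (\<forall>x y. D (x + y) = D x + D y) \<and> (\<forall>c x. D (c *s x) = c * D x)"
    by (intro exI[of _ "(*) (deriv g (f z)) \<circ> D"]) (auto simp: o_def D algebra_simps)
qed

section \<open>Complex lines and mean values over discs\<close>

lemma has_derivative_slice:
  fixes f :: "complex ^ 'n \<Rightarrow> complex"
  assumes D: "(f has_derivative D) (at (a + \<zeta> *s v))" "\<And>c x. D (c *s x) = c * D x"
  shows "((\<lambda>\<zeta>. f (a + \<zeta> *s v)) has_field_derivative D v) (at \<zeta>)"
proof -
  have "linear (\<lambda>\<zeta>. \<zeta> *s v)"
    by (rule linearI) (auto simp: scaleR_eq_vector_scalar_mult scaleR_conv_of_real[where 'a=complex]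
        vector_sadd_rdistrib)
  then have "((\<lambda>\<zeta>. a + \<zeta> *s v) has_derivative (\<lambda>\<zeta>. \<zeta> *s v)) (at \<zeta>)"
    by (auto intro!: derivative_eq_intros bounded_linear_imp_has_derivative simp: linear_conv_bounded_linear)
  from diff_chain_at[OF this D(1)]
  have "((\<lambda>\<zeta>. f (a + \<zeta> *s v)) has_derivative (\<lambda>\<zeta>. \<zeta> * D v)) (at \<zeta>)"
    by (simp add: o_def D)
  moreover have "(\<lambda>\<zeta>. \<zeta> * D v) = (*) (D v)" by auto
  ultimately show ?thesis unfolding has_field_derivative_def by simp
qed

lemma holo_on_slice:
  assumes f: "holo_on f S" and sub: "\<And>\<zeta>. \<zeta> \<in> T \<Longrightarrow> a + \<zeta> *s v \<in> S"
  shows "(\<lambda>\<zeta>. f (a + \<zeta> *s v)) holomorphic_on T"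
  unfolding holomorphic_on_def
proof
  fix \<zeta> assume "\<zeta> \<in> T"
  then obtain D where "(f has_derivative D) (at (a + \<zeta> *s v))" "\<And>c x. D (c *s x) = c * D x"
    using f sub unfolding holo_on_def by metis
  then have "((\<lambda>\<zeta>. f (a + \<zeta> *s v)) has_field_derivative D v) (at \<zeta>)"
    by (rule has_derivative_slice)
  then show "(\<lambda>\<zeta>. f (a + \<zeta> *s v)) field_differentiable at \<zeta> within T"
    using field_differentiable_at_within field_differentiable_def by blast
qed

text \<open>Cauchy's integral formula at the centre, parametrized by \<open>circlepath\<close>, with
  the absolute value taken under the integral.\<close>

lemma disc_mean_value_le:
  assumes h: "h holomorphic_on cball 0 1"
  shows "ennreal (norm (h 0)) \<le> (\<integral>\<^sup>+t. indicator {0..1} t * ennreal (norm (h (exp (2 * of_real pi * \<i> * of_real t)))) \<partial>lborel)"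
proof -
  define e where "e t = exp (2 * of_real pi * \<i> * of_real t)" for t :: real
  have e: "norm (e t) = 1" for t by (simp add: e_def norm_exp_eq_Re)
  have "((\<lambda>u. h u/(u-0)) has_contour_integral (2 * of_real pi * \<i> * h 0)) (circlepath 0 1)"
    by (rule Cauchy_integral_circlepath_simple[OF h]) simp
  then have "((\<lambda>t. h (e t) / e t * (2 * pi * \<i> * e t)) has_integral (2 * of_real pi * \<i> * h 0)) {0..1}"
    unfolding has_contour_integral vector_derivative_circlepath by (simp add: circlepath e_def mult_ac)
  moreover have "e t \<noteq> 0" for t using e[of t] by auto
  ultimately have "((\<lambda>t. (2 * pi * \<i>) * h (e t)) has_integral ((2 * of_real pi * \<i>) * h 0)) {0..1}"
    by (simp add: mult_ac)
  then have hi: "((\<lambda>t. h (e t)) has_integral h 0) {0..1}"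
    using has_integral_mult_right[of "\<lambda>t. (2 * pi * \<i>) * h (e t)" "(2 * of_real pi * \<i>) * h 0" "{0..1}" "1 / (2 * of_real pi * \<i>)"]
    by simp
  have "continuous_on {0..1} (\<lambda>t. h (e t))"
    by (rule continuous_on_compose2[OF holomorphic_on_imp_continuous_on[OF h]])
      (auto simp: e e_def[abs_def] norm_exp_eq_Re intro!: continuous_intros)
  then have si: "set_integrable lborel {0..1} (\<lambda>t. h (e t))" by (rule borel_integrable_atLeastAtMost')
  have "h 0 = (LINT t:{0..1}|lborel. h (e t))"
    using set_borel_integral_eq_integral(2)[OF si] integral_unique[OF hi] by simp
  then have "ennreal (norm (h 0)) \<le> (\<integral>\<^sup>+t. norm (indicator {0..1} t *\<^sub>R h (e t)) \<partial>lborel)"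
    using integral_norm_bound_ennreal[OF si[unfolded set_integrable_def]] by (simp add: set_lebesgue_integral_def)
  also have "\<dots> = (\<integral>\<^sup>+t. indicator {0..1} t * ennreal (norm (h (e t))) \<partial>lborel)"
    by (intro nn_integral_cong) (auto simp: indicator_def)
  finally show ?thesis by (simp add: e_def)
qed

text \<open>Each x in the ball spans a disc of points \<zeta> x, on which the one-variable mean
  value inequality holds. Integrating it over x and exchanging the integrals leaves, for each angle
  t, the integral of |g| composed with the isometry x -> e(t) x, which does not depend on t.\<close>

lemma submean_unit:
  fixes g :: "complex ^ 'n \<Rightarrow> complex"
  assumes g: "holo_on g (ball 0 1)"
  shows "ennreal (norm (g 0)) * emeasure lborel (ball (0 :: complex ^ 'n) 1)
    \<le> (\<integral>\<^sup>+x. ennreal (norm (g x)) * indicator (ball 0 1) x \<partial>lborel)"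
proof -
  define e where "e t = exp (2 * of_real pi * \<i> * of_real t)" for t :: real
  have e: "norm (e t) = 1" for t by (simp add: e_def norm_exp_eq_Re)
  have [measurable]: "e \<in> borel_measurable borel"
    unfolding e_def by (intro borel_measurable_continuous_onI continuous_intros)
  define G where "G x = norm (indicator (ball 0 1) x *\<^sub>R g x)" for x
  have [measurable]: "G \<in> borel_measurable borel"
    unfolding G_def using holo_on_imp_measurable[OF g] by measurable
  have G: "ennreal (G x) = ennreal (norm (g x)) * indicator (ball 0 1) x" for x
    by (auto simp: G_def indicator_def)
  have [measurable]: "(\<lambda>(x :: complex ^ 'n, t). e t *s x) \<in> borel_measurable (lborel \<Otimes>\<^sub>M lborel)"
  proof -
    have "continuous_on UNIV (\<lambda>p :: (complex ^ 'n) \<times> real. e (snd p) *s fst p)"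
      unfolding e_def by (intro continuous_intros)
    from borel_measurable_continuous_onI[OF this] show ?thesis
      by (simp add: case_prod_beta' lborel_prod)
  qed
  have "ennreal (norm (g 0)) * emeasure lborel (ball (0 :: complex ^ 'n) 1)
      = (\<integral>\<^sup>+x. ennreal (norm (g 0)) * indicator (ball (0 :: complex ^ 'n) 1) x \<partial>lborel)"
    by (simp add: nn_integral_cmult_indicator)
  also have "\<dots> \<le> (\<integral>\<^sup>+x. (\<integral>\<^sup>+t. indicator {0..1} t * ennreal (G (e t *s x)) \<partial>lborel) \<partial>lborel)"
  proof (rule nn_integral_mono)
    fix x :: "complex ^ 'n"
    show "ennreal (norm (g 0)) * indicator (ball (0 :: complex ^ 'n) 1) x
        \<le> (\<integral>\<^sup>+t. indicator {0..1} t * ennreal (G (e t *s x)) \<partial>lborel)"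
    proof (cases "x \<in> ball 0 1")
      case True
      have in_ball: "0 + \<zeta> *s x \<in> ball 0 1" if "\<zeta> \<in> cball 0 1" for \<zeta>
      proof -
        have "norm \<zeta> * norm x \<le> 1 * norm x" using that by (intro mult_right_mono) auto
        then show ?thesis using True by (simp add: norm_vector_scalar_mult)
      qed
      have "(\<lambda>\<zeta>. g (0 + \<zeta> *s x)) holomorphic_on cball 0 1"
        by (rule holo_on_slice[OF g in_ball])
      from disc_mean_value_le[OF this]
      have "ennreal (norm (g 0)) \<le> (\<integral>\<^sup>+t. indicator {0..1} t * ennreal (norm (g (e t *s x))) \<partial>lborel)"
        by (simp add: e_def)
      also have "\<dots> = (\<integral>\<^sup>+t. indicator {0..1} t * ennreal (G (e t *s x)) \<partial>lborel)"
        using True by (intro nn_integral_cong) (auto simp: G_def norm_vector_scalar_mult e)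
      finally show ?thesis using True by simp
    qed simp
  qed
  also have "\<dots> = (\<integral>\<^sup>+t. (\<integral>\<^sup>+x. indicator {0..1} t * ennreal (G (e t *s x)) \<partial>lborel) \<partial>lborel)"
    by (rule lborel_pair.Fubini'[symmetric]) measurable
  also have "\<dots> = (\<integral>\<^sup>+t. indicator {0..1::real} t * (\<integral>\<^sup>+x. ennreal (G x) \<partial>lborel) \<partial>lborel)"
  proof (rule nn_integral_cong)
    fix t
    have lin: "linear ((*s) (e t) :: complex ^ 'n \<Rightarrow> _)"
      by (rule linearI) (auto simp: vec_eq_iff algebra_simps)
    have [measurable]: "(*s) (e t) \<in> borel_measurable (borel :: (complex ^ 'n) measure)"
      by (intro borel_measurable_continuous_onI continuous_intros)
    have "(\<integral>\<^sup>+x. indicator {0..1} t * ennreal (G (e t *s x)) \<partial>lborel)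
        = indicator {0..1} t * (\<integral>\<^sup>+x. ennreal (G (e t *s x)) \<partial>lborel)"
      by (rule nn_integral_cmult) measurable
    also have "(\<integral>\<^sup>+x. ennreal (G (e t *s x)) \<partial>lborel) = (\<integral>\<^sup>+x. ennreal (G x) \<partial>lborel)"
      by (rule nn_integral_linear_isometry[OF lin]) (auto simp: norm_vector_scalar_mult e)
    finally show "(\<integral>\<^sup>+x. indicator {0..1} t * ennreal (G (e t *s x)) \<partial>lborel)
        = indicator {0..1} t * (\<integral>\<^sup>+x. ennreal (G x) \<partial>lborel)" .
  qed
  also have "\<dots> = (\<integral>\<^sup>+x. ennreal (G x) \<partial>lborel)"
    by (subst mult.commute, subst nn_integral_cmult_indicator) auto
  finally show ?thesis by (simp add: G)
qed

text \<open>Exponent and constant are left open because this is applied twice: with exponent 1 on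
  the way to exponents p <= 1, and then with the final exponent.\<close>

lemma submean_rescale:
  fixes g :: "complex ^ 'n \<Rightarrow> complex"
  assumes unit: "\<And>g :: complex ^ 'n \<Rightarrow> complex. holo_on g (ball 0 1) \<Longrightarrow>
      ennreal (norm (g 0) powr p) \<le> K * (\<integral>\<^sup>+x. ennreal (norm (g x) powr p) * indicator (ball 0 1) x \<partial>lborel)"
    and g: "holo_on g (ball a r)" and r: "r > 0"
  shows "ennreal (norm (g a) powr p) * ennreal (r ^ DIM(complex ^ 'n))
    \<le> K * (\<integral>\<^sup>+x. ennreal (norm (g x) powr p) * indicator (ball a r) x \<partial>lborel)"
proof -
  have "holo_on (\<lambda>x. g (a + r *\<^sub>R x)) (ball 0 1)"
    by (rule holo_on_affine[OF g])
      (use r in \<open>auto simp: scaleR_add_right dist_norm scaleR_eq_vector_scalar_mult mult.commute norm_vector_scalar_mult\<close>)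
  from unit[OF this]
  have 1: "ennreal (norm (g a) powr p)
      \<le> K * (\<integral>\<^sup>+x. ennreal (norm (g (a + r *\<^sub>R x)) powr p) * indicator (ball 0 1) x \<partial>lborel)" by simp
  have eq: "ennreal (norm (g x) powr p) * indicator (ball a r) x
      = ennreal (norm (indicator (ball a r) x *\<^sub>R g x) powr p) * indicator (ball a r) x" for x
    by (auto simp: indicator_def)
  have [measurable]: "ball a r \<in> sets borel" by simp
  have [measurable]: "(\<lambda>x. ennreal (norm (g x) powr p) * indicator (ball a r) x) \<in> borel_measurable borel"
    unfolding eq using holo_on_imp_measurable[OF g] by measurable
  have "(\<integral>\<^sup>+x. ennreal (norm (g x) powr p) * indicator (ball a r) x \<partial>lborel)
     = ennreal (r ^ DIM(complex ^ 'n)) * (\<integral>\<^sup>+x. ennreal (norm (g (a + r *\<^sub>R x)) powr p) * indicator (ball a r) (a + r *\<^sub>R x) \<partial>lborel)"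
    by (rule nn_integral_lborel_scale[OF _ r]) measurable
  also have "(\<lambda>x. indicator (ball a r) (a + r *\<^sub>R x)) = (indicator (ball 0 1) :: complex ^ 'n \<Rightarrow> ennreal)"
    using r by (auto simp: indicator_def dist_norm fun_eq_iff)
  finally show ?thesis using mult_right_mono[OF 1, of "ennreal (r ^ DIM(complex ^ 'n))"]
    by (simp add: mult_ac)
qed

section \<open>Submean values\<close>

text \<open>At a maximum point of \<open>|g|\<^sup>p (1/2 - |x|)\<^sup>m\<close> the values of \<open>|g|\<close> nearby are comparable to the one there,
  so \<open>|g|\<close> may be replaced by a multiple of \<open>|g|\<^sup>p\<close> in the submean inequality for exponent 1.\<close>
lemma submean_unit_le_one:
  assumes p: "0 < p" "p \<le> 1"
  obtains K where "K > 0" "\<And>g :: complex ^ 'n \<Rightarrow> complex. holo_on g (ball 0 1) \<Longrightarrow>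
    ennreal (norm (g 0) powr p) \<le> ennreal K * (\<integral>\<^sup>+x. ennreal (norm (g x) powr p) * indicator (ball 0 1) x \<partial>lborel)"
proof -
  define m where "m = DIM(complex ^ 'n)"
  define V where "V = measure lborel (ball (0 :: complex ^ 'n) 1)"
  have V: "V > 0" "emeasure lborel (ball (0 :: complex ^ 'n) 1) = ennreal V"
    by (simp_all add: V_def content_ball unit_ball_vol_pos emeasure_ball)
  \<comment> \<open>\<open>4 ^ m\<close> comes from comparing the weights at 0 and at the maximum
    point, the middle factor is \<open>M powr (1 - p)\<close> without its power of A, and 1 / V is
    the constant for exponent 1.\<close>
  define K where "K = 4 ^ m * (2 powr (m / p)) powr (1 - p) / V"
  have unit1: "ennreal (norm (g 0) powr 1)
      \<le> ennreal (1 / V) * (\<integral>\<^sup>+x. ennreal (norm (g x) powr 1) * indicator (ball 0 1) x \<partial>lborel)"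
    if "holo_on g (ball 0 1)" for g :: "complex ^ 'n \<Rightarrow> complex"
  proof -
    have "ennreal (norm (g 0) powr 1) = ennreal (1 / V) * (ennreal (norm (g 0)) * ennreal V)"
      using V(1) by (simp flip: ennreal_mult' ennreal_mult)
    also have "\<dots> \<le> ennreal (1 / V) * (\<integral>\<^sup>+x. ennreal (norm (g x) powr 1) * indicator (ball 0 1) x \<partial>lborel)"
      using submean_unit[OF that] by (intro mult_left_mono) (auto simp: V)
    finally show ?thesis .
  qed
  have main: "ennreal (norm (g 0) powr p) \<le> ennreal K * (\<integral>\<^sup>+x. ennreal (norm (g x) powr p) * indicator (ball 0 1) x \<partial>lborel)"
    if g: "holo_on g (ball 0 1)" for g :: "complex ^ 'n \<Rightarrow> complex"
  proof -
    define I where "I = (\<integral>\<^sup>+x. ennreal (norm (g x) powr p) * indicator (ball 0 1) x \<partial>lborel)"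
    define \<phi> where "\<phi> x = norm (g x) powr p * (1 / 2 - norm x) ^ m" for x
    have "continuous_on (cball 0 (1 / 2)) g"
      by (rule continuous_on_subset[OF holo_on_imp_continuous_on[OF g]]) auto
    then have "continuous_on (cball 0 (1 / 2)) \<phi>"
      unfolding \<phi>_def by (intro continuous_intros continuous_on_powr') (use p in auto)
    then obtain x0 where x0: "x0 \<in> cball 0 (1 / 2)" "\<And>y. y \<in> cball 0 (1 / 2) \<Longrightarrow> \<phi> y \<le> \<phi> x0"
      using continuous_attains_sup[of "cball 0 (1 / 2)" \<phi>] by auto
    \<comment> \<open>With half the distance from x0 to the sphere of radius 1/2, the factor 1/2 -
      |y| stays above \<rho>, half its value at x0, on the ball of radius \<rho> about x0.
      Maximality then costs only 2^m.\<close>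
    define \<rho> where "\<rho> = (1 / 2 - norm x0) / 2"
    define A where "A = norm (g x0)"
    have max0: "norm (g 0) powr p * (1 / 2) ^ m \<le> A powr p * (2 * \<rho>) ^ m"
    proof -
      have "2 * \<rho> = 1 / 2 - norm x0" by (simp add: \<rho>_def)
      then show ?thesis using x0(2)[of 0] by (simp add: \<phi>_def A_def)
    qed
    have \<rho>0: "\<rho> \<ge> 0" using x0(1) by (simp add: \<rho>_def)
    \<comment> \<open>If A = 0 or \<rho> = 0, the maximum of \<phi> is 0 and hence g vanishes at 0;
      if I is infinite the claim is trivial. Otherwise A and \<rho> can be cancelled.\<close>
    show ?thesis
    proof (cases "I = top \<or> A = 0 \<or> \<rho> = 0")
      case True
      then consider "I = top" | "A = 0 \<or> \<rho> = 0" by blast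
      then show ?thesis
      proof cases
        case 1
        have "K > 0" using V by (simp add: K_def)
        then show ?thesis using 1 by (simp add: I_def[symmetric] ennreal_mult_top)
      next
        case 2
        have "m > 0" by (simp add: m_def)
        then have "norm (g 0) powr p * (1 / 2) ^ m \<le> 0" using 2 max0 p by (auto simp: power_0_left)
        moreover have "(1 / 2 :: real) ^ m > 0" by simp
        ultimately have "norm (g 0) powr p \<le> 0" by (metis mult_le_0_iff not_le)
        then have "g 0 = 0" using p by simp
        then show ?thesis using p by simp
      qed
    next
      case False
      then have pos: "A > 0" "\<rho> > 0" using \<rho>0 by (auto simp: A_def)
      obtain i where i: "I = ennreal i" "i \<ge> 0" using False by (cases I) auto
      \<comment> \<open>M is the bound for |g| near x0 that maximality yields: |g|^p <= 2^m A^p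
        there.\<close>
      define M where "M = 2 powr (m / p) * A"
      have M: "M > 0" using pos by (simp add: M_def)
      have sub: "ball x0 \<rho> \<subseteq> ball 0 1"
      proof
        fix y assume "y \<in> ball x0 \<rho>"
        then have "norm y \<le> norm x0 + \<rho>" using norm_triangle_sub[of y x0] by (simp add: dist_norm norm_minus_commute)
        moreover have "norm x0 \<le> 1 / 2" using x0(1) by simp
        ultimately have "norm y < 1" unfolding \<rho>_def by argo
        then show "y \<in> ball 0 1" by simp
      qed
      have bd: "norm (g y) \<le> norm (g y) powr p * M powr (1 - p)" if y: "y \<in> ball x0 \<rho>" for y
      proof -
        have ny: "norm y \<le> norm x0 + \<rho>"
          using norm_triangle_sub[of y x0] y by (simp add: dist_norm norm_minus_commute)
        then have "\<rho> \<le> 1 / 2 - norm y" unfolding \<rho>_def by argo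
        then have "norm (g y) powr p * \<rho> ^ m \<le> \<phi> y"
          using \<rho>0 unfolding \<phi>_def by (intro mult_left_mono power_mono) auto
        also have "\<dots> \<le> \<phi> x0"
        proof (rule x0(2))
          have "norm x0 \<le> 1 / 2" using x0(1) by simp
          then have "norm y \<le> 1 / 2" using ny unfolding \<rho>_def by argo
          then show "y \<in> cball 0 (1 / 2)" by simp
        qed
        also have "\<phi> x0 = A powr p * 2 ^ m * \<rho> ^ m" by (simp add: \<phi>_def A_def \<rho>_def power_divide)
        finally have "norm (g y) powr p \<le> A powr p * 2 ^ m" using pos by simp
        also have "\<dots> = M powr p"
          using p pos by (simp add: M_def powr_mult powr_powr powr_realpow)
        finally have "norm (g y) powr p \<le> M powr p" .
        then have "norm (g y) \<le> M"
          using powr_less_mono2[of p M "norm (g y)"] p M by linarith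
        then have le: "norm (g y) powr (1 - p) \<le> M powr (1 - p)" using p by (intro powr_mono2) auto
        have "norm (g y) = norm (g y) powr p * norm (g y) powr (1 - p)"
          by (cases "g y = 0") (use p in \<open>auto simp flip: powr_add\<close>)
        also have "\<dots> \<le> norm (g y) powr p * M powr (1 - p)" using le by (intro mult_left_mono) auto
        finally show ?thesis .
      qed
      have "ennreal (A powr 1) * ennreal (\<rho> ^ m)
          \<le> ennreal (1 / V) * (\<integral>\<^sup>+x. ennreal (norm (g x) powr 1) * indicator (ball x0 \<rho>) x \<partial>lborel)"
        unfolding A_def m_def
        by (rule submean_rescale[OF unit1 holo_on_subset[OF g sub] pos(2)])
      also have "\<dots> \<le> ennreal (1 / V) * (\<integral>\<^sup>+x. ennreal (M powr (1 - p)) * (ennreal (norm (g x) powr p) * indicator (ball 0 1) x) \<partial>lborel)"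
      proof (intro mult_left_mono nn_integral_mono)
        fix x
        show "ennreal (norm (g x) powr 1) * indicator (ball x0 \<rho>) x
            \<le> ennreal (M powr (1 - p)) * (ennreal (norm (g x) powr p) * indicator (ball 0 1) x)"
          using bd[of x] sub by (auto simp: indicator_def mult.commute simp flip: ennreal_mult intro!: ennreal_leI)
      qed simp
      also have "\<dots> = ennreal (1 / V) * (ennreal (M powr (1 - p)) * I)"
      proof -
        have eq: "ennreal (norm (g x) powr p) * indicator (ball 0 1) x
          = ennreal (norm (indicator (ball 0 1) x *\<^sub>R g x) powr p) * indicator (ball 0 1) x" for x
          by (auto simp: indicator_def)
        have [measurable]: "ball (0 :: complex ^ 'n) 1 \<in> sets borel" by simp
        have [measurable]: "(\<lambda>x. ennreal (norm (g x) powr p) * indicator (ball 0 1) x) \<in> borel_measurable borel"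
          unfolding eq using holo_on_imp_measurable[OF g] by measurable
        show ?thesis unfolding I_def by (subst nn_integral_cmult) auto
      qed
      also have "\<dots> = ennreal (M powr (1 - p) * i / V)"
        using V i by (simp flip: ennreal_mult)
      finally have "ennreal (A * \<rho> ^ m) \<le> ennreal (M powr (1 - p) * i / V)"
        using pos by (simp flip: ennreal_mult)
      then have le: "A * \<rho> ^ m \<le> M powr (1 - p) * i / V"
        using V i by (subst (asm) ennreal_le_iff) auto
      have Mp: "M powr (1 - p) = (2 powr (m / p)) powr (1 - p) * A powr (1 - p)"
        using pos by (simp add: M_def powr_mult)
      have Ap: "A powr (1 - p) * A powr p = A" using pos by (simp flip: powr_add)
      \<comment> \<open>The right side carries A only to the power 1 - p, so cancelling it leaves
        A^p, as wanted; this absorbs the maximum into the left side.\<close>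
      have "A powr (1 - p) * (A powr p * \<rho> ^ m) = A * \<rho> ^ m"
        by (simp only: mult.assoc[symmetric] Ap)
      also have "\<dots> \<le> A powr (1 - p) * ((2 powr (m / p)) powr (1 - p) * i / V)"
        using le unfolding Mp by (simp only: mult_ac times_divide_eq_right times_divide_eq_left)
      finally have "A powr (1 - p) * (A powr p * \<rho> ^ m) \<le> A powr (1 - p) * ((2 powr (m / p)) powr (1 - p) * i / V)" .
      then have "A powr p * \<rho> ^ m \<le> (2 powr (m / p)) powr (1 - p) * i / V"
        using pos by (subst (asm) mult_le_cancel_left_pos) auto
      from mult_left_mono[OF this, of "4 ^ m"] have "4 ^ m * (A powr p * \<rho> ^ m) \<le> K * i"
        by (simp add: K_def mult.assoc)
      moreover have "norm (g 0) powr p \<le> 4 ^ m * (A powr p * \<rho> ^ m)"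
      proof -
        have "norm (g 0) powr p = 2 ^ m * (norm (g 0) powr p * (1 / 2) ^ m)" by (simp add: power_divide)
        also have "\<dots> \<le> 2 ^ m * (A powr p * (2 * \<rho>) ^ m)" using max0 by (rule mult_left_mono) simp
        also have "\<dots> = 4 ^ m * (A powr p * \<rho> ^ m)"
        proof -
          have "(4::real) ^ m = 2 ^ m * 2 ^ m" by (simp flip: power_mult_distrib)
          then show ?thesis by (simp add: power_mult_distrib)
        qed
        finally show ?thesis .
      qed
      ultimately have "norm (g 0) powr p \<le> K * i" by simp
      then show ?thesis using V i unfolding I_def[symmetric]
        by (simp add: ennreal_leI K_def flip: ennreal_mult)
    qed
  qed
  have "K > 0" using V by (simp add: K_def)
  with main show thesis by (rule that[rotated])
qed

text \<open>Exponents above 1 reduce to the previous case by replacing \<open>g\<close> with a power.\<close>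
lemma submean:
  assumes p: "0 < p"
  obtains K where "K > 0" "\<And>(g :: complex ^ 'n \<Rightarrow> complex) a r. holo_on g (ball a r) \<Longrightarrow> r > 0 \<Longrightarrow>
    ennreal (norm (g a) powr p) * ennreal (r ^ (2 * CARD('n)))
     \<le> ennreal K * (\<integral>\<^sup>+x. ennreal (norm (g x) powr p) * indicator (ball a r) x \<partial>lborel)"
proof -
  obtain k :: nat where k: "p \<le> real k" using real_arch_simple by blast
  with p have k0: "k > 0" by (cases k) auto
  obtain K where K: "K > 0" "\<And>g :: complex ^ 'n \<Rightarrow> complex. holo_on g (ball 0 1) \<Longrightarrow>
    ennreal (norm (g 0) powr (p / k)) \<le> ennreal K * (\<integral>\<^sup>+x. ennreal (norm (g x) powr (p / k)) * indicator (ball 0 1) x \<partial>lborel)"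
    using submean_unit_le_one[of "p / k"] p k k0 by auto
  have eq: "norm (g x ^ k) powr (p / k) = norm (g x) powr p" for g :: "complex ^ 'n \<Rightarrow> complex" and x
  proof -
    have "norm (g x ^ k) powr (p / k) = (norm (g x) powr real k) powr (p / k)"
      using k0 by (simp add: norm_power powr_realpow')
    then show ?thesis using k0 by (simp add: powr_powr)
  qed
  have unit: "ennreal (norm (g 0) powr p) \<le> ennreal K * (\<integral>\<^sup>+x. ennreal (norm (g x) powr p) * indicator (ball 0 1) x \<partial>lborel)"
    if "holo_on g (ball 0 1)" for g :: "complex ^ 'n \<Rightarrow> complex"
    using K(2)[OF holo_on_power[OF that, of k]] unfolding eq .
  show thesis
  proof (rule that[OF K(1)])
    fix g :: "complex ^ 'n \<Rightarrow> complex" and a r assume "holo_on g (ball a r)" "r > 0"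
    from submean_rescale[OF unit this]
    show "ennreal (norm (g a) powr p) * ennreal (r ^ (2 * CARD('n)))
     \<le> ennreal K * (\<integral>\<^sup>+x. ennreal (norm (g x) powr p) * indicator (ball a r) x \<partial>lborel)"
      by (simp add: mult.commute)
  qed
qed

section \<open>Anisotropic ellipsoids and the weighted measure\<close>

text \<open>The ellipsoid has size R/2 along u and \<open>sqrt R / 2\<close> across it, small enough
  that 1 - |x|^2 remains comparable to R. For the last claim put d = |1 -
  \<langle>w,\<xi>\<rangle>|. Moving along u changes the form by at most R/2 <= d/2. Moving across
  sees only the component \<xi>' of \<xi> orthogonal to u; since |\<xi>'|^2 <= 2d and R <= d, the
  change is of order \<open>sqrt R\<close> |\<xi>'|, again of order d.\<close>

lemma aniso_geometry:
  fixes u z \<xi> :: "complex ^ 'n"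
  assumes u: "norm u = 1" and \<xi>: "norm \<xi> = 1" and \<rho>: "0 \<le> \<rho>" "\<rho> < 1" and z: "norm z < 1"
  defines "R \<equiv> 1 - \<rho>" and "w \<equiv> \<rho> *\<^sub>R u"
  defines "x \<equiv> w + (1 / 2) *\<^sub>R aniso R u z"
  shows "R \<le> 2 * (1 - (norm x)\<^sup>2)" "1 - (norm x)\<^sup>2 \<le> 3 * R"
    "norm (1 - herm x \<xi>) \<le> 3 * norm (1 - herm w \<xi>)"
proof -
  define a where "a = herm z u"
  define z' where "z' = z - a *s u"
  define b where "b = norm a"
  have R: "0 < R" "R \<le> 1" using \<rho> by (auto simp: R_def)
  have z': "(norm z')\<^sup>2 = (norm z)\<^sup>2 - b\<^sup>2" unfolding z'_def a_def b_def by (rule norm_sq_decomp[OF u])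
  have z1: "(norm z)\<^sup>2 \<le> 1" using z by (simp add: power_le_one)
  have b1: "b \<le> 1" using norm_herm_le[of z u] z u by (simp add: a_def b_def)
  have b0: "b \<ge> 0" by (simp add: b_def)
  have hu: "herm u u = 1" by (simp add: herm_self u)
  have hz': "herm z' u = 0" by (simp add: z'_def herm_diff_left herm_scale_left hu a_def)
  have xe: "x = (of_real \<rho> + of_real R * a / 2) *s u + of_real (sqrt R / 2) *s z'"
    by (simp add: x_def w_def aniso_def z'_def a_def scaleR_eq_vector_scalar_mult vec_eq_iff field_simps)
  have hx: "herm x u = of_real \<rho> + of_real R * a / 2"
    by (simp add: xe herm_add_left herm_scale_left hz' hu)
  have "x - herm x u *s u = of_real (sqrt R / 2) *s z'" unfolding hx by (simp add: xe)
  then have "(norm x)\<^sup>2 = (norm (of_real (sqrt R / 2) *s z'))\<^sup>2 + (norm (herm x u))\<^sup>2"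
    using norm_sq_decomp[OF u, of x] by simp
  also have "(norm (of_real (sqrt R / 2) *s z'))\<^sup>2 = R / 4 * (norm z')\<^sup>2"
    using R by (simp add: norm_vector_scalar_mult power_mult_distrib norm_divide power_divide)
  finally have nx: "(norm x)\<^sup>2 = R / 4 * (norm z')\<^sup>2 + (norm (herm x u))\<^sup>2" .
  have "norm (herm x u) \<le> \<rho> + R * b / 2"
    unfolding hx b_def using norm_triangle_ineq[of "of_real \<rho>" "of_real R * a / 2"] R \<rho> by (simp add: norm_mult norm_divide)
  then have hxu: "(norm (herm x u))\<^sup>2 \<le> (\<rho> + R * b / 2)\<^sup>2" by (rule power_mono) simp
  have hz4: "R / 4 * (norm z')\<^sup>2 \<le> R / 4 * (1 - b\<^sup>2)" using z' z1 R by (intro mult_left_mono) auto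
  have "(norm x)\<^sup>2 \<le> R / 4 * (1 - b\<^sup>2) + (1 - R * (1 - b / 2))\<^sup>2"
  proof -
    have "\<rho> + R * b / 2 = 1 - R * (1 - b / 2)" by (simp add: R_def algebra_simps)
    from hxu[unfolded this] hz4 show ?thesis unfolding nx by linarith
  qed
  also have "(1 - R * (1 - b / 2))\<^sup>2 \<le> 1 - 2 * R * (1 - b / 2) + R * (1 - b / 2)\<^sup>2"
  proof -
    have "R\<^sup>2 * (1 - b / 2)\<^sup>2 \<le> R * (1 - b / 2)\<^sup>2"
      using R by (intro mult_right_mono) (auto simp: power2_eq_square mult_le_one)
    then show ?thesis by (simp add: power2_eq_square algebra_simps)
  qed
  \<comment> \<open>All terms in b cancel, so the bound does not depend on the direction in which x
    deviates from w.\<close>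
  also have "R / 4 * (1 - b\<^sup>2) + (1 - 2 * R * (1 - b / 2) + R * (1 - b / 2)\<^sup>2) = 1 - 3 / 4 * R"
    by (simp add: power2_eq_square field_simps)
  finally have nx1: "(norm x)\<^sup>2 \<le> 1 - 3 / 4 * R" by simp
  then show "R \<le> 2 * (1 - (norm x)\<^sup>2)" using R by simp
  have x1: "norm x \<le> 1" using nx1 R by (simp add: power2_le_imp_le[of _ 1])
  have "norm (herm x u) \<ge> \<rho> - R * b / 2"
    unfolding hx b_def using norm_diff_ineq[of "of_real \<rho>" "of_real R * a / 2"] R \<rho> by (simp add: norm_mult norm_divide)
  moreover have "norm (herm x u) \<le> norm x" using norm_herm_le[of x u] u by simp
  moreover have "R * b \<le> R" using R b1 by (simp add: mult_left_le)
  ultimately have "1 - norm x \<le> 3 / 2 * R" by (simp add: R_def)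
  moreover have "1 - (norm x)\<^sup>2 \<le> 2 * (1 - norm x)"
    using x1 zero_le_power2[of "1 - norm x"] by (simp add: power2_eq_square algebra_simps)
  ultimately show "1 - (norm x)\<^sup>2 \<le> 3 * R" by simp
  define d where "d = norm (1 - herm w \<xi>)"
  define h where "h = norm (herm \<xi> u)"
  have h': "norm (herm u \<xi>) = h" unfolding h_def by (metis cnj_herm complex_mod_cnj)
  have h1: "h \<le> 1" "h \<ge> 0" using norm_herm_le[of \<xi> u] u \<xi> by (auto simp: h_def)
  have "d \<ge> 1 - \<rho> * h"
    using norm_triangle_ineq2[of 1 "herm w \<xi>"] \<rho> by (simp add: d_def w_def herm_scaleR_left norm_mult h')
  moreover have "\<rho> * h \<le> h" "\<rho> * h \<le> \<rho>" using \<rho> h1 by (simp_all add: mult_left_le mult_left_le_one_le)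
  ultimately have d: "1 - h \<le> d" "R \<le> d" by (auto simp: R_def)
  \<comment> \<open>d >= 1 - h with h = |\<langle>\<xi>,u\<rangle>| says that \<xi> is nearly
    parallel to u when d is small, which bounds the orthogonal part of \<xi>.\<close>
  define \<xi>' where "\<xi>' = \<xi> - herm \<xi> u *s u"
  have "(norm \<xi>')\<^sup>2 = 1 - h\<^sup>2" unfolding \<xi>'_def h_def using norm_sq_decomp[OF u, of \<xi>] \<xi> by simp
  also have "\<dots> \<le> 2 * d"
    using d h1 zero_le_power2[of "1 - h"] by (simp add: power2_eq_square algebra_simps)
  finally have \<xi>': "(norm \<xi>')\<^sup>2 \<le> 2 * d" .
  have "(sqrt R * norm \<xi>')\<^sup>2 \<le> (2 * d)\<^sup>2"
  proof -
    have "(sqrt R * norm \<xi>')\<^sup>2 = R * (norm \<xi>')\<^sup>2" using R by (simp add: power_mult_distrib)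
    also have "\<dots> \<le> d * (2 * d)" using R d \<xi>' by (intro mult_mono) auto
    also have "\<dots> \<le> (2 * d)\<^sup>2" by (simp add: power2_eq_square)
    finally show ?thesis .
  qed
  then have sq: "sqrt R * norm \<xi>' \<le> 2 * d" by (rule power2_le_imp_le) (use d R in auto)
  have "(norm z')\<^sup>2 \<le> 1" using z' z1 zero_le_power2[of b] by linarith
  then have nz': "norm z' \<le> 1" by (simp add: power2_le_imp_le[of _ 1])
  have "herm z' \<xi> = herm z' \<xi>'" by (simp add: \<xi>'_def herm_diff_right herm_scale_right hz')
  then have "norm (herm z' \<xi>) \<le> norm z' * norm \<xi>'" by (simp add: norm_herm_le)
  also have "\<dots> \<le> norm \<xi>'" using nz' by (simp add: mult_left_le_one_le)
  finally have hz\<xi>: "norm (herm z' \<xi>) \<le> norm \<xi>'" .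
  have "1 - herm x \<xi> = (1 - herm w \<xi>) - (of_real R * a / 2 * herm u \<xi> + of_real (sqrt R / 2) * herm z' \<xi>)"
    by (simp add: xe w_def herm_add_left herm_scale_left herm_scaleR_left algebra_simps)
  then have "norm (1 - herm x \<xi>) \<le> d + norm (of_real R * a / 2 * herm u \<xi> + of_real (sqrt R / 2) * herm z' \<xi>)"
    unfolding d_def by (metis norm_triangle_ineq4)
  also have "\<dots> \<le> d + (norm (of_real R * a / 2 * herm u \<xi>) + norm (of_real (sqrt R / 2) * herm z' \<xi>))"
    by (intro add_left_mono norm_triangle_ineq)
  finally have tri: "norm (1 - herm x \<xi>) \<le> d + (norm (of_real R * a / 2 * herm u \<xi>) + norm (of_real (sqrt R / 2) * herm z' \<xi>))" .
  have t1: "norm (of_real R * a / 2 * herm u \<xi>) \<le> d / 2"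
  proof -
    have "norm (of_real R * a / 2 * herm u \<xi>) = R * (b * h) / 2"
      using R by (simp add: norm_mult norm_divide b_def h')
    moreover have "R * (b * h) \<le> R * 1" using R b1 h1 b0 by (intro mult_left_mono) (auto simp: mult_le_one)
    ultimately show ?thesis using d by simp
  qed
  have t2: "norm (of_real (sqrt R / 2) * herm z' \<xi>) \<le> d"
  proof -
    have "norm (of_real (sqrt R / 2) * herm z' \<xi>) = sqrt R * norm (herm z' \<xi>) / 2"
      using R by (simp add: norm_mult norm_divide)
    moreover have "sqrt R * norm (herm z' \<xi>) \<le> sqrt R * norm \<xi>'" using R hz\<xi> by (intro mult_left_mono) auto
    ultimately show ?thesis using sq by simp
  qed
  show "norm (1 - herm x \<xi>) \<le> 3 * norm (1 - herm w \<xi>)"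
    using tri t1 t2 d R unfolding d_def[symmetric] by linarith
qed

text \<open>The absolute value in the exponent of c covers weights with positive and negative
  \<alpha> at once.\<close>

lemma powr_comparable:
  fixes x y c a :: real
  assumes "0 < x" "0 < y" "x \<le> c * y" "y \<le> c * x" "1 \<le> c"
  shows "x powr a \<le> c powr \<bar>a\<bar> * y powr a"
proof (cases "a \<ge> 0")
  case True
  then have "x powr a \<le> (c * y) powr a" using assms by (intro powr_mono2) auto
  then show ?thesis using True assms by (simp add: powr_mult)
next
  case False
  then have "x powr a \<le> (y / c) powr a"
    using assms by (intro powr_mono2') (auto simp: field_simps)
  also have "\<dots> = c powr \<bar>a\<bar> * y powr a"
    using False assms by (simp add: powr_divide powr_minus_divide)
  finally show ?thesis .
qed

text \<open>v_\<alpha> up to a constant factor, but as a measure on the whole space that vanishes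
  off the ball: Borel functions, translations and dilations then need no restriction.\<close>

definition weighted_lborel :: "real \<Rightarrow> (complex ^ 'n) measure" where
  "weighted_lborel \<alpha> = density lborel (\<lambda>z. ennreal ((1 - (norm z)\<^sup>2) powr \<alpha>) * indicator (ball 0 1) z)"

lemma sets_weighted_lborel [measurable_cong]: "sets (weighted_lborel \<alpha>) = sets borel"
  by (simp add: weighted_lborel_def)

lemma measurable_weighted_lborel_weight [measurable]:
  "(\<lambda>z :: complex ^ 'n. ennreal ((1 - (norm z)\<^sup>2) powr \<alpha>) * indicator (ball 0 1) z) \<in> borel_measurable borel"
proof -
  have [measurable]: "ball (0 :: complex ^ 'n) 1 \<in> sets borel" by simp
  show ?thesis by measurable
qed

lemma nn_integral_weighted_lborel:
  assumes "F \<in> borel_measurable borel"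
  shows "(\<integral>\<^sup>+z. F z \<partial>weighted_lborel \<alpha>) = (\<integral>\<^sup>+z. ennreal ((1 - (norm z)\<^sup>2) powr \<alpha>) * indicator (ball 0 1) z * F z \<partial>lborel)"
  unfolding weighted_lborel_def using assms by (subst nn_integral_density) auto

lemma holo_on_measurable_powr:
  assumes f: "holo_on f (ball 0 1)"
  shows "(\<lambda>x. ennreal (norm (f x) powr p) * indicator (ball 0 1) x) \<in> borel_measurable borel"
proof -
  have eq: "ennreal (norm (f x) powr p) * indicator (ball 0 1) x
      = ennreal (norm (indicator (ball 0 1) x *\<^sub>R f x) powr p) * indicator (ball 0 1) x" for x
    by (auto simp: indicator_def)
  have [measurable]: "ball (0 :: complex ^ 'n) 1 \<in> sets borel" by simp
  show ?thesis
    unfolding eq using holo_on_imp_measurable[OF f] by measurable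
qed

text \<open>The submean inequality on the unit ball is applied to f composed with the map onto the
  ellipsoid. The Jacobian contributes R^(n + 1) and the weight, comparable to R^\<alpha> on the
  ellipsoid, the rest of the exponent. The indicator retains of the ellipsoid only its position
  relative to \<xi>; estimating it by 1 gives the growth bound.\<close>

lemma submean_aniso:
  fixes \<alpha> p :: real
  assumes p: "0 < p"
  obtains K where "K > 0" "\<And>(f :: complex ^ 'n \<Rightarrow> complex) \<xi> w. holo_on f (ball 0 1) \<Longrightarrow> norm \<xi> = 1 \<Longrightarrow> norm w < 1 \<Longrightarrow>
    ennreal (norm (f w) powr p) * ennreal ((1 - norm w) powr (CARD('n) + 1 + \<alpha>))
     \<le> ennreal K * (\<integral>\<^sup>+x. ennreal (norm (f x) powr p) * indicator (ball 0 1) x *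
         indicator {x. 1 - norm w \<le> 2 * (1 - (norm x)\<^sup>2) \<and> norm (1 - herm x \<xi>) \<le> 3 * norm (1 - herm w \<xi>)} x \<partial>weighted_lborel \<alpha>)"
proof -
  obtain K where K: "K > 0" "\<And>(g :: complex ^ 'n \<Rightarrow> complex) a r. holo_on g (ball a r) \<Longrightarrow> r > 0 \<Longrightarrow>
    ennreal (norm (g a) powr p) * ennreal (r ^ (2 * CARD('n)))
     \<le> ennreal K * (\<integral>\<^sup>+x. ennreal (norm (g x) powr p) * indicator (ball a r) x \<partial>lborel)"
    using submean[OF p] by blast
  define K' where "K' = K * 4 ^ CARD('n) * 3 powr \<bar>\<alpha>\<bar>"
  have [measurable]: "ball (0 :: complex ^ 'n) 1 \<in> sets borel" by simp
  show thesis
  proof (rule that)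
    show "K' > 0" using K by (simp add: K'_def)
    fix f :: "complex ^ 'n \<Rightarrow> complex" and \<xi> w :: "complex ^ 'n"
    assume f: "holo_on f (ball 0 1)" and \<xi>: "norm \<xi> = 1" and w: "norm w < 1"
    define R where "R = 1 - norm w"
    have R: "0 < R" using w by (simp add: R_def)
    \<comment> \<open>At w = 0 any direction will do.\<close>
    define u where "u = (if w = 0 then \<xi> else (1 / norm w) *\<^sub>R w)"
    have u: "norm u = 1" and wu: "w = norm w *\<^sub>R u" using \<xi> by (auto simp: u_def)
    let ?x = "\<lambda>z. w + (1 / 2) *\<^sub>R aniso R u z"
    define E where "E = {x. R \<le> 2 * (1 - (norm x)\<^sup>2) \<and> norm (1 - herm x \<xi>) \<le> 3 * norm (1 - herm w \<xi>)}"
    have [measurable]: "E \<in> sets borel" unfolding E_def by measurable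
    have xE: "?x z \<in> E \<and> 1 - (norm (?x z))\<^sup>2 \<le> 3 * R" if "norm z < 1" for z
      using aniso_geometry[OF u \<xi> _ w that] unfolding R_def[symmetric] wu[symmetric] E_def by auto
    have xball: "?x z \<in> ball 0 1" if "norm z < 1" for z
    proof -
      have "(norm (?x z))\<^sup>2 < 1\<^sup>2" using xE[OF that] R by (simp add: E_def)
      then have "norm (?x z) < 1" by (rule power2_less_imp_less) simp
      then show ?thesis by simp
    qed
    \<comment> \<open>The upper bound for 1 - |x|^2 is kept until the weight has been compared with
      R^\<alpha>, a comparison that needs both bounds.\<close>
    define G where "G x = ennreal (norm (f x) powr p) * indicator (ball 0 1) x * indicator (E \<inter> {x. 1 - (norm x)\<^sup>2 \<le> 3 * R}) x" for x
    have Gm [measurable]: "G \<in> borel_measurable borel"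
      unfolding G_def using holo_on_measurable_powr[OF f] by measurable
    have "holo_on (\<lambda>z. f (w + (1 / 2) *\<^sub>R aniso R u z)) (ball 0 1)"
      by (rule holo_on_affine[OF f])
         (use xball in \<open>auto simp: aniso_def herm_add_left herm_scale_left scaleR_eq_vector_scalar_mult vec_eq_iff algebra_simps\<close>)
    from K(2)[OF this]
    have "ennreal (norm (f w) powr p) \<le> ennreal K * (\<integral>\<^sup>+z. ennreal (norm (f (?x z)) powr p) * indicator (ball 0 1) z \<partial>lborel)"
      by (simp add: aniso_def)
    also have "\<dots> \<le> ennreal K * (\<integral>\<^sup>+z. G (?x z) \<partial>lborel)"
      by (intro mult_left_mono nn_integral_mono) (use xE xball in \<open>auto simp: G_def indicator_def\<close>)
    finally have 1: "ennreal (norm (f w) powr p) \<le> ennreal K * (\<integral>\<^sup>+z. G (?x z) \<partial>lborel)" .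
    \<comment> \<open>The factor 1/2 in front of \<open>aniso\<close> has real Jacobian 2^(-2n) =
      4^(-n).\<close>
    have half: "ennreal (4 ^ CARD('n)) * ennreal ((1 / 2) ^ DIM(complex ^ 'n)) = 1"
    proof -
      have "((2::real) ^ CARD('n))\<^sup>2 = 4 ^ CARD('n)" by (simp add: power2_eq_square flip: power_mult_distrib)
      then show ?thesis by (simp add: power_mult power_divide flip: ennreal_mult ennreal_1)
    qed
    have "ennreal (R ^ (CARD('n) + 1)) * (\<integral>\<^sup>+z. G (?x z) \<partial>lborel) = (\<integral>\<^sup>+z. G (w + (1 / 2) *\<^sub>R z) \<partial>lborel)"
      by (rule nn_integral_aniso[OF _ R u, symmetric]) measurable
    also have "\<dots> = ennreal (4 ^ CARD('n)) * (\<integral>\<^sup>+z. G z \<partial>lborel)"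
    proof -
      have "(\<integral>\<^sup>+z. G z \<partial>lborel) = ennreal ((1 / 2) ^ DIM(complex ^ 'n)) * (\<integral>\<^sup>+z. G (w + (1 / 2) *\<^sub>R z) \<partial>lborel)"
        by (rule nn_integral_lborel_scale[OF Gm]) simp
      then show ?thesis using half by (simp add: mult.assoc[symmetric] del: DIM_cart)
    qed
    finally have 2: "ennreal (R ^ (CARD('n) + 1)) * (\<integral>\<^sup>+z. G (?x z) \<partial>lborel) = ennreal (4 ^ CARD('n)) * (\<integral>\<^sup>+z. G z \<partial>lborel)" .
    let ?F = "\<lambda>x. ennreal (norm (f x) powr p) * indicator (ball 0 1) x * indicator E x"
    have Fm: "?F \<in> borel_measurable borel"
      using holo_on_measurable_powr[OF f] by measurable
    have 3: "ennreal (R powr \<alpha>) * (\<integral>\<^sup>+z. G z \<partial>lborel) \<le> ennreal (3 powr \<bar>\<alpha>\<bar>) * (\<integral>\<^sup>+z. ?F z \<partial>weighted_lborel \<alpha>)"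
    proof -
      have "ennreal (R powr \<alpha>) * (\<integral>\<^sup>+z. G z \<partial>lborel) = (\<integral>\<^sup>+z. ennreal (R powr \<alpha>) * G z \<partial>lborel)"
        by (rule nn_integral_cmult[symmetric]) measurable
      also have "\<dots> \<le> (\<integral>\<^sup>+z. ennreal (3 powr \<bar>\<alpha>\<bar>) * (ennreal ((1 - (norm z)\<^sup>2) powr \<alpha>) * indicator (ball 0 1) z * ?F z) \<partial>lborel)"
      proof (rule nn_integral_mono)
        fix z :: "complex ^ 'n"
        show "ennreal (R powr \<alpha>) * G z \<le> ennreal (3 powr \<bar>\<alpha>\<bar>) * (ennreal ((1 - (norm z)\<^sup>2) powr \<alpha>) * indicator (ball 0 1) z * ?F z)"
        proof (cases "z \<in> ball 0 1 \<and> z \<in> E \<and> 1 - (norm z)\<^sup>2 \<le> 3 * R")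
          case True
          then have "R powr \<alpha> \<le> 3 powr \<bar>\<alpha>\<bar> * (1 - (norm z)\<^sup>2) powr \<alpha>"
            using R by (intro powr_comparable) (auto simp: E_def abs_square_less_1)
          then have "ennreal (R powr \<alpha>) * ennreal (norm (f z) powr p) \<le> ennreal (3 powr \<bar>\<alpha>\<bar> * (1 - (norm z)\<^sup>2) powr \<alpha>) * ennreal (norm (f z) powr p)"
            by (intro mult_right_mono ennreal_leI) auto
          then show ?thesis using True by (simp add: G_def ennreal_mult mult.assoc)
        qed (auto simp: G_def)
      qed
      also have "\<dots> = ennreal (3 powr \<bar>\<alpha>\<bar>) * (\<integral>\<^sup>+z. ?F z \<partial>weighted_lborel \<alpha>)"
        unfolding nn_integral_weighted_lborel[OF Fm]
        using borel_measurable_times_ennreal[OF measurable_weighted_lborel_weight Fm] by (intro nn_integral_cmult) simp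
      finally show ?thesis .
    qed
    have "ennreal (norm (f w) powr p) * ennreal (R powr (CARD('n) + 1 + \<alpha>))
        = ennreal (R powr \<alpha>) * (ennreal (R ^ (CARD('n) + 1)) * ennreal (norm (f w) powr p))"
    proof -
      have "R powr (CARD('n) + 1 + \<alpha>) = R powr \<alpha> * R powr (real (CARD('n) + 1))"
        by (simp add: powr_add[symmetric] add_ac)
      also have "R powr (real (CARD('n) + 1)) = R ^ (CARD('n) + 1)" by (rule powr_realpow[OF R])
      finally show ?thesis using R by (simp add: mult_ac ennreal_mult)
    qed
    also have "\<dots> \<le> ennreal (R powr \<alpha>) * (ennreal (R ^ (CARD('n) + 1)) * (ennreal K * (\<integral>\<^sup>+z. G (?x z) \<partial>lborel)))"
      using 1 by (intro mult_left_mono) auto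
    also have "\<dots> = ennreal (R powr \<alpha>) * (ennreal K * (ennreal (4 ^ CARD('n)) * (\<integral>\<^sup>+z. G z \<partial>lborel)))"
      unfolding 2[symmetric] by (simp only: mult_ac)
    also have "\<dots> = ennreal (K * 4 ^ CARD('n)) * (ennreal (R powr \<alpha>) * (\<integral>\<^sup>+z. G z \<partial>lborel))"
      using K by (simp add: ennreal_mult mult_ac)
    also have "\<dots> \<le> ennreal (K * 4 ^ CARD('n)) * (ennreal (3 powr \<bar>\<alpha>\<bar>) * (\<integral>\<^sup>+z. ?F z \<partial>weighted_lborel \<alpha>))"
      using 3 by (intro mult_left_mono) auto
    also have "\<dots> = ennreal K' * (\<integral>\<^sup>+z. ?F z \<partial>weighted_lborel \<alpha>)"
      using K by (simp add: K'_def ennreal_mult mult_ac)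
    finally show "ennreal (norm (f w) powr p) * ennreal ((1 - norm w) powr (CARD('n) + 1 + \<alpha>))
     \<le> ennreal K' * (\<integral>\<^sup>+x. ennreal (norm (f x) powr p) * indicator (ball 0 1) x *
         indicator {x. 1 - norm w \<le> 2 * (1 - (norm x)\<^sup>2) \<and> norm (1 - herm x \<xi>) \<le> 3 * norm (1 - herm w \<xi>)} x \<partial>weighted_lborel \<alpha>)"
      by (simp add: E_def R_def)
  qed
qed

section \<open>The weight near the sphere\<close>

text \<open>The substitution x = 1 - \<tau> r leads to the integral of x^\<alpha> from 0, finite as
  \<alpha> > -1. The limit 1/r is where \<tau> u, with |u| = r, reaches the sphere.\<close>

lemma nn_integral_radial_singularity:
  fixes r :: real
  assumes \<alpha>: "\<alpha> > -1" and r: "0 < r" "r < 1"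
  shows "(\<integral>\<^sup>+\<tau>. indicator {1..1 / r} \<tau> * ennreal ((1 - \<tau> * r) powr \<alpha>) \<partial>lborel) = ennreal ((1 - r) powr (\<alpha> + 1) / (\<alpha> + 1) / r)"
proof -
  have "(\<integral>\<^sup>+x. ennreal (x powr \<alpha>) * indicator {0..1 - r} x \<partial>lborel) = ennreal ((1 - r) powr (\<alpha> + 1) / (\<alpha> + 1))"
    by (rule nn_integral_has_integral_lebesgue'[OF _ has_integral_powr_from_0]) (use \<alpha> r in auto)
  also have "(\<integral>\<^sup>+x. ennreal (x powr \<alpha>) * indicator {0..1 - r} x \<partial>lborel)
      = ennreal \<bar>-r\<bar> * (\<integral>\<^sup>+\<tau>. ennreal ((1 + (-r) * \<tau>) powr \<alpha>) * indicator {0..1 - r} (1 + (-r) * \<tau>) \<partial>lborel)"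
    by (rule nn_integral_real_affine) (use r in auto)
  also have "(\<lambda>\<tau>. ennreal ((1 + (-r) * \<tau>) powr \<alpha>) * indicator {0..1 - r} (1 + (-r) * \<tau>))
      = (\<lambda>\<tau>. indicator {1..1 / r} \<tau> * ennreal ((1 - \<tau> * r) powr \<alpha>))"
    using r by (auto simp: fun_eq_iff indicator_def field_simps)
  finally have eq: "ennreal r * (\<integral>\<^sup>+\<tau>. indicator {1..1 / r} \<tau> * ennreal ((1 - \<tau> * r) powr \<alpha>) \<partial>lborel)
      = ennreal ((1 - r) powr (\<alpha> + 1) / (\<alpha> + 1))" using r by simp
  have "ennreal (1 / r) * (ennreal r * (\<integral>\<^sup>+\<tau>. indicator {1..1 / r} \<tau> * ennreal ((1 - \<tau> * r) powr \<alpha>) \<partial>lborel))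
      = (\<integral>\<^sup>+\<tau>. indicator {1..1 / r} \<tau> * ennreal ((1 - \<tau> * r) powr \<alpha>) \<partial>lborel)"
    using r by (simp add: mult.assoc[symmetric] flip: ennreal_mult)
  then show ?thesis unfolding eq using \<alpha> r by (simp add: mult.commute flip: ennreal_mult)
qed

text \<open>Substituting \<open>z = \<tau> u\<close> and averaging over \<open>\<tau>\<close> removes the boundary singularity of the weight for \<open>\<alpha> < 0\<close>.\<close>
lemma emeasure_weighted_lborel_averaged:
  assumes \<alpha>: "\<alpha> > -1" and M: "M > 0"
  obtains C where "C > 0" "\<And>s A A'. 0 < s \<Longrightarrow> s \<le> 1 / 2 \<Longrightarrow> A \<in> sets borel \<Longrightarrow> A' \<in> sets borel \<Longrightarrow> A \<subseteq> ball (0 :: complex ^ 'n) 1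
    \<Longrightarrow> (\<And>\<tau> u. 1 \<le> \<tau> \<Longrightarrow> \<tau> \<le> 1 + s \<Longrightarrow> \<tau> *\<^sub>R u \<in> A \<Longrightarrow> u \<in> A' \<and> 1 - norm u \<le> M * s \<and> 1 / 2 \<le> norm u)
    \<Longrightarrow> emeasure (weighted_lborel \<alpha>) A \<le> ennreal (C * s powr \<alpha>) * emeasure lborel A'"
proof -
  define C where "C = 2 powr \<bar>\<alpha>\<bar> * 2 ^ DIM(complex ^ 'n) * (2 * M powr (\<alpha> + 1) / (\<alpha> + 1))"
  show thesis
  proof (rule that)
    show "C > 0" using \<alpha> M by (simp add: C_def)
    fix s :: real and A A' :: "(complex ^ 'n) set"
    assume s: "0 < s" "s \<le> 1 / 2" and [measurable]: "A \<in> sets borel" "A' \<in> sets borel" and A: "A \<subseteq> ball 0 1"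
      and AA': "\<And>\<tau> u. 1 \<le> \<tau> \<Longrightarrow> \<tau> \<le> 1 + s \<Longrightarrow> \<tau> *\<^sub>R u \<in> A \<Longrightarrow> u \<in> A' \<and> 1 - norm u \<le> M * s \<and> 1 / 2 \<le> norm u"
    define h where "h z = indicator A z * ennreal ((1 - norm z) powr \<alpha>)" for z :: "complex ^ 'n"
    have [measurable]: "h \<in> borel_measurable borel" unfolding h_def by measurable
    define J where "J = ennreal (2 * (M * s) powr (\<alpha> + 1) / (\<alpha> + 1))"
    have "emeasure (weighted_lborel \<alpha>) A = (\<integral>\<^sup>+z. indicator A z \<partial>weighted_lborel \<alpha>)" by simp
    also have "\<dots> = (\<integral>\<^sup>+z. ennreal ((1 - (norm z)\<^sup>2) powr \<alpha>) * indicator (ball 0 1) z * indicator A z \<partial>lborel)"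
      by (rule nn_integral_weighted_lborel) measurable
    also have "\<dots> \<le> (\<integral>\<^sup>+z. ennreal (2 powr \<bar>\<alpha>\<bar>) * h z \<partial>lborel)"
    proof (rule nn_integral_mono)
      fix z :: "complex ^ 'n"
      show "ennreal ((1 - (norm z)\<^sup>2) powr \<alpha>) * indicator (ball 0 1) z * indicator A z \<le> ennreal (2 powr \<bar>\<alpha>\<bar>) * h z"
      proof (cases "z \<in> A")
        case True
        then have z: "norm z < 1" using A by auto
        have "1 - (norm z)\<^sup>2 = (1 - norm z) * (1 + norm z)" by (simp add: power2_eq_square algebra_simps)
        moreover have "(1 - norm z) * (1 + norm z) \<le> (1 - norm z) * 2" using z by (intro mult_left_mono) auto
        moreover have "(1 - norm z) * (1 + norm z) \<ge> (1 - norm z) * 1" using z by (intro mult_left_mono) auto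
        moreover have "0 < (1 - norm z) * (1 + norm z)" using z by (intro mult_pos_pos) (auto simp: add_pos_nonneg)
        ultimately have "(1 - (norm z)\<^sup>2) powr \<alpha> \<le> 2 powr \<bar>\<alpha>\<bar> * (1 - norm z) powr \<alpha>"
          using z by (intro powr_comparable) auto
        then show ?thesis using True z by (simp add: h_def flip: ennreal_mult)
      qed simp
    qed
    also have "\<dots> = ennreal (2 powr \<bar>\<alpha>\<bar>) * (\<integral>\<^sup>+z. h z \<partial>lborel)"
      by (rule nn_integral_cmult) measurable
    finally have 1: "emeasure (weighted_lborel \<alpha>) A \<le> ennreal (2 powr \<bar>\<alpha>\<bar>) * (\<integral>\<^sup>+z. h z \<partial>lborel)" .
    \<comment> \<open>For every \<tau> the integral of h is \<tau>^(2n) times that of u -> h(\<tau>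
      u), and \<tau> <= 2. This is averaged over an interval of length s.\<close>
    have "ennreal s * (\<integral>\<^sup>+z. h z \<partial>lborel) = (\<integral>\<^sup>+\<tau>. (\<integral>\<^sup>+z. h z \<partial>lborel) * indicator {1..1 + s} \<tau> \<partial>lborel)"
      using s by (subst nn_integral_cmult_indicator) (auto simp: mult.commute)
    also have "\<dots> \<le> (\<integral>\<^sup>+\<tau>. ennreal (2 ^ DIM(complex ^ 'n)) * (\<integral>\<^sup>+u. indicator {1..1 + s} \<tau> * h (\<tau> *\<^sub>R u) \<partial>lborel) \<partial>lborel)"
    proof (rule nn_integral_mono)
      fix \<tau> :: real
      show "(\<integral>\<^sup>+z. h z \<partial>lborel) * indicator {1..1 + s} \<tau>
        \<le> ennreal (2 ^ DIM(complex ^ 'n)) * (\<integral>\<^sup>+u. indicator {1..1 + s} \<tau> * h (\<tau> *\<^sub>R u) \<partial>lborel)"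
      proof (cases "\<tau> \<in> {1..1 + s}")
        case True
        then have \<tau>: "0 < \<tau>" "\<tau> \<le> 2" using s by auto
        have "(\<integral>\<^sup>+z. h z \<partial>lborel) = ennreal (\<tau> ^ DIM(complex ^ 'n)) * (\<integral>\<^sup>+u. h (0 + \<tau> *\<^sub>R u) \<partial>lborel)"
          by (rule nn_integral_lborel_scale[OF _ \<tau>(1)]) measurable
        also have "\<dots> \<le> ennreal (2 ^ DIM(complex ^ 'n)) * (\<integral>\<^sup>+u. h (0 + \<tau> *\<^sub>R u) \<partial>lborel)"
          using \<tau> by (intro mult_right_mono ennreal_leI power_mono) auto
        finally show ?thesis using True by simp
      qed simp
    qed
    also have "\<dots> = ennreal (2 ^ DIM(complex ^ 'n)) * (\<integral>\<^sup>+\<tau>. (\<integral>\<^sup>+u. indicator {1..1 + s} \<tau> * h (\<tau> *\<^sub>R u) \<partial>lborel) \<partial>lborel)"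
      by (rule nn_integral_cmult) measurable
    also have "(\<integral>\<^sup>+\<tau>. (\<integral>\<^sup>+u. indicator {1..1 + s} \<tau> * h (\<tau> *\<^sub>R u) \<partial>lborel) \<partial>lborel)
        = (\<integral>\<^sup>+u. (\<integral>\<^sup>+\<tau>. indicator {1..1 + s} \<tau> * h (\<tau> *\<^sub>R u) \<partial>lborel) \<partial>lborel)"
      by (rule lborel_pair.Fubini'[symmetric]) measurable
    also have "\<dots> \<le> (\<integral>\<^sup>+u. J * indicator A' u \<partial>lborel)"
    proof (rule nn_integral_mono)
      fix u :: "complex ^ 'n"
      show "(\<integral>\<^sup>+\<tau>. indicator {1..1 + s} \<tau> * h (\<tau> *\<^sub>R u) \<partial>lborel) \<le> J * indicator A' u"
      proof (cases "\<exists>\<tau>\<in>{1..1+s}. \<tau> *\<^sub>R u \<in> A")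
        case False
        then have "(\<integral>\<^sup>+\<tau>. indicator {1..1 + s} \<tau> * h (\<tau> *\<^sub>R u) \<partial>lborel) = (\<integral>\<^sup>+\<tau>. 0 \<partial>(lborel :: real measure))"
          by (intro nn_integral_cong) (auto simp: h_def indicator_def)
        then show ?thesis by simp
      next
        case True
        then obtain \<tau>0 where \<tau>0: "1 \<le> \<tau>0" "\<tau>0 \<le> 1 + s" "\<tau>0 *\<^sub>R u \<in> A" by auto
        from AA'[OF this] have u: "u \<in> A'" "1 - norm u \<le> M * s" "1 / 2 \<le> norm u" by auto
        have "norm (\<tau>0 *\<^sub>R u) < 1" using \<tau>0 A by auto
        moreover have "1 * norm u \<le> \<tau>0 * norm u" using \<tau>0 by (intro mult_right_mono) auto
        ultimately have u1: "norm u < 1" using \<tau>0 by simp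
        have "(\<integral>\<^sup>+\<tau>. indicator {1..1 + s} \<tau> * h (\<tau> *\<^sub>R u) \<partial>lborel)
            \<le> (\<integral>\<^sup>+\<tau>. indicator {1..1 / norm u} \<tau> * ennreal ((1 - \<tau> * norm u) powr \<alpha>) \<partial>lborel)"
        proof (rule nn_integral_mono)
          fix \<tau> :: real
          show "indicator {1..1 + s} \<tau> * h (\<tau> *\<^sub>R u) \<le> indicator {1..1 / norm u} \<tau> * ennreal ((1 - \<tau> * norm u) powr \<alpha>)"
          proof (cases "\<tau> \<in> {1..1+s} \<and> \<tau> *\<^sub>R u \<in> A")
            case True
            then have "norm (\<tau> *\<^sub>R u) < 1" using A by auto
            moreover have "norm u > 0" using u by linarith
            ultimately have "\<tau> \<le> 1 / norm u" using True by (simp add: pos_le_divide_eq)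
            then show ?thesis using True by (simp add: h_def)
          qed (auto simp: h_def indicator_def)
        qed
        also have "\<dots> = ennreal ((1 - norm u) powr (\<alpha> + 1) / (\<alpha> + 1) / norm u)"
          using u u1 by (intro nn_integral_radial_singularity \<alpha>) auto
        \<comment> \<open>As 1 - |u| <= M s, the radial integral is of order s^(\<alpha> + 1);
          division by the length s of the interval will leave s^\<alpha>. The lower bound for |u|
          controls the factor 1/|u|.\<close>
        also have "\<dots> \<le> J"
          unfolding J_def
        proof (rule ennreal_leI)
          have "(1 - norm u) powr (\<alpha> + 1) / (\<alpha> + 1) / norm u \<le> (M * s) powr (\<alpha> + 1) / (\<alpha> + 1) / (1 / 2)"
            using u u1 \<alpha> by (intro frac_le divide_right_mono powr_mono2) auto
          then show "(1 - norm u) powr (\<alpha> + 1) / (\<alpha> + 1) / norm u \<le> 2 * (M * s) powr (\<alpha> + 1) / (\<alpha> + 1)"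
            by (simp add: mult.commute)
        qed
        finally show ?thesis using u by simp
      qed
    qed
    also have "(\<integral>\<^sup>+u. J * indicator A' u \<partial>lborel) = J * emeasure lborel A'"
      by (rule nn_integral_cmult_indicator) simp
    finally have 2: "ennreal s * (\<integral>\<^sup>+z. h z \<partial>lborel) \<le> ennreal (2 ^ DIM(complex ^ 'n)) * (J * emeasure lborel A')"
      by (simp add: mult_left_mono)
    have "(\<integral>\<^sup>+z. h z \<partial>lborel) = ennreal (1 / s) * (ennreal s * (\<integral>\<^sup>+z. h z \<partial>lborel))"
      using s by (simp add: mult.assoc[symmetric] flip: ennreal_mult)
    also have "\<dots> \<le> ennreal (1 / s) * (ennreal (2 ^ DIM(complex ^ 'n)) * (J * emeasure lborel A'))"
      using 2 by (rule mult_left_mono) simp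
    finally have "emeasure (weighted_lborel \<alpha>) A \<le> ennreal (2 powr \<bar>\<alpha>\<bar>) * (ennreal (1 / s) * (ennreal (2 ^ DIM(complex ^ 'n)) * (J * emeasure lborel A')))"
      using 1 by (meson mult_left_mono order_trans zero_le)
    also have "\<dots> = ennreal (2 powr \<bar>\<alpha>\<bar> * ((1 / s) * (2 ^ DIM(complex ^ 'n) * (2 * (M * s) powr (\<alpha> + 1) / (\<alpha> + 1))))) * emeasure lborel A'"
    proof -
      have "ennreal a * (ennreal b * (ennreal c * (ennreal d * X))) = ennreal (a * (b * (c * d))) * X"
        if "0 \<le> a" "0 \<le> b" "0 \<le> c" "0 \<le> d" for a b c d X
        using that by (simp add: ennreal_mult mult.assoc)
      then show ?thesis unfolding J_def by this (use s \<alpha> M in auto)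
    qed
    also have "2 powr \<bar>\<alpha>\<bar> * ((1 / s) * (2 ^ DIM(complex ^ 'n) * (2 * (M * s) powr (\<alpha> + 1) / (\<alpha> + 1)))) = C * s powr \<alpha>"
      using s M \<alpha> by (simp add: C_def powr_mult powr_add field_simps del: DIM_cart)
    finally show "emeasure (weighted_lborel \<alpha>) A \<le> ennreal (C * s powr \<alpha>) * emeasure lborel A'" .
  qed
qed

section \<open>Volume of Koranyi regions\<close>

lemma emeasure_weighted_lborel_Int_ball:
  assumes [measurable]: "A \<in> sets borel"
  shows "emeasure (weighted_lborel \<alpha>) A = emeasure (weighted_lborel \<alpha>) (A \<inter> ball 0 1)"
proof -
  have [measurable]: "ball (0 :: complex ^ 'n) 1 \<in> sets borel" by simp
  have "emeasure (weighted_lborel \<alpha>) A = (\<integral>\<^sup>+z. indicator A z \<partial>weighted_lborel \<alpha>)" by simp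
  also have "\<dots> = (\<integral>\<^sup>+z. indicator (A \<inter> ball 0 1) z \<partial>weighted_lborel \<alpha>)"
    by (subst (1 2) nn_integral_weighted_lborel) (auto intro!: nn_integral_cong simp: indicator_def)
  finally show ?thesis by simp
qed

text \<open>Only the outer shell is delicate, and there averaging applies; on the inner ball the
  density is bounded.\<close>

lemma weighted_lborel_total:
  assumes \<alpha>: "\<alpha> > -1"
  obtains T where "T > 0" "\<And>A. A \<in> sets borel \<Longrightarrow> emeasure (weighted_lborel \<alpha> :: (complex ^ 'n) measure) A \<le> ennreal T"
proof -
  define V where "V = unit_ball_vol (DIM(complex ^ 'n))"
  have V: "V > 0" "emeasure lborel (ball (0 :: complex ^ 'n) 1) = ennreal V"
    by (simp_all add: V_def unit_ball_vol_pos emeasure_ball)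
  have [measurable]: "ball (0 :: complex ^ 'n) r \<in> sets borel" for r by simp
  obtain C where C: "C > 0" "\<And>s A A'. 0 < s \<Longrightarrow> s \<le> 1 / 2 \<Longrightarrow> A \<in> sets borel \<Longrightarrow> A' \<in> sets borel \<Longrightarrow> A \<subseteq> ball (0 :: complex ^ 'n) 1
    \<Longrightarrow> (\<And>\<tau> u. 1 \<le> \<tau> \<Longrightarrow> \<tau> \<le> 1 + s \<Longrightarrow> \<tau> *\<^sub>R u \<in> A \<Longrightarrow> u \<in> A' \<and> 1 - norm u \<le> 1 * s \<and> 1 / 2 \<le> norm u)
    \<Longrightarrow> emeasure (weighted_lborel \<alpha>) A \<le> ennreal (C * s powr \<alpha>) * emeasure lborel A'"
    using emeasure_weighted_lborel_averaged[OF \<alpha>, of 1] by (metis zero_less_one)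
  \<comment> \<open>Averaging uses s = 1/2, hence \<tau> <= 3/2, and (3/4) / (3/2) is exactly the
    required lower bound 1/2 for |u|.\<close>
  let ?A = "{z :: complex ^ 'n. 3 / 4 \<le> norm z \<and> norm z < 1}"
  have 1: "emeasure (weighted_lborel \<alpha>) ?A \<le> ennreal (C * (1 / 2) powr \<alpha>) * emeasure lborel (ball (0 :: complex ^ 'n) 1)"
  proof (rule C(2))
    fix \<tau> :: real and u :: "complex ^ 'n"
    assume \<tau>: "1 \<le> \<tau>" "\<tau> \<le> 1 + 1 / 2" "\<tau> *\<^sub>R u \<in> ?A"
    have "1 * norm u \<le> \<tau> * norm u" "\<tau> * norm u \<le> (1 + 1 / 2) * norm u"
      using \<tau> by (intro mult_right_mono; auto)+
    then show "u \<in> ball 0 1 \<and> 1 - norm u \<le> 1 * (1 / 2) \<and> 1 / 2 \<le> norm u" using \<tau> by simp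
  qed auto
  have 2: "emeasure (weighted_lborel \<alpha>) (ball (0 :: complex ^ 'n) (3 / 4)) \<le> ennreal (4 powr \<bar>\<alpha>\<bar>) * emeasure lborel (ball (0 :: complex ^ 'n) 1)"
  proof -
    have "emeasure (weighted_lborel \<alpha>) (ball (0 :: complex ^ 'n) (3 / 4)) = (\<integral>\<^sup>+z. indicator (ball (0 :: complex ^ 'n) (3 / 4)) z \<partial>weighted_lborel \<alpha>)" by simp
    also have "\<dots> = (\<integral>\<^sup>+z. ennreal ((1 - (norm z)\<^sup>2) powr \<alpha>) * indicator (ball 0 1) z * indicator (ball (0 :: complex ^ 'n) (3 / 4)) z \<partial>lborel)"
      by (rule nn_integral_weighted_lborel) measurable
    also have "\<dots> \<le> (\<integral>\<^sup>+z. ennreal (4 powr \<bar>\<alpha>\<bar>) * indicator (ball (0 :: complex ^ 'n) 1) z \<partial>lborel)"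
    proof (rule nn_integral_mono)
      fix z :: "complex ^ 'n"
      show "ennreal ((1 - (norm z)\<^sup>2) powr \<alpha>) * indicator (ball 0 1) z * indicator (ball 0 (3 / 4)) z
        \<le> ennreal (4 powr \<bar>\<alpha>\<bar>) * indicator (ball 0 1) z"
      proof (cases "z \<in> ball 0 (3 / 4)")
        case True
        then have "(norm z)\<^sup>2 \<le> (3 / 4)\<^sup>2" by (intro power_mono) auto
        then have z: "(norm z)\<^sup>2 \<le> 9 / 16" by (simp add: power2_eq_square)
        have "(1 - (norm z)\<^sup>2) powr \<alpha> \<le> 4 powr \<bar>\<alpha>\<bar> * 1 powr \<alpha>"
          by (rule powr_comparable) (use z order_trans[of "- ((norm z)\<^sup>2)" 0 3] in auto)
        then show ?thesis using True by (simp add: ennreal_leI)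
      qed simp
    qed
    also have "\<dots> = ennreal (4 powr \<bar>\<alpha>\<bar>) * emeasure lborel (ball (0 :: complex ^ 'n) 1)"
      by (rule nn_integral_cmult_indicator) simp
    finally show ?thesis .
  qed
  define T where "T = C * (1 / 2) powr \<alpha> * V + 4 powr \<bar>\<alpha>\<bar> * V"
  show thesis
  proof (rule that)
    show "T > 0" unfolding T_def using V C by (intro add_pos_pos mult_pos_pos) auto
    fix A :: "(complex ^ 'n) set" assume [measurable]: "A \<in> sets borel"
    have "emeasure (weighted_lborel \<alpha>) A = emeasure (weighted_lborel \<alpha>) (A \<inter> ball 0 1)" by (rule emeasure_weighted_lborel_Int_ball) simp
    also have "\<dots> \<le> emeasure (weighted_lborel \<alpha>) (?A \<union> ball 0 (3 / 4))"
      by (rule emeasure_mono) (auto simp: sets_weighted_lborel)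
    also have "\<dots> \<le> emeasure (weighted_lborel \<alpha>) ?A + emeasure (weighted_lborel \<alpha>) (ball (0 :: complex ^ 'n) (3 / 4))"
      by (rule emeasure_subadditive) (auto simp: sets_weighted_lborel)
    also have "\<dots> \<le> ennreal (C * (1 / 2) powr \<alpha>) * ennreal V + ennreal (4 powr \<bar>\<alpha>\<bar>) * ennreal V"
      using add_mono[OF 1 2] unfolding V .
    also have "\<dots> = ennreal T" unfolding T_def using V C by (simp add: ennreal_plus ennreal_mult)
    finally show "emeasure (weighted_lborel \<alpha>) A \<le> ennreal T" .
  qed
qed

text \<open>The dilation centred at \<xi> pulls the region back into a fixed ball. The component a
  along \<xi> satisfies |a| <= 1. The component z' across satisfies s |z'|^2 = |x|^2 -
  |\<langle>x,\<xi>\<rangle>|^2 <= 1 - (1 - 2s), because x lies in the unit ball. So |z|^2 <=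
  3.\<close>

lemma emeasure_koranyi_region_le:
  fixes \<xi> :: "complex ^ 'n"
  assumes \<xi>: "norm \<xi> = 1" and s: "s > 0"
  shows "emeasure lborel {u \<in> ball 0 1. norm (1 - herm u \<xi>) \<le> s}
    \<le> ennreal (s ^ (CARD('n) + 1)) * emeasure lborel (ball (0 :: complex ^ 'n) 2)"
proof -
  have [measurable]: "ball (0 :: complex ^ 'n) r \<in> sets borel" for r by simp
  let ?D = "{u \<in> ball 0 1. norm (1 - herm u \<xi>) \<le> s}"
  have [measurable]: "?D \<in> sets borel" by measurable
  have "emeasure lborel ?D = (\<integral>\<^sup>+x. indicator ?D x \<partial>lborel)" by simp
  also have "\<dots> = (\<integral>\<^sup>+x. indicator ?D (\<xi> + x) \<partial>lborel)"
    by (rule nn_integral_lborel_translate[symmetric]) measurable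
  also have "\<dots> = ennreal (s ^ (CARD('n) + 1)) * (\<integral>\<^sup>+z. indicator ?D (\<xi> + aniso s \<xi> z) \<partial>lborel)"
    by (rule nn_integral_aniso[OF _ s \<xi>]) measurable
  also have "\<dots> \<le> ennreal (s ^ (CARD('n) + 1)) * (\<integral>\<^sup>+z. indicator (ball (0 :: complex ^ 'n) 2) z \<partial>lborel)"
  proof (intro mult_left_mono nn_integral_mono)
    fix z :: "complex ^ 'n"
    have "z \<in> ball 0 2" if zD: "\<xi> + aniso s \<xi> z \<in> ?D"
    proof -
      define a where "a = herm z \<xi>"
      define z' where "z' = z - a *s \<xi>"
      define x where "x = \<xi> + aniso s \<xi> z"
      have hx1: "herm \<xi> \<xi> = 1" by (simp add: herm_self \<xi>)
      have hz': "herm z' \<xi> = 0" by (simp add: z'_def herm_diff_left herm_scale_left hx1 a_def)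
      have xe: "x = (1 + of_real s * a) *s \<xi> + of_real (sqrt s) *s z'"
        by (simp add: x_def aniso_def z'_def a_def vec_eq_iff algebra_simps)
      have hx: "herm x \<xi> = 1 + of_real s * a" by (simp add: xe herm_add_left herm_scale_left hz' hx1)
      have "norm (1 - herm x \<xi>) \<le> s" "norm x < 1" using zD by (auto simp: x_def)
      then have a1: "norm a \<le> 1" using s by (simp add: hx norm_mult)
      have "x - herm x \<xi> *s \<xi> = of_real (sqrt s) *s z'" unfolding hx by (simp add: xe)
      then have "(norm (of_real (sqrt s) *s z'))\<^sup>2 = (norm x)\<^sup>2 - (norm (herm x \<xi>))\<^sup>2"
        using norm_sq_decomp[OF \<xi>, of x] by simp
      moreover have "(norm (of_real (sqrt s) *s z'))\<^sup>2 = s * (norm z')\<^sup>2"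
        using s by (simp add: norm_vector_scalar_mult power_mult_distrib)
      moreover have "(norm x)\<^sup>2 \<le> 1" using \<open>norm x < 1\<close> by (simp add: power_le_one)
      moreover have "(norm (herm x \<xi>))\<^sup>2 \<ge> 1 - 2 * s"
      proof -
        have "\<bar>Re a\<bar> \<le> 1" using abs_Re_le_cmod[of a] a1 by linarith
        then have "s * Re a \<ge> s * (-1)" using s by (intro mult_left_mono) auto
        moreover have "(norm (herm x \<xi>))\<^sup>2 = 1 + 2 * (s * Re a) + (s * Re a)\<^sup>2 + (s * Im a)\<^sup>2"
          unfolding hx cmod_power2 by (simp add: power2_eq_square algebra_simps)
        ultimately show ?thesis using zero_le_power2[of "s * Re a"] zero_le_power2[of "s * Im a"] by linarith
      qed
      ultimately have "s * (norm z')\<^sup>2 \<le> s * 2" by linarith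
      then have "(norm z')\<^sup>2 \<le> 2" using s by simp
      moreover have "(norm a)\<^sup>2 \<le> 1" using a1 by (simp add: power_le_one)
      moreover have "(norm z')\<^sup>2 = (norm z)\<^sup>2 - (norm a)\<^sup>2"
        unfolding z'_def a_def by (rule norm_sq_decomp[OF \<xi>])
      ultimately have "(norm z)\<^sup>2 < 2\<^sup>2" by simp
      then have "norm z < 2" by (rule power2_less_imp_less) simp
      then show ?thesis by simp
    qed
    then show "indicator ?D (\<xi> + aniso s \<xi> z) \<le> (indicator (ball 0 2) z :: ennreal)"
      by (auto simp: indicator_def)
  qed simp
  finally show ?thesis by simp
qed

text \<open>Dividing a point by \<tau> <= 1 + s moves it from the region of size s at most into that
  of size 2s, so averaging reduces small s to the Lebesgue volume. Large s is covered by the total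
  mass.\<close>

lemma weighted_lborel_koranyi_region:
  fixes \<alpha> :: real
  assumes \<alpha>: "\<alpha> > -1"
  obtains C where "C > 0" "\<And>(\<xi> :: complex ^ 'n) s. norm \<xi> = 1 \<Longrightarrow> s > 0 \<Longrightarrow>
    emeasure (weighted_lborel \<alpha>) {u. norm (1 - herm u \<xi>) \<le> s} \<le> ennreal (C * s powr (CARD('n) + 1 + \<alpha>))"
proof -
  have [measurable]: "ball (0 :: complex ^ 'n) r \<in> sets borel" for r by simp
  obtain T where T: "T > 0" "\<And>A. A \<in> sets borel \<Longrightarrow> emeasure (weighted_lborel \<alpha> :: (complex ^ 'n) measure) A \<le> ennreal T"
    using weighted_lborel_total[OF \<alpha>] by blast
  obtain C where C: "C > 0" "\<And>s A A'. 0 < s \<Longrightarrow> s \<le> 1 / 2 \<Longrightarrow> A \<in> sets borel \<Longrightarrow> A' \<in> sets borel \<Longrightarrow> A \<subseteq> ball (0 :: complex ^ 'n) 1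
    \<Longrightarrow> (\<And>\<tau> u. 1 \<le> \<tau> \<Longrightarrow> \<tau> \<le> 1 + s \<Longrightarrow> \<tau> *\<^sub>R u \<in> A \<Longrightarrow> u \<in> A' \<and> 1 - norm u \<le> 2 * s \<and> 1 / 2 \<le> norm u)
    \<Longrightarrow> emeasure (weighted_lborel \<alpha>) A \<le> ennreal (C * s powr \<alpha>) * emeasure lborel A'"
    using emeasure_weighted_lborel_averaged[OF \<alpha>, of 2] by (metis zero_less_numeral)
  define V where "V = 2 ^ DIM(complex ^ 'n) * unit_ball_vol (DIM(complex ^ 'n))"
  have V: "V > 0" "emeasure lborel (ball (0 :: complex ^ 'n) 2) = ennreal V"
    by (simp_all add: V_def unit_ball_vol_pos emeasure_ball mult.commute)
  define N where "N = CARD('n) + 1 + \<alpha>"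
  have N: "N > 0" using \<alpha> by (simp add: N_def)
  define C' where "C' = C * 2 ^ (CARD('n) + 1) * V + T * 4 powr N"
  show thesis
  proof (rule that)
    show "C' > 0" unfolding C'_def using C V T by (intro add_pos_pos mult_pos_pos) auto
    fix \<xi> :: "complex ^ 'n" and s :: real assume \<xi>: "norm \<xi> = 1" and s: "s > 0"
    \<comment> \<open>Up to s = 1/4 the enlarged region has 1 - |u| <= 2s <= 1/2, as averaging
      demands.\<close>
    show "emeasure (weighted_lborel \<alpha>) {u. norm (1 - herm u \<xi>) \<le> s} \<le> ennreal (C' * s powr (CARD('n) + 1 + \<alpha>))"
    proof (cases "s \<le> 1 / 4")
      case True
      let ?A = "{u \<in> ball 0 1. norm (1 - herm u \<xi>) \<le> s}" and ?A' = "{u \<in> ball 0 1. norm (1 - herm u \<xi>) \<le> 2 * s}"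
      have "emeasure (weighted_lborel \<alpha>) {u. norm (1 - herm u \<xi>) \<le> s} = emeasure (weighted_lborel \<alpha>) ({u. norm (1 - herm u \<xi>) \<le> s} \<inter> ball 0 1)"
        by (rule emeasure_weighted_lborel_Int_ball) measurable
      also have "{u. norm (1 - herm u \<xi>) \<le> s} \<inter> ball 0 1 = ?A" by auto
      also have "emeasure (weighted_lborel \<alpha>) ?A \<le> ennreal (C * s powr \<alpha>) * emeasure lborel ?A'"
      proof (rule C(2))
        fix \<tau> :: real and u :: "complex ^ 'n"
        assume \<tau>: "1 \<le> \<tau>" "\<tau> \<le> 1 + s" "\<tau> *\<^sub>R u \<in> ?A"
        have "1 * norm u \<le> \<tau> * norm u"
          using \<tau> by (intro mult_right_mono) auto
        then have u1: "norm u < 1" using \<tau> by simp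
        have hu: "norm (herm u \<xi>) \<le> norm u" using norm_herm_le[of u \<xi>] \<xi> by simp
        have "1 - herm u \<xi> = (1 - herm (\<tau> *\<^sub>R u) \<xi>) + of_real (\<tau> - 1) * herm u \<xi>"
          by (simp add: herm_scaleR_left algebra_simps)
        then have "norm (1 - herm u \<xi>) \<le> norm (1 - herm (\<tau> *\<^sub>R u) \<xi>) + norm (of_real (\<tau> - 1) * herm u \<xi>)"
          by (metis norm_triangle_ineq)
        also have "norm (of_real (\<tau> - 1) * herm u \<xi>) = (\<tau> - 1) * norm (herm u \<xi>)"
          using \<tau> by (simp only: norm_mult norm_of_real)
        also have "(\<tau> - 1) * norm (herm u \<xi>) \<le> s * 1" using \<tau> hu u1 by (intro mult_mono) auto
        finally have d: "norm (1 - herm u \<xi>) \<le> 2 * s" using \<tau> by simp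
        moreover have "1 - norm u \<le> norm (1 - herm u \<xi>)"
          using norm_triangle_ineq2[of 1 "herm u \<xi>"] hu by simp
        ultimately show "u \<in> ?A' \<and> 1 - norm u \<le> 2 * s \<and> 1 / 2 \<le> norm u"
          using u1 True by auto
      qed (use s True in auto)
      also have "\<dots> \<le> ennreal (C * s powr \<alpha>) * (ennreal ((2 * s) ^ (CARD('n) + 1)) * ennreal V)"
        using emeasure_koranyi_region_le[OF \<xi>, of "2 * s"] s V(2) by (intro mult_left_mono) auto
      also have "\<dots> = ennreal (C * s powr \<alpha> * ((2 * s) ^ (CARD('n) + 1) * V))"
        using C V s by (simp add: ennreal_mult)
      also have "C * s powr \<alpha> * ((2 * s) ^ (CARD('n) + 1) * V) = (C * 2 ^ (CARD('n) + 1) * V) * s powr N"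
      proof -
        have "s powr N = s powr \<alpha> * s powr (real (CARD('n) + 1))"
          by (simp add: N_def powr_add[symmetric] add_ac)
        also have "s powr (real (CARD('n) + 1)) = s ^ (CARD('n) + 1)" by (rule powr_realpow[OF s])
        finally show ?thesis by (simp add: power_mult_distrib mult_ac)
      qed
      also have "ennreal \<dots> \<le> ennreal (C' * s powr N)"
        unfolding C'_def using T by (intro ennreal_leI mult_right_mono) auto
      finally show ?thesis by (simp add: N_def)
    next
      case False
      have "T * 1 \<le> T * ((4 * s) powr N)"
        using False N T by (intro mult_left_mono ge_one_powr_ge_zero) auto
      then have "T \<le> (T * 4 powr N) * s powr N" using s by (simp add: powr_mult mult.assoc)
      also have "\<dots> \<le> C' * s powr N"
        unfolding C'_def using C V by (intro mult_right_mono) auto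
      finally have "ennreal T \<le> ennreal (C' * s powr N)" by (rule ennreal_leI)
      moreover have "emeasure (weighted_lborel \<alpha>) {u. norm (1 - herm u \<xi>) \<le> s} \<le> ennreal T"
        by (rule T) measurable
      ultimately have "emeasure (weighted_lborel \<alpha>) {u. norm (1 - herm u \<xi>) \<le> s} \<le> ennreal (C' * s powr N)" by (rule order_trans[rotated])
      then show ?thesis by (simp add: N_def)
    qed
  qed
qed

text \<open>The isotropic counterpart, for the area integral. The ball reaches across the sphere, so
  the singularity of the weight has to be averaged out here too.\<close>

lemma weighted_lborel_cball:
  fixes \<alpha> :: real
  assumes \<alpha>: "\<alpha> > -1"
  obtains C where "C > 0" "\<And>w :: complex ^ 'n. norm w < 1 \<Longrightarrow>
    emeasure (weighted_lborel \<alpha>) (cball w (3 * (1 - norm w))) \<le> ennreal (C * (1 - norm w) powr (2 * CARD('n) + \<alpha>))"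
proof -
  have [measurable]: "ball (0 :: complex ^ 'n) r \<in> sets borel" for r by simp
  have [measurable]: "cball (w :: complex ^ 'n) r \<in> sets borel" for w r by simp
  obtain T where T: "T > 0" "\<And>A. A \<in> sets borel \<Longrightarrow> emeasure (weighted_lborel \<alpha> :: (complex ^ 'n) measure) A \<le> ennreal T"
    using weighted_lborel_total[OF \<alpha>] by blast
  obtain C where C: "C > 0" "\<And>s A A'. 0 < s \<Longrightarrow> s \<le> 1 / 2 \<Longrightarrow> A \<in> sets borel \<Longrightarrow> A' \<in> sets borel \<Longrightarrow> A \<subseteq> ball (0 :: complex ^ 'n) 1
    \<Longrightarrow> (\<And>\<tau> u. 1 \<le> \<tau> \<Longrightarrow> \<tau> \<le> 1 + s \<Longrightarrow> \<tau> *\<^sub>R u \<in> A \<Longrightarrow> u \<in> A' \<and> 1 - norm u \<le> 5 * s \<and> 1 / 2 \<le> norm u)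
    \<Longrightarrow> emeasure (weighted_lborel \<alpha>) A \<le> ennreal (C * s powr \<alpha>) * emeasure lborel A'"
    using emeasure_weighted_lborel_averaged[OF \<alpha>, of 5] by (metis zero_less_numeral)
  define V where "V = unit_ball_vol (DIM(complex ^ 'n))"
  have V: "V > 0" by (simp add: V_def unit_ball_vol_pos)
  define N where "N = 2 * CARD('n) + \<alpha>"
  have N: "N > 0"
  proof -
    have "CARD('n) \<ge> 1" by (simp add: Suc_leI)
    then show ?thesis using \<alpha> unfolding N_def by linarith
  qed
  define C' where "C' = C * 4 ^ (2 * CARD('n)) * V + T * 10 powr N"
  show thesis
  proof (rule that)
    show "C' > 0" unfolding C'_def using C V T by (intro add_pos_pos mult_pos_pos) auto
    fix w :: "complex ^ 'n" assume w: "norm w < 1"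
    define s where "s = 1 - norm w"
    have s: "0 < s" using w by (simp add: s_def)
    \<comment> \<open>Below 1/10 the bound 1 - |u| <= 5s keeps |u| >= 1/2; above it the total mass
      is enough.\<close>
    show "emeasure (weighted_lborel \<alpha>) (cball w (3 * (1 - norm w))) \<le> ennreal (C' * (1 - norm w) powr (2 * CARD('n) + \<alpha>))"
    proof (cases "s \<le> 1 / 10")
      case True
      have "emeasure (weighted_lborel \<alpha>) (cball w (3 * s)) = emeasure (weighted_lborel \<alpha>) (cball w (3 * s) \<inter> ball 0 1)"
        by (rule emeasure_weighted_lborel_Int_ball) measurable
      also have "\<dots> \<le> ennreal (C * s powr \<alpha>) * emeasure lborel (cball w (4 * s))"
      proof (rule C(2))
        fix \<tau> :: real and u :: "complex ^ 'n"
        assume \<tau>: "1 \<le> \<tau>" "\<tau> \<le> 1 + s" "\<tau> *\<^sub>R u \<in> cball w (3 * s) \<inter> ball 0 1"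
        have "1 * norm u \<le> \<tau> * norm u"
          using \<tau> by (intro mult_right_mono) auto
        then have u1: "norm u < 1" using \<tau> by simp
        have "w - u = (w - \<tau> *\<^sub>R u) + (\<tau> - 1) *\<^sub>R u" by (simp add: algebra_simps)
        then have "norm (w - u) \<le> norm (w - \<tau> *\<^sub>R u) + norm ((\<tau> - 1) *\<^sub>R u)" by (metis norm_triangle_ineq)
        also have "norm ((\<tau> - 1) *\<^sub>R u) = (\<tau> - 1) * norm u" using \<tau> by simp
        also have "(\<tau> - 1) * norm u \<le> s * 1" using \<tau> u1 by (intro mult_mono) auto
        finally have d: "norm (w - u) \<le> 4 * s" using \<tau> by (simp add: dist_norm)
        moreover have "norm w - norm u \<le> norm (w - u)" by (rule norm_triangle_ineq2)
        ultimately show "u \<in> cball w (4 * s) \<and> 1 - norm u \<le> 5 * s \<and> 1 / 2 \<le> norm u"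
          using True by (auto simp: dist_norm s_def)
      qed (use s True in auto)
      also have "emeasure lborel (cball w (4 * s)) = ennreal (V * (4 * s) ^ (2 * CARD('n)))"
        using s by (simp add: emeasure_cball V_def mult.commute)
      also have "ennreal (C * s powr \<alpha>) * ennreal (V * (4 * s) ^ (2 * CARD('n))) = ennreal ((C * 4 ^ (2 * CARD('n)) * V) * s powr N)"
      proof -
        have "s powr N = s powr \<alpha> * s powr (real (2 * CARD('n)))"
          by (simp add: N_def powr_add[symmetric] add_ac)
        also have "s powr (real (2 * CARD('n))) = s ^ (2 * CARD('n))" by (rule powr_realpow[OF s])
        finally show ?thesis using C V s by (simp add: power_mult_distrib mult_ac flip: ennreal_mult)
      qed
      also have "\<dots> \<le> ennreal (C' * s powr N)"
        unfolding C'_def using T by (intro ennreal_leI mult_right_mono) auto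
      finally show ?thesis by (simp add: N_def s_def)
    next
      case False
      have "T * 1 \<le> T * ((10 * s) powr N)"
        using False N T by (intro mult_left_mono ge_one_powr_ge_zero) auto
      then have "T \<le> (T * 10 powr N) * s powr N" using s by (simp add: powr_mult mult.assoc)
      also have "\<dots> \<le> C' * s powr N"
        unfolding C'_def using C V by (intro mult_right_mono) auto
      finally have "ennreal T \<le> ennreal (C' * s powr N)" by (rule ennreal_leI)
      moreover have "emeasure (weighted_lborel \<alpha>) (cball w (3 * s)) \<le> ennreal T"
        by (rule T) measurable
      ultimately have "emeasure (weighted_lborel \<alpha>) (cball w (3 * s)) \<le> ennreal (C' * s powr N)" by (rule order_trans[rotated])
      then show ?thesis by (simp add: N_def s_def)
    qed
  qed
qed

section \<open>Domination by an area integral\<close>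

lemma ennreal_mult3:
  "0 \<le> a \<Longrightarrow> 0 \<le> b \<Longrightarrow> 0 \<le> c \<Longrightarrow> ennreal a * (ennreal b * (ennreal c * X)) = ennreal (a * (b * c)) * X"
  by (simp add: ennreal_mult mult.assoc)

text \<open>S z integrates |f(w)|^p (1 - |w|)^(-2n) over a nontangential region at z, up to a
  constant. For every t the Euclidean ball of radius (1 - t|z|)/2 about tz lies in this region, and
  on it 1 - |w| is comparable to the radius, so the submean inequality gives the same majorant for
  all t.\<close>

lemma radial_area_bound:
  fixes \<alpha> p :: real
  assumes \<alpha>: "\<alpha> > -1" and p: "p > 0"
  obtains C where "C > 0" "\<And>f :: complex ^ 'n \<Rightarrow> complex. holo_on f (ball 0 1) \<Longrightarrow>
    \<exists>S. S \<in> borel_measurable borel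
      \<and> (\<forall>z t. norm z < 1 \<longrightarrow> 0 \<le> t \<longrightarrow> t < 1 \<longrightarrow> ennreal (norm (f (t *\<^sub>R z)) powr p) \<le> S z)
      \<and> (\<integral>\<^sup>+z. S z \<partial>weighted_lborel \<alpha>) \<le> ennreal C * (\<integral>\<^sup>+x. ennreal (norm (f x) powr p) * indicator (ball 0 1) x \<partial>weighted_lborel \<alpha>)"
proof -
  obtain K where K: "K > 0" "\<And>(g :: complex ^ 'n \<Rightarrow> complex) a r. holo_on g (ball a r) \<Longrightarrow> r > 0 \<Longrightarrow>
    ennreal (norm (g a) powr p) * ennreal (r ^ (2 * CARD('n)))
     \<le> ennreal K * (\<integral>\<^sup>+x. ennreal (norm (g x) powr p) * indicator (ball a r) x \<partial>lborel)"
    using submean[OF p] by blast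
  obtain V where V: "V > 0" "\<And>w :: complex ^ 'n. norm w < 1 \<Longrightarrow>
    emeasure (weighted_lborel \<alpha>) (cball w (3 * (1 - norm w))) \<le> ennreal (V * (1 - norm w) powr (2 * CARD('n) + \<alpha>))"
    using weighted_lborel_cball[OF \<alpha>] by blast
  define m where "m = 2 * CARD('n)"
  define C where "C = K * 3 ^ m * (V * 2 powr \<bar>\<alpha>\<bar>)"
  show thesis
  proof (rule that)
    show "C > 0" using K V by (simp add: C_def)
    fix f :: "complex ^ 'n \<Rightarrow> complex" assume f: "holo_on f (ball 0 1)"
    define F where "F x = ennreal (norm (f x) powr p) * indicator (ball 0 1) x" for x
    have [measurable]: "F \<in> borel_measurable borel"
      unfolding F_def by (rule holo_on_measurable_powr[OF f])
    \<comment> \<open>The aperture 3: if w is within \<rho>/2 of tz, where \<rho> = 1 - t|z|, then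
      |w - z| <= 3\<rho>/2, while 1 - |w| >= \<rho>/2.\<close>
    define Q where "Q = {(z :: complex ^ 'n, w). dist w z \<le> 3 * (1 - norm w)}"
    define G where "G z w = F w * ennreal ((1 / (1 - norm w)) ^ m) * indicator Q (z, w)" for z w
    define S where "S z = ennreal (K * 3 ^ m) * (\<integral>\<^sup>+w. G z w \<partial>lborel)" for z
    have Qs: "Q \<in> sets (borel \<Otimes>\<^sub>M borel)"
    proof -
      have "closed Q"
        unfolding Q_def case_prod_beta by (intro closed_Collect_le continuous_intros)
      then show ?thesis unfolding borel_prod by (rule borel_closed)
    qed
    have [measurable]: "(\<lambda>(z, w). G z w) \<in> borel_measurable (M \<Otimes>\<^sub>M N)"
      if "sets M = sets borel" "sets N = sets borel" for M N :: "(complex ^ 'n) measure"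
    proof -
      have "(\<lambda>(z, w). G z w) \<in> borel_measurable (borel \<Otimes>\<^sub>M borel)"
        unfolding G_def using Qs by measurable
      then show ?thesis using that by (simp cong: measurable_cong_sets sets_pair_measure_cong)
    qed
    have Sm: "S \<in> borel_measurable borel" unfolding S_def by measurable
    moreover have "ennreal (norm (f (t *\<^sub>R z)) powr p) \<le> S z" if z: "norm z < 1" and t: "0 \<le> t" "t < 1" for z t
    proof -
      define \<rho> where "\<rho> = 1 - t * norm z"
      have tz: "t * norm z \<le> norm z" "t * norm z \<le> t" using z t by (simp_all add: mult_left_le mult_left_le_one_le)
      have \<rho>: "\<rho> > 0" using tz z by (simp add: \<rho>_def)
      have w: "norm w < 1 \<and> 1 - norm w \<le> 3 / 2 * \<rho> \<and> \<rho> / 2 \<le> 1 - norm w \<and> dist w z \<le> 3 * (1 - norm w)"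
        if "w \<in> ball (t *\<^sub>R z) (\<rho> / 2)" for w
      proof -
        have d: "norm (w - t *\<^sub>R z) < \<rho> / 2" using that by (simp add: dist_norm norm_minus_commute)
        have 1: "norm w - norm (t *\<^sub>R z) \<le> norm (w - t *\<^sub>R z)" by (rule norm_triangle_ineq2)
        have 2: "norm (t *\<^sub>R z) - norm w \<le> norm (w - t *\<^sub>R z)" by (metis norm_minus_commute norm_triangle_ineq2)
        have nt: "norm (t *\<^sub>R z) = 1 - \<rho>" using t by (simp add: \<rho>_def)
        have "w - z = (w - t *\<^sub>R z) + (t - 1) *\<^sub>R z" by (simp add: algebra_simps)
        then have "norm (w - z) \<le> norm (w - t *\<^sub>R z) + norm ((t - 1) *\<^sub>R z)" by (metis norm_triangle_ineq)
        moreover have "norm ((t - 1) *\<^sub>R z) \<le> \<rho>"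
        proof -
          have "norm ((t - 1) *\<^sub>R z) = (1 - t) * norm z" using t by simp
          also have "\<dots> \<le> (1 - t) * 1" using z t by (intro mult_left_mono) auto
          also have "\<dots> \<le> \<rho>" using tz by (simp add: \<rho>_def)
          finally show ?thesis .
        qed
        ultimately have "norm (w - z) \<le> \<rho> / 2 + \<rho>" using d by linarith
        then show ?thesis using d 1 2 nt \<rho> by (simp add: dist_norm)
      qed
      have "holo_on f (ball (t *\<^sub>R z) (\<rho> / 2))" by (rule holo_on_subset[OF f]) (use w in auto)
      from K(2)[OF this] \<rho>
      have "ennreal (norm (f (t *\<^sub>R z)) powr p) * ennreal ((\<rho> / 2) ^ m)
        \<le> ennreal K * (\<integral>\<^sup>+x. ennreal (norm (f x) powr p) * indicator (ball (t *\<^sub>R z) (\<rho> / 2)) x \<partial>lborel)"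
        by (simp add: m_def)
      also have "\<dots> \<le> ennreal K * (\<integral>\<^sup>+x. ennreal ((3 / 2 * \<rho>) ^ m) * G z x \<partial>lborel)"
      proof (intro mult_left_mono nn_integral_mono)
        fix x
        show "ennreal (norm (f x) powr p) * indicator (ball (t *\<^sub>R z) (\<rho> / 2)) x \<le> ennreal ((3 / 2 * \<rho>) ^ m) * G z x"
        proof (cases "x \<in> ball (t *\<^sub>R z) (\<rho> / 2)")
          case True
          from w[OF this] have x: "norm x < 1" "1 - norm x \<le> 3 / 2 * \<rho>" "(z, x) \<in> Q" by (auto simp: Q_def)
          have "1 \<le> ((3 / 2 * \<rho>) * (1 / (1 - norm x))) ^ m" using x by (intro one_le_power) (simp add: field_simps)
          then have "norm (f x) powr p * 1 \<le> norm (f x) powr p * ((3 / 2 * \<rho>) ^ m * (1 / (1 - norm x)) ^ m)"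
            unfolding power_mult_distrib by (intro mult_left_mono) auto
          then show ?thesis using x True \<rho>
            by (simp add: G_def F_def mult_ac ennreal_leI flip: ennreal_mult)
        qed simp
      qed simp
      also have "\<dots> = ennreal K * (ennreal ((3 / 2 * \<rho>) ^ m) * (\<integral>\<^sup>+x. G z x \<partial>lborel))"
        by (subst nn_integral_cmult) auto
      finally have "ennreal (1 / (\<rho> / 2) ^ m) * (ennreal (norm (f (t *\<^sub>R z)) powr p) * ennreal ((\<rho> / 2) ^ m))
        \<le> ennreal (1 / (\<rho> / 2) ^ m) * (ennreal K * (ennreal ((3 / 2 * \<rho>) ^ m) * (\<integral>\<^sup>+x. G z x \<partial>lborel)))"
        by (rule mult_left_mono) simp
      also have "\<dots> = ennreal ((1 / (\<rho> / 2) ^ m) * (K * (3 / 2 * \<rho>) ^ m)) * (\<integral>\<^sup>+x. G z x \<partial>lborel)"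
        by (rule ennreal_mult3) (use \<rho> K(1) in auto)
      also have "(1 / (\<rho> / 2) ^ m) * (K * (3 / 2 * \<rho>) ^ m) = K * 3 ^ m"
        using \<rho> by (simp add: power_mult_distrib power_divide)
      also have "ennreal (1 / (\<rho> / 2) ^ m) * (ennreal (norm (f (t *\<^sub>R z)) powr p) * ennreal ((\<rho> / 2) ^ m))
          = ennreal (norm (f (t *\<^sub>R z)) powr p)"
        using \<rho> by (simp flip: ennreal_mult)
      finally show ?thesis unfolding S_def .
    qed
    moreover have "(\<integral>\<^sup>+z. S z \<partial>weighted_lborel \<alpha>) \<le> ennreal C * (\<integral>\<^sup>+x. F x \<partial>weighted_lborel \<alpha>)"
    proof -
      interpret bm: finite_measure "weighted_lborel \<alpha> :: (complex ^ 'n) measure"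
      proof
        obtain T where "T > 0" "\<And>A. A \<in> sets borel \<Longrightarrow> emeasure (weighted_lborel \<alpha> :: (complex ^ 'n) measure) A \<le> ennreal T"
          using weighted_lborel_total[OF \<alpha>] by blast
        then have "emeasure (weighted_lborel \<alpha> :: (complex ^ 'n) measure) (space (weighted_lborel \<alpha>)) \<le> ennreal T" by (simp add: weighted_lborel_def)
        then show "emeasure (weighted_lborel \<alpha> :: (complex ^ 'n) measure) (space (weighted_lborel \<alpha>)) \<noteq> \<infinity>"
          using ennreal_less_top le_less_trans by (metis infinity_ennreal_def less_irrefl)
      qed
      interpret pr: pair_sigma_finite "weighted_lborel \<alpha> :: (complex ^ 'n) measure" "lborel :: (complex ^ 'n) measure"
        by unfold_locales
      have "(\<integral>\<^sup>+z. S z \<partial>weighted_lborel \<alpha>) = ennreal (K * 3 ^ m) * (\<integral>\<^sup>+z. (\<integral>\<^sup>+w. G z w \<partial>lborel) \<partial>weighted_lborel \<alpha>)"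
        unfolding S_def by (rule nn_integral_cmult) (measurable, simp_all add: sets_weighted_lborel)
      also have "(\<integral>\<^sup>+z. (\<integral>\<^sup>+w. G z w \<partial>lborel) \<partial>weighted_lborel \<alpha>) = (\<integral>\<^sup>+w. (\<integral>\<^sup>+z. G z w \<partial>weighted_lborel \<alpha>) \<partial>lborel)"
        by (rule pr.Fubini'[symmetric]) (measurable, simp_all add: sets_weighted_lborel)
      also have "\<dots> \<le> (\<integral>\<^sup>+w. ennreal (V * 2 powr \<bar>\<alpha>\<bar>) * (ennreal ((1 - (norm w)\<^sup>2) powr \<alpha>) * indicator (ball 0 1) w * F w) \<partial>lborel)"
      proof (rule nn_integral_mono)
        fix w :: "complex ^ 'n"
        show "(\<integral>\<^sup>+z. G z w \<partial>weighted_lborel \<alpha>) \<le> ennreal (V * 2 powr \<bar>\<alpha>\<bar>) * (ennreal ((1 - (norm w)\<^sup>2) powr \<alpha>) * indicator (ball 0 1) w * F w)"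
        proof (cases "norm w < 1")
          case True
          \<comment> \<open>For fixed w the region is a ball in z. Its measure cancels (1 -
            |w|)^(-2n) and leaves (1 - |w|)^\<alpha>, comparable to the weight.\<close>
          have "(\<integral>\<^sup>+z. G z w \<partial>weighted_lborel \<alpha>) = (\<integral>\<^sup>+z. F w * ennreal ((1 / (1 - norm w)) ^ m) * indicator (cball w (3 * (1 - norm w))) z \<partial>weighted_lborel \<alpha>)"
            by (intro nn_integral_cong) (auto simp: G_def Q_def indicator_def)
          also have "\<dots> = F w * ennreal ((1 / (1 - norm w)) ^ m) * emeasure (weighted_lborel \<alpha>) (cball w (3 * (1 - norm w)))"
            by (rule nn_integral_cmult_indicator) (simp add: sets_weighted_lborel)
          also have "\<dots> \<le> F w * ennreal ((1 / (1 - norm w)) ^ m) * ennreal (V * (1 - norm w) powr (2 * CARD('n) + \<alpha>))"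
            using V(2)[OF True] by (intro mult_left_mono) auto
          also have "\<dots> = F w * ennreal ((1 / (1 - norm w)) ^ m * (V * (1 - norm w) powr (2 * CARD('n) + \<alpha>)))"
            using True V by (simp add: ennreal_mult mult.assoc)
          also have "(1 / (1 - norm w)) ^ m * (V * (1 - norm w) powr (2 * CARD('n) + \<alpha>)) = V * (1 - norm w) powr \<alpha>"
          proof -
            have "(1 - norm w) powr (2 * CARD('n) + \<alpha>) = (1 - norm w) powr (real m) * (1 - norm w) powr \<alpha>"
              by (simp add: powr_add[symmetric] m_def)
            also have "(1 - norm w) powr (real m) = (1 - norm w) ^ m" by (rule powr_realpow) (use True in simp)
            finally show ?thesis using True by (simp add: power_divide)
          qed
          also have "F w * ennreal (V * (1 - norm w) powr \<alpha>) \<le> F w * ennreal (V * (2 powr \<bar>\<alpha>\<bar> * (1 - (norm w)\<^sup>2) powr \<alpha>))"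
          proof (intro mult_left_mono ennreal_leI)
            have e: "1 - (norm w)\<^sup>2 = (1 - norm w) * (1 + norm w)" by (simp add: power2_eq_square algebra_simps)
            have "(1 - norm w) * (1 + norm w) \<le> (1 - norm w) * 2" "(1 - norm w) * (1 + norm w) \<ge> (1 - norm w) * 1"
              using True by (intro mult_left_mono; auto)+
            moreover have "0 < (1 - norm w) * (1 + norm w)" using True by (intro mult_pos_pos) (auto simp: add_pos_nonneg)
            ultimately have "(1 - norm w) powr \<alpha> \<le> 2 powr \<bar>\<alpha>\<bar> * (1 - (norm w)\<^sup>2) powr \<alpha>"
              unfolding e using True by (intro powr_comparable) auto
            then show "(1 - norm w) powr \<alpha> \<le> 2 powr \<bar>\<alpha>\<bar> * (1 - (norm w)\<^sup>2) powr \<alpha>" .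
          qed (use V in auto)
          finally show ?thesis using V True by (simp add: ennreal_mult mult_ac)
        qed (simp add: G_def F_def)
      qed
      also have "\<dots> = ennreal (V * 2 powr \<bar>\<alpha>\<bar>) * (\<integral>\<^sup>+x. F x \<partial>weighted_lborel \<alpha>)"
        by (subst nn_integral_weighted_lborel) (auto intro!: nn_integral_cmult)
      finally have "(\<integral>\<^sup>+z. S z \<partial>weighted_lborel \<alpha>) \<le> ennreal (K * 3 ^ m) * (ennreal (V * 2 powr \<bar>\<alpha>\<bar>) * (\<integral>\<^sup>+x. F x \<partial>weighted_lborel \<alpha>))"
        by (simp add: mult_left_mono)
      then show ?thesis using K V by (simp add: C_def ennreal_mult mult.assoc)
    qed
    ultimately show "\<exists>S. S \<in> borel_measurable borel
      \<and> (\<forall>z t. norm z < 1 \<longrightarrow> 0 \<le> t \<longrightarrow> t < 1 \<longrightarrow> ennreal (norm (f (t *\<^sub>R z)) powr p) \<le> S z)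
      \<and> (\<integral>\<^sup>+z. S z \<partial>weighted_lborel \<alpha>) \<le> ennreal C * (\<integral>\<^sup>+x. ennreal (norm (f x) powr p) * indicator (ball 0 1) x \<partial>weighted_lborel \<alpha>)"
      unfolding F_def by blast
  qed
qed

section \<open>Dyadic decompositions and integrals of powers of d\<close>

lemma dyadic_below:
  fixes x :: real
  assumes "0 < x" "x \<le> 1"
  obtains j :: nat where "(1 / 2) ^ Suc j < x" "x \<le> (1 / 2) ^ j"
proof -
  have ex: "\<exists>k. (1 / 2) ^ k < x" using real_arch_pow_inv[OF assms(1), of "1 / 2"] by auto
  define k where "k = (LEAST k. (1 / 2) ^ k < x)"
  have k: "(1 / 2) ^ k < x" unfolding k_def by (rule LeastI_ex[OF ex])
  then have "k \<noteq> 0" using assms by (intro notI) simp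
  then obtain j where j: "k = Suc j" by (cases k) auto
  then have "\<not> (1 / 2) ^ j < x" using not_less_Least[of j "\<lambda>k. (1 / 2) ^ k < x"] unfolding k_def by auto
  then show thesis using k j by (intro that[of j]) auto
qed

lemma power_powr_swap: "x > 0 \<Longrightarrow> (x ^ j) powr a = (x powr a) ^ j" for x a :: real
  by (simp add: powr_power powr_powr mult.commute flip: powr_realpow)

lemma suminf_ennreal_geometric:
  fixes A r :: real
  assumes "0 \<le> A" "0 \<le> r" "r < 1"
  shows "(\<Sum>j. ennreal (A * r ^ j)) = ennreal (A / (1 - r))"
proof -
  have "summable (\<lambda>j. A * r ^ j)" using assms by (intro summable_mult summable_geometric) auto
  moreover have "(\<Sum>j. A * r ^ j) = A / (1 - r)"
    using assms by (simp add: suminf_mult suminf_geometric summable_geometric)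
  ultimately show ?thesis using assms by (simp add: suminf_ennreal2)
qed

lemma one_term_le_suminf_ennreal: "f j \<le> (\<Sum>j. f j)" for f :: "nat \<Rightarrow> ennreal"
  using sum_le_suminf[of f "{j}"] by simp

text \<open>On the shell where d is about 2^(-j) s the integrand is of order (2^(-j) s)^(-\<gamma>)
  and the measure at most of order (2^(-j) s)^N, so the sum is geometric with ratio 2^(\<gamma> - N)
  < 1.\<close>

lemma weighted_lborel_koranyi_inside:
  fixes \<alpha> \<gamma> :: real
  assumes \<alpha>: "\<alpha> > -1" and \<gamma>: "0 \<le> \<gamma>" "\<gamma> < CARD('n) + 1 + \<alpha>"
  obtains C where "C > 0" "\<And>(\<xi> :: complex ^ 'n) s. norm \<xi> = 1 \<Longrightarrow> s > 0 \<Longrightarrow>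
    (\<integral>\<^sup>+z. ennreal (norm (1 - herm z \<xi>) powr (-\<gamma>)) * indicator {z. norm (1 - herm z \<xi>) \<le> s} z \<partial>weighted_lborel \<alpha>)
      \<le> ennreal (C * s powr (CARD('n) + 1 + \<alpha> - \<gamma>))"
proof -
  define N where "N = CARD('n) + 1 + \<alpha>"
  obtain V where V: "V > 0" "\<And>(\<xi> :: complex ^ 'n) s. norm \<xi> = 1 \<Longrightarrow> s > 0 \<Longrightarrow>
    emeasure (weighted_lborel \<alpha>) {u. norm (1 - herm u \<xi>) \<le> s} \<le> ennreal (V * s powr N)"
    using weighted_lborel_koranyi_region[OF \<alpha>] unfolding N_def by blast
  define r where "r = (1 / 2 :: real) powr (N - \<gamma>)"
  have r: "0 \<le> r" "r < 1" using powr_less_mono[of 0 "N - \<gamma>" 2] \<gamma> by (auto simp: r_def N_def powr_divide)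
  define C where "C = V * 2 powr \<gamma> / (1 - r)"
  show thesis
  proof (rule that)
    show "C > 0" using V r by (simp add: C_def)
    fix \<xi> :: "complex ^ 'n" and s :: real assume \<xi>: "norm \<xi> = 1" and s: "s > 0"
    let ?d = "\<lambda>z. norm (1 - herm z \<xi>)"
    let ?a = "\<lambda>j. ennreal (((1 / 2) ^ Suc j * s) powr (-\<gamma>))"
    let ?D = "\<lambda>j. {z. ?d z \<le> (1 / 2) ^ j * s}"
    have "(\<integral>\<^sup>+z. ennreal (?d z powr (-\<gamma>)) * indicator {z. ?d z \<le> s} z \<partial>weighted_lborel \<alpha>)
        \<le> (\<integral>\<^sup>+z. (\<Sum>j. ?a j * indicator (?D j) z) \<partial>weighted_lborel \<alpha>)"
    proof (rule nn_integral_mono)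
      fix z
      show "ennreal (?d z powr (-\<gamma>)) * indicator {z. ?d z \<le> s} z \<le> (\<Sum>j. ?a j * indicator (?D j) z)"
      \<comment> \<open>Where d vanishes the integrand is 0, since \<open>0 powr\<close> any
        exponent is 0.\<close>
      proof (cases "0 < ?d z \<and> ?d z \<le> s")
        case True
        then have "0 < ?d z / s" "?d z / s \<le> 1" using s by auto
        then obtain j where j: "(1 / 2) ^ Suc j < ?d z / s" "?d z / s \<le> (1 / 2) ^ j" by (rule dyadic_below)
        then have j': "(1 / 2) ^ Suc j * s < ?d z" "?d z \<le> (1 / 2) ^ j * s"
          using s by (simp_all only: pos_less_divide_eq pos_divide_le_eq)
        have "?d z powr (-\<gamma>) \<le> ((1 / 2) ^ Suc j * s) powr (-\<gamma>)"
          using \<gamma> s j' by (intro powr_mono2') auto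
        then have "ennreal (?d z powr (-\<gamma>)) * indicator {z. ?d z \<le> s} z \<le> ?a j * indicator (?D j) z"
          using j' True by (simp add: ennreal_leI)
        also have "\<dots> \<le> (\<Sum>j. ?a j * indicator (?D j) z)"
          by (rule one_term_le_suminf_ennreal[of "\<lambda>j. ?a j * indicator (?D j) z"])
        finally show ?thesis .
      qed (auto simp: indicator_def)
    qed
    also have "\<dots> = (\<Sum>j. \<integral>\<^sup>+z. ?a j * indicator (?D j) z \<partial>weighted_lborel \<alpha>)"
      by (rule nn_integral_suminf) (simp add: measurable_cong_sets[OF sets_weighted_lborel refl])
    also have "\<dots> \<le> (\<Sum>j. ennreal ((V * 2 powr \<gamma> * s powr (N - \<gamma>)) * r ^ j))"
    proof (intro suminf_le allI)
      fix j
      have "(\<integral>\<^sup>+z. ?a j * indicator (?D j) z \<partial>weighted_lborel \<alpha>) = ?a j * emeasure (weighted_lborel \<alpha>) (?D j)"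
        by (rule nn_integral_cmult_indicator) (simp add: sets_weighted_lborel)
      also have "\<dots> \<le> ?a j * ennreal (V * ((1 / 2) ^ j * s) powr N)"
        using s by (intro mult_left_mono V \<xi>) auto
      also have "\<dots> = ennreal ((V * 2 powr \<gamma> * s powr (N - \<gamma>)) * r ^ j)"
      proof -
        have "((1 / 2) ^ Suc j * s) powr (-\<gamma>) * (((1 / 2) ^ j * s) powr N)
            = ((1 / 2) powr (-\<gamma>)) * (((1 / 2) ^ j * s) powr (-\<gamma>) * ((1 / 2) ^ j * s) powr N)"
        proof -
          have "(1 / 2 * x) powr a = (1 / 2) powr a * x powr a" if "x > 0" for x a :: real
            using that by (simp add: powr_divide)
          from this[of "(1 / 2) ^ j * s" "-\<gamma>"] s show ?thesis by simp
        qed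
        also have "((1 / 2) ^ j * s) powr (-\<gamma>) * ((1 / 2) ^ j * s) powr N = ((1 / 2) ^ j * s) powr (N - \<gamma>)"
          by (simp add: powr_add[symmetric])
        also have "((1 / 2) ^ j * s) powr (N - \<gamma>) = r ^ j * s powr (N - \<gamma>)"
          using s by (simp add: powr_mult power_powr_swap r_def)
        also have "(1 / 2 :: real) powr (-\<gamma>) = 2 powr \<gamma>"
          by (simp add: powr_minus powr_divide)
        finally show ?thesis using V by (simp add: mult_ac flip: ennreal_mult)
      qed
      finally show "(\<integral>\<^sup>+z. ?a j * indicator (?D j) z \<partial>weighted_lborel \<alpha>) \<le> ennreal ((V * 2 powr \<gamma> * s powr (N - \<gamma>)) * r ^ j)" .
    qed auto
    also have "\<dots> = ennreal ((V * 2 powr \<gamma> * s powr (N - \<gamma>)) / (1 - r))"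
      using V r by (intro suminf_ennreal_geometric) auto
    finally show "(\<integral>\<^sup>+z. ennreal (?d z powr (-\<gamma>)) * indicator {z. ?d z \<le> s} z \<partial>weighted_lborel \<alpha>)
      \<le> ennreal (C * s powr (CARD('n) + 1 + \<alpha> - \<gamma>))"
      by (simp add: C_def N_def)
  qed
qed

text \<open>The same summation outwards, geometric because now \<gamma> > N. The maximum with s lets
  the core d <= s belong to the first shell. This integral governs the norms of the test
  functions.\<close>

lemma weighted_lborel_koranyi_outside:
  fixes \<alpha> \<gamma> :: real
  assumes \<alpha>: "\<alpha> > -1" and \<gamma>: "\<gamma> > CARD('n) + 1 + \<alpha>"
  obtains C where "C > 0" "\<And>(\<xi> :: complex ^ 'n) s. norm \<xi> = 1 \<Longrightarrow> s > 0 \<Longrightarrow>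
    (\<integral>\<^sup>+z. ennreal (max s (norm (1 - herm z \<xi>)) powr (-\<gamma>)) \<partial>weighted_lborel \<alpha>)
      \<le> ennreal (C * s powr (CARD('n) + 1 + \<alpha> - \<gamma>))"
proof -
  define N where "N = CARD('n) + 1 + \<alpha>"
  obtain V where V: "V > 0" "\<And>(\<xi> :: complex ^ 'n) s. norm \<xi> = 1 \<Longrightarrow> s > 0 \<Longrightarrow>
    emeasure (weighted_lborel \<alpha>) {u. norm (1 - herm u \<xi>) \<le> s} \<le> ennreal (V * s powr N)"
    using weighted_lborel_koranyi_region[OF \<alpha>] unfolding N_def by blast
  have \<gamma>0: "\<gamma> > 0" using \<gamma> \<alpha> by linarith
  define r where "r = (2 :: real) powr (N - \<gamma>)"
  have r: "0 \<le> r" "r < 1" using powr_less_mono[of "N - \<gamma>" 0 2] \<gamma> by (auto simp: r_def N_def)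
  define C where "C = V * 2 powr N / (1 - r)"
  show thesis
  proof (rule that)
    show "C > 0" using V r by (simp add: C_def)
    fix \<xi> :: "complex ^ 'n" and s :: real assume \<xi>: "norm \<xi> = 1" and s: "s > 0"
    let ?d = "\<lambda>z. norm (1 - herm z \<xi>)"
    let ?a = "\<lambda>j. ennreal ((2 ^ j * s) powr (-\<gamma>))"
    let ?D = "\<lambda>j. {z. ?d z \<le> 2 ^ Suc j * s}"
    have "(\<integral>\<^sup>+z. ennreal (max s (?d z) powr (-\<gamma>)) \<partial>weighted_lborel \<alpha>)
        \<le> (\<integral>\<^sup>+z. (\<Sum>j. ?a j * indicator (?D j) z) \<partial>weighted_lborel \<alpha>)"
    proof (rule nn_integral_mono)
      fix z
      define m where "m = max s (?d z)"
      have m: "s \<le> m" "?d z \<le> m" by (auto simp: m_def)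
      then have "0 < s / m" "s / m \<le> 1" using s by auto
      then obtain j where j: "(1 / 2) ^ Suc j < s / m" "s / m \<le> (1 / 2) ^ j" by (rule dyadic_below)
      have m0: "m > 0" using m s by linarith
      have j': "2 ^ j * s \<le> m" "m < 2 ^ Suc j * s"
        using j m0 by (simp_all add: field_simps power_divide)
      have "m powr (-\<gamma>) \<le> (2 ^ j * s) powr (-\<gamma>)"
        using \<gamma>0 s j' by (intro powr_mono2') auto
      then have "ennreal (m powr (-\<gamma>)) \<le> ?a j * indicator (?D j) z"
        using j' m by (simp add: ennreal_leI)
      also have "\<dots> \<le> (\<Sum>j. ?a j * indicator (?D j) z)"
        by (rule one_term_le_suminf_ennreal[of "\<lambda>j. ?a j * indicator (?D j) z"])
      finally show "ennreal (max s (?d z) powr (-\<gamma>)) \<le> (\<Sum>j. ?a j * indicator (?D j) z)"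
        unfolding m_def .
    qed
    also have "\<dots> = (\<Sum>j. \<integral>\<^sup>+z. ?a j * indicator (?D j) z \<partial>weighted_lborel \<alpha>)"
      by (rule nn_integral_suminf) (simp add: measurable_cong_sets[OF sets_weighted_lborel refl])
    also have "\<dots> \<le> (\<Sum>j. ennreal ((V * 2 powr N * s powr (N - \<gamma>)) * r ^ j))"
    proof (intro suminf_le allI)
      fix j
      have "(\<integral>\<^sup>+z. ?a j * indicator (?D j) z \<partial>weighted_lborel \<alpha>) = ?a j * emeasure (weighted_lborel \<alpha>) (?D j)"
        by (rule nn_integral_cmult_indicator) (simp add: sets_weighted_lborel)
      also have "\<dots> \<le> ?a j * ennreal (V * (2 ^ Suc j * s) powr N)"
        using s by (intro mult_left_mono V \<xi>) auto
      also have "\<dots> = ennreal ((V * 2 powr N * s powr (N - \<gamma>)) * r ^ j)"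
      proof -
        have "(2 ^ j * s) powr (-\<gamma>) * ((2 ^ Suc j * s) powr N)
            = (2 powr N) * ((2 ^ j * s) powr (-\<gamma>) * (2 ^ j * s) powr N)"
        proof -
          have "(2 * x) powr a = 2 powr a * x powr a" if "x > 0" for x a :: real
            using that by (simp add: powr_mult)
          from this[of "2 ^ j * s" N] s show ?thesis by (simp add: mult_ac)
        qed
        also have "(2 ^ j * s) powr (-\<gamma>) * (2 ^ j * s) powr N = (2 ^ j * s) powr (N - \<gamma>)"
          by (simp add: powr_add[symmetric])
        also have "(2 ^ j * s) powr (N - \<gamma>) = r ^ j * s powr (N - \<gamma>)"
          using s by (simp add: powr_mult power_powr_swap r_def)
        finally show ?thesis using V by (simp add: mult_ac flip: ennreal_mult)
      qed
      finally show "(\<integral>\<^sup>+z. ?a j * indicator (?D j) z \<partial>weighted_lborel \<alpha>) \<le> ennreal ((V * 2 powr N * s powr (N - \<gamma>)) * r ^ j)" .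
    qed auto
    also have "\<dots> = ennreal ((V * 2 powr N * s powr (N - \<gamma>)) / (1 - r))"
      using V r by (intro suminf_ennreal_geometric) auto
    finally show "(\<integral>\<^sup>+z. ennreal (max s (?d z) powr (-\<gamma>)) \<partial>weighted_lborel \<alpha>)
      \<le> ennreal (C * s powr (CARD('n) + 1 + \<alpha> - \<gamma>))"
      by (simp add: C_def N_def)
  qed
qed

section \<open>The kernel on dyadic pieces\<close>

lemma herm_ball:
  assumes "norm \<xi> = 1" "norm z < 1"
  shows "norm (herm z \<xi>) < 1" and "1 - norm z \<le> norm (1 - herm z \<xi>)" and "herm z \<xi> \<noteq> 1"
proof -
  have le: "norm (herm z \<xi>) \<le> norm z" using norm_herm_le[of z \<xi>] assms by simp
  then show "norm (herm z \<xi>) < 1" using assms by simp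
  then show "herm z \<xi> \<noteq> 1" by auto
  show "1 - norm z \<le> norm (1 - herm z \<xi>)" using norm_triangle_ineq2[of 1 "herm z \<xi>"] le by simp
qed

text \<open>1 - h and 1 - th differ by at most 1 - t, so |1 - th| is comparable to the maximum of 1
  - t and |1 - h|.\<close>

lemma radial_distance:
  fixes h :: complex
  assumes h: "norm h < 1" and t: "0 \<le> t" "t < 1"
  shows "1 - t \<le> norm (1 - of_real t * h)" "norm (1 - h) / 2 \<le> norm (1 - of_real t * h)"
    "norm (1 - of_real t * h) \<le> norm (1 - h) + (1 - t)"
proof -
  have "t * norm h \<le> t * 1" using h t by (intro mult_left_mono) auto
  then show 1: "1 - t \<le> norm (1 - of_real t * h)"
    using norm_triangle_ineq2[of 1 "of_real t * h"] t by (simp add: norm_mult)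
  have e: "norm (of_real (1 - t) * h) \<le> 1 - t"
  proof -
    have "norm (of_real (1 - t) * h) = (1 - t) * norm h" using t by (simp only: norm_mult norm_of_real)
    then show ?thesis using h t by (simp add: mult_left_le)
  qed
  have "1 - h = (1 - of_real t * h) - of_real (1 - t) * h" by (simp add: algebra_simps)
  then have "norm (1 - h) \<le> norm (1 - of_real t * h) + norm (of_real (1 - t) * h)" by (metis norm_triangle_ineq4)
  then show "norm (1 - h) / 2 \<le> norm (1 - of_real t * h)" using e 1 by simp
  have "1 - of_real t * h = (1 - h) + of_real (1 - t) * h" by (simp add: algebra_simps)
  then have "norm (1 - of_real t * h) \<le> norm (1 - h) + norm (of_real (1 - t) * h)" by (metis norm_triangle_ineq)
  then show "norm (1 - of_real t * h) \<le> norm (1 - h) + (1 - t)" using e by simp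
qed

lemma norm_cesaro_kernel:
  "norm (cesaro_kernel \<beta> \<xi> f z t) = norm (f (t *\<^sub>R z)) / norm (1 - of_real t * herm z \<xi>) powr \<beta>"
  by (simp add: cesaro_kernel_def norm_divide norm_powr_real_powr')

lemma half_powr_less_one: "0 < e \<Longrightarrow> (1 / 2 :: real) powr e < 1"
  using powr_less_mono[of 0 e 2] by (simp add: powr_divide)

lemma finite_dyadic_ge: "0 < d \<Longrightarrow> finite {k :: nat. d \<le> (1 / 2) ^ k}" for d :: real
proof -
  assume "0 < d"
  then obtain n where n: "(1 / 2) ^ n < d" using real_arch_pow_inv[of d "1 / 2"] by auto
  have "k < n" if "d \<le> (1 / 2) ^ k" for k
  proof (rule ccontr)
    assume "\<not> k < n"
    then have "(1 / 2 :: real) ^ k \<le> (1 / 2) ^ n" by (intro power_decreasing) auto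
    then show False using that n by linarith
  qed
  then have "{k. d \<le> (1 / 2) ^ k} \<subseteq> {..<n}" by auto
  then show ?thesis using finite_subset by blast
qed

text \<open>The nonzero terms start at the first power of 1/2 below d, where the quotient is less
  than 1, and from there they decrease geometrically.\<close>

lemma suminf_dyadic_tail:
  fixes A d \<beta> :: real
  assumes A: "0 \<le> A" and d: "0 < d" and \<beta>: "0 < \<beta>"
  shows "(\<Sum>k. ennreal (A * (if d \<le> (1 / 2) ^ k then 0 else ((1 / 2) ^ k / d) powr \<beta>))) \<le> ennreal (A / (1 - (1 / 2) powr \<beta>))"
proof -
  let ?f = "\<lambda>k. ennreal (A * (if d \<le> (1 / 2) ^ k then 0 else ((1 / 2) ^ k / d) powr \<beta>))"
  have ex: "\<exists>k. (1 / 2) ^ k < d" using real_arch_pow_inv[OF d, of "1 / 2"] by auto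
  define k0 where "k0 = (LEAST k. (1 / 2) ^ k < d)"
  have k0: "(1 / 2) ^ k0 < d" unfolding k0_def by (rule LeastI_ex[OF ex])
  have lt: "d \<le> (1 / 2) ^ k" if "k < k0" for k
    using not_less_Least[of k "\<lambda>k. (1 / 2) ^ k < d"] that unfolding k0_def by auto
  have "(\<Sum>k. ?f k) = (\<Sum>j. ?f (j + k0)) + (\<Sum>j<k0. ?f j)"
    by (rule suminf_offset) (rule summableI)
  also have "(\<Sum>j<k0. ?f j) = 0" by (rule sum.neutral) (use lt in auto)
  also have "(\<Sum>j. ?f (j + k0)) \<le> (\<Sum>j. ennreal (A * ((1 / 2) powr \<beta>) ^ j))"
  proof (intro suminf_le allI ennreal_leI mult_left_mono A)
    fix j
    have "((1 / 2) ^ (j + k0) / d) powr \<beta> \<le> ((1 / 2) ^ j) powr \<beta>"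
    proof (rule powr_mono2)
      show "(1 / 2) ^ (j + k0) / d \<le> (1 / 2) ^ j"
        using k0 d by (simp add: power_add pos_divide_le_eq)
    qed (use \<beta> d in auto)
    then show "(if d \<le> (1 / 2) ^ (j + k0) then 0 else ((1 / 2) ^ (j + k0) / d) powr \<beta>) \<le> ((1 / 2) powr \<beta>) ^ j"
      by (simp add: power_powr_swap)
  qed auto
  also have "\<dots> = ennreal (A / (1 - (1 / 2) powr \<beta>))"
    by (rule suminf_ennreal_geometric) (use A half_powr_less_one[OF \<beta>] in auto)
  finally show ?thesis by simp
qed

text \<open>The terms increase with k up to the last index m, where they are at most
  d^(-\<epsilon>). Read backwards from m the sum is geometric, so its length, about log(1/d), does
  not enter.\<close>

lemma sum_dyadic_head:
  fixes d \<epsilon> :: real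
  assumes d: "0 < d" and \<epsilon>: "0 < \<epsilon>"
  shows "(\<Sum>k | d \<le> (1 / 2) ^ k. ((1 / 2) ^ k) powr (-\<epsilon>)) \<le> d powr (-\<epsilon>) / (1 - (1 / 2) powr \<epsilon>)"
proof (cases "{k. d \<le> (1 / 2) ^ k} = {}")
  case True
  then show ?thesis using half_powr_less_one[OF \<epsilon>] by simp
next
  case False
  let ?J = "{k. d \<le> (1 / 2) ^ k}"
  define \<rho> where "\<rho> = (1 / 2 :: real) powr \<epsilon>"
  have \<rho>: "0 < \<rho>" "\<rho> < 1" using half_powr_less_one[OF \<epsilon>] by (auto simp: \<rho>_def)
  have fin: "finite ?J" by (rule finite_dyadic_ge[OF d])
  define m where "m = Max ?J"
  have m: "d \<le> (1 / 2) ^ m" using Max_in[OF fin False] by (simp add: m_def)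
  have "?J \<subseteq> {..m}" using fin by (auto simp: m_def)
  then have "(\<Sum>k\<in>?J. ((1 / 2) ^ k) powr (-\<epsilon>)) \<le> (\<Sum>k\<le>m. ((1 / 2) ^ k) powr (-\<epsilon>))"
    by (intro sum_mono2) auto
  also have "\<dots> = (\<Sum>k\<le>m. ((1 / 2) ^ (m - k)) powr (-\<epsilon>))"
    by (rule sum.nat_diff_reindex[where n = "Suc m", unfolded lessThan_Suc_atMost, symmetric, of "\<lambda>k. ((1 / 2) ^ k) powr (-\<epsilon>)", simplified])
  also have "\<dots> = (\<Sum>k\<le>m. ((1 / 2) ^ m) powr (-\<epsilon>) * \<rho> ^ k)"
  proof (rule sum.cong[OF refl])
    fix k assume "k \<in> {..m}"
    then have "(1 / 2 :: real) ^ m = (1 / 2) ^ (m - k) * (1 / 2) ^ k" by (simp flip: power_add)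
    then have "((1 / 2 :: real) ^ m) powr (-\<epsilon>) = ((1 / 2) ^ (m - k)) powr (-\<epsilon>) * ((1 / 2) ^ k) powr (-\<epsilon>)"
      by (simp only: powr_mult)
    moreover have "((1 / 2 :: real) ^ k) powr (-\<epsilon>) * \<rho> ^ k = 1"
      by (simp add: \<rho>_def power_powr_swap[symmetric] powr_add[symmetric])
    ultimately show "((1 / 2) ^ (m - k)) powr (-\<epsilon>) = ((1 / 2) ^ m) powr (-\<epsilon>) * \<rho> ^ k"
      by simp
  qed
  also have "\<dots> = ((1 / 2) ^ m) powr (-\<epsilon>) * (\<Sum>k\<le>m. \<rho> ^ k)" by (simp add: sum_distrib_left)
  also have "\<dots> \<le> d powr (-\<epsilon>) * (1 / (1 - \<rho>))"
  proof (rule mult_mono)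
    show "((1 / 2) ^ m) powr (-\<epsilon>) \<le> d powr (-\<epsilon>)" using m d \<epsilon> by (intro powr_mono2') auto
    have "(1 - \<rho>) * (\<Sum>k\<le>m. \<rho> ^ k) = 1 - \<rho> ^ Suc m" by (rule sum_gp_basic)
    also have "\<dots> \<le> 1" using \<rho> by simp
    finally show "(\<Sum>k\<le>m. \<rho> ^ k) \<le> 1 / (1 - \<rho>)" using \<rho> by (simp add: pos_le_divide_eq mult.commute)
  qed (use \<rho> in \<open>auto intro: sum_nonneg\<close>)
  finally show ?thesis by (simp add: \<rho>_def)
qed

text \<open>With \<epsilon> = N/(2q), the factor x_k^(-N/q) is split into two factors
  x_k^(-\<epsilon>). One of them, together with \<phi>_k^(1/q), is at most T^(1/q), T being the sum
  on the right, because a single term is at most the whole sum; the other is summed geometrically to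
  order d^(-\<epsilon>). No convexity is involved, so q < 1 is included.\<close>

lemma dyadic_hardy:
  fixes d N q :: real and \<phi> :: "nat \<Rightarrow> real"
  assumes d: "0 < d" and N: "0 < N" and q: "0 < q" and \<phi>: "\<And>k. 0 \<le> \<phi> k"
  shows "(\<Sum>k | d \<le> (1 / 2) ^ k. ((1 / 2) ^ k) powr (-N / q) * \<phi> k powr (1 / q)) powr q
    \<le> (1 / (1 - (1 / 2) powr (N / (2 * q)))) powr q * (d powr (-N / 2) * (\<Sum>k | d \<le> (1 / 2) ^ k. ((1 / 2) ^ k) powr (-N / 2) * \<phi> k))"
proof -
  let ?J = "{k. d \<le> (1 / 2) ^ k}"
  define \<epsilon> where "\<epsilon> = N / (2 * q)"
  have \<epsilon>: "0 < \<epsilon>" using N q by (simp add: \<epsilon>_def)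
  define \<rho> where "\<rho> = (1 / 2 :: real) powr \<epsilon>"
  have \<rho>: "0 < \<rho>" "\<rho> < 1" using half_powr_less_one[OF \<epsilon>] by (auto simp: \<rho>_def)
  have fin: "finite ?J" by (rule finite_dyadic_ge[OF d])
  define T where "T = (\<Sum>k\<in>?J. ((1 / 2) ^ k) powr (-N / 2) * \<phi> k)"
  have T: "0 \<le> T" unfolding T_def using \<phi> by (intro sum_nonneg) auto
  have "(\<Sum>k\<in>?J. ((1 / 2) ^ k) powr (-N / q) * \<phi> k powr (1 / q)) \<le> (\<Sum>k\<in>?J. ((1 / 2) ^ k) powr (-\<epsilon>) * T powr (1 / q))"
  proof (rule sum_mono)
    fix k assume k: "k \<in> ?J"
    have "((1 / 2) ^ k) powr (-N / 2) * \<phi> k \<le> T"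
      unfolding T_def using fin k \<phi> by (intro member_le_sum[of k ?J "\<lambda>k. ((1 / 2) ^ k) powr (-N / 2) * \<phi> k"]) auto
    then have "(((1 / 2) ^ k) powr (-N / 2) * \<phi> k) powr (1 / q) \<le> T powr (1 / q)"
      using q \<phi> by (intro powr_mono2) auto
    then have "((1 / 2) ^ k) powr (-\<epsilon>) * (((1 / 2) ^ k) powr (-N / 2) * \<phi> k) powr (1 / q) \<le> ((1 / 2) ^ k) powr (-\<epsilon>) * T powr (1 / q)"
      by (rule mult_left_mono) simp
    also have "((1 / 2) ^ k) powr (-\<epsilon>) * (((1 / 2) ^ k) powr (-N / 2) * \<phi> k) powr (1 / q)
        = (((1 / 2) ^ k) powr (-\<epsilon>) * ((1 / 2) ^ k) powr (-N / 2 * (1 / q))) * \<phi> k powr (1 / q)"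
      using \<phi> by (simp add: powr_mult powr_powr mult.assoc)
    also have "((1 / 2 :: real) ^ k) powr (-\<epsilon>) * ((1 / 2) ^ k) powr (-N / 2 * (1 / q)) = ((1 / 2) ^ k) powr (-N / q)"
    proof -
      have "-\<epsilon> + (-N / 2 * (1 / q)) = -N / q" using q by (simp add: \<epsilon>_def field_simps)
      then show ?thesis by (simp add: powr_add[symmetric])
    qed
    finally show "((1 / 2) ^ k) powr (-N / q) * \<phi> k powr (1 / q) \<le> ((1 / 2) ^ k) powr (-\<epsilon>) * T powr (1 / q)" .
  qed
  also have "\<dots> = (\<Sum>k\<in>?J. ((1 / 2) ^ k) powr (-\<epsilon>)) * T powr (1 / q)" by (simp add: sum_distrib_right)
  also have "\<dots> \<le> d powr (-\<epsilon>) / (1 - \<rho>) * T powr (1 / q)"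
    unfolding \<rho>_def by (intro mult_right_mono sum_dyadic_head d \<epsilon>) auto
  finally have "(\<Sum>k\<in>?J. ((1 / 2) ^ k) powr (-N / q) * \<phi> k powr (1 / q)) powr q \<le> (d powr (-\<epsilon>) / (1 - \<rho>) * T powr (1 / q)) powr q"
    using q \<phi> by (intro powr_mono2) (auto intro: sum_nonneg)
  also have "(d powr (-\<epsilon>) / (1 - \<rho>) * T powr (1 / q)) powr q = ((1 / (1 - \<rho>)) * (d powr (-\<epsilon>) * T powr (1 / q))) powr q"
    by simp
  also have "\<dots> = (1 / (1 - \<rho>)) powr q * ((d powr (-\<epsilon>)) powr q * (T powr (1 / q)) powr q)"
    using \<rho> by (simp only: powr_mult)
  also have "(d powr (-\<epsilon>)) powr q = d powr (-N / 2)"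
    using q by (simp add: powr_powr \<epsilon>_def)
  also have "(T powr (1 / q)) powr q = T" using q T by (simp add: powr_powr)
  finally show ?thesis unfolding T_def \<rho>_def \<epsilon>_def .
qed

text \<open>On the k-th piece the kernel is at most (2 / max(x_k, d))^\<beta> and the mass of \<mu>
  at most K x_k^(\<beta> + \<delta>). The factor x_k^\<delta> is handed over to the bounds for f;
  what remains is the \<beta>-th power of x_k / max(x_k, d). X is the localized bound for the pieces
  with x_k >= d, Y the uniform one that is summed against the decay on the others.\<close>

lemma kernel_integral_bound:
  fixes X :: "nat \<Rightarrow> real" and \<beta> \<delta> K Y :: real and \<xi> z :: "complex ^ 'n"
  assumes z: "norm z < 1" and \<xi>: "norm \<xi> = 1" and \<beta>: "\<beta> > 0" and \<mu>: "borel_measure_01 \<mu>" and K: "0 \<le> K"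
    and \<mu>K: "\<And>r. 0 \<le> r \<Longrightarrow> r < 1 \<Longrightarrow> emeasure \<mu> {r..<1} \<le> ennreal (K * (1 - r) powr (\<beta> + \<delta>))"
  defines "d \<equiv> norm (1 - herm z \<xi>)"
  assumes X: "\<And>k t. d \<le> (1 / 2) ^ k \<Longrightarrow> 0 \<le> t \<Longrightarrow> (1 / 2) ^ Suc k < 1 - t \<Longrightarrow> 1 - t \<le> (1 / 2) ^ k \<Longrightarrow>
      ((1 / 2) ^ k) powr \<delta> * norm (f (t *\<^sub>R z)) \<le> X k"
    and X0: "\<And>k. 0 \<le> X k"
    and Y: "\<And>k t. 0 \<le> t \<Longrightarrow> (1 / 2) ^ Suc k < 1 - t \<Longrightarrow> 1 - t \<le> (1 / 2) ^ k \<Longrightarrow>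
      ((1 / 2) ^ k) powr \<delta> * norm (f (t *\<^sub>R z)) \<le> Y"
    and Y0: "0 \<le> Y"
  shows "(\<integral>\<^sup>+t. ennreal (norm (cesaro_kernel \<beta> \<xi> f z t)) \<partial>\<mu>)
    \<le> ennreal (K * 2 powr \<beta> * ((\<Sum>k | d \<le> (1 / 2) ^ k. X k) + Y / (1 - (1 / 2) powr \<beta>)))"
proof -
  have sets\<mu>: "sets \<mu> = sets (restrict_space borel {0..<1})" using \<mu> by (simp add: borel_measure_01_def)
  have sp: "space \<mu> = {0..<1}" using sets_eq_imp_space_eq[OF sets\<mu>] by (simp add: space_restrict_space)
  have h: "norm (herm z \<xi>) < 1" and d0: "0 < d"
    using herm_ball[OF \<xi> z] by (auto simp: d_def)
  define x where "x k = (1 / 2 :: real) ^ k" for k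
  have x: "x k > 0" for k by (simp add: x_def)
  have fin: "finite {k. d \<le> x k}" using finite_dyadic_ge[OF d0] by (simp add: x_def)
  define B where "B k = 2 powr \<beta> * max (x k) d powr (-\<beta>) * (x k powr (-\<delta>) * (if d \<le> x k then X k else Y))" for k
  have B0: "B k \<ge> 0" for k using X0 Y0 by (simp add: B_def)
  define I where "I k = {t. 0 \<le> t \<and> x (Suc k) < 1 - t \<and> 1 - t \<le> x k}" for k
  have Im: "I k \<in> sets \<mu>" and Isub: "I k \<subseteq> {1 - x k..<1}" for k
  proof -
    have "I k \<subseteq> {0..<1}" using x[of "Suc k"] by (auto simp: I_def)
    moreover have "I k \<in> sets borel" unfolding I_def by measurable
    ultimately show "I k \<in> sets \<mu>" unfolding sets\<mu> by (auto simp: sets_restrict_space_iff)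
    show "I k \<subseteq> {1 - x k..<1}" using x[of "Suc k"] by (auto simp: I_def)
  qed
  have "(\<integral>\<^sup>+t. ennreal (norm (cesaro_kernel \<beta> \<xi> f z t)) \<partial>\<mu>) \<le> (\<integral>\<^sup>+t. (\<Sum>k. ennreal (B k) * indicator (I k) t) \<partial>\<mu>)"
  proof (rule nn_integral_mono)
    fix t assume "t \<in> space \<mu>"
    then have t: "0 \<le> t" "t < 1" by (auto simp: sp)
    then have "0 < 1 - t" "1 - t \<le> 1" by auto
    then obtain k where k: "x (Suc k) < 1 - t" "1 - t \<le> x k" unfolding x_def by (rule dyadic_below)
    define b where "b = norm (1 - of_real t * herm z \<xi>)"
    define v where "v = norm (f (t *\<^sub>R z))"
    have b: "max (x k) d / 2 \<le> b"
      using radial_distance(1,2)[OF h t] k by (auto simp: b_def d_def x_def)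
    have m0: "max (x k) d > 0" using d0 by simp
    have "v \<le> x k powr (-\<delta>) * (if d \<le> x k then X k else Y)"
    proof -
      have "x k powr \<delta> * v \<le> (if d \<le> x k then X k else Y)"
        using X[of k t] Y[of t k] t k by (auto simp: x_def v_def)
      then have "x k powr (-\<delta>) * (x k powr \<delta> * v) \<le> x k powr (-\<delta>) * (if d \<le> x k then X k else Y)"
        by (rule mult_left_mono) simp
      moreover have "x k powr (-\<delta>) * (x k powr \<delta> * v) = v"
        using x[of k] by (simp add: mult.assoc[symmetric] powr_add[symmetric])
      ultimately show ?thesis by simp
    qed
    moreover have "b powr (-\<beta>) \<le> 2 powr \<beta> * max (x k) d powr (-\<beta>)"
    proof -
      have "b powr (-\<beta>) \<le> (max (x k) d / 2) powr (-\<beta>)" using b m0 \<beta> by (intro powr_mono2') auto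
      also have "\<dots> = 2 powr \<beta> * max (x k) d powr (-\<beta>)"
        using m0 by (simp add: powr_divide powr_minus divide_simps)
      finally show ?thesis .
    qed
    ultimately have "b powr (-\<beta>) * v \<le> B k"
      unfolding B_def by (intro mult_mono) (auto simp: v_def)
    then have "norm (cesaro_kernel \<beta> \<xi> f z t) \<le> B k"
      by (simp add: norm_cesaro_kernel b_def v_def powr_minus divide_inverse mult.commute)
    then have "ennreal (norm (cesaro_kernel \<beta> \<xi> f z t)) \<le> ennreal (B k) * indicator (I k) t"
      using k t by (simp add: I_def ennreal_leI)
    also have "\<dots> \<le> (\<Sum>k. ennreal (B k) * indicator (I k) t)"
      by (rule one_term_le_suminf_ennreal[of "\<lambda>k. ennreal (B k) * indicator (I k) t"])
    finally show "ennreal (norm (cesaro_kernel \<beta> \<xi> f z t)) \<le> (\<Sum>k. ennreal (B k) * indicator (I k) t)" .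
  qed
  also have "\<dots> = (\<Sum>k. \<integral>\<^sup>+t. ennreal (B k) * indicator (I k) t \<partial>\<mu>)"
    by (rule nn_integral_suminf) (use Im in auto)
  also have "\<dots> \<le> (\<Sum>k. ennreal ((K * 2 powr \<beta>) * (if d \<le> x k then X k else 0)) + ennreal ((K * 2 powr \<beta> * Y) * (if d \<le> x k then 0 else (x k / d) powr \<beta>)))"
  proof (intro suminf_le allI)
    fix k
    have "(\<integral>\<^sup>+t. ennreal (B k) * indicator (I k) t \<partial>\<mu>) = ennreal (B k) * emeasure \<mu> (I k)"
      by (rule nn_integral_cmult_indicator[OF Im])
    also have "\<dots> \<le> ennreal (B k) * ennreal (K * x k powr (\<beta> + \<delta>))"
    proof (rule mult_left_mono)
      \<comment> \<open>Only the masses of tails are known, so the piece is enlarged to the tail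
        that starts at 1 - x_k.\<close>
      have "{1 - x k..<1} \<in> sets \<mu>"
        unfolding sets\<mu> by (auto simp: sets_restrict_space_iff x_def power_le_one)
      then have "emeasure \<mu> (I k) \<le> emeasure \<mu> {1 - x k..<1}" by (intro emeasure_mono Isub)
      also have "\<dots> \<le> ennreal (K * (1 - (1 - x k)) powr (\<beta> + \<delta>))"
        using x[of k] by (intro \<mu>K) (auto simp: x_def power_le_one)
      finally show "emeasure \<mu> (I k) \<le> ennreal (K * x k powr (\<beta> + \<delta>))" by simp
    qed simp
    also have "\<dots> = ennreal (B k * (K * x k powr (\<beta> + \<delta>)))" using B0 K by (simp add: ennreal_mult)
    also have "B k * (K * x k powr (\<beta> + \<delta>))
        = K * 2 powr \<beta> * (max (x k) d powr (-\<beta>) * x k powr \<beta>) * ((x k powr (-\<delta>) * x k powr \<delta>) * (if d \<le> x k then X k else Y))"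
      by (simp add: B_def powr_add)
    also have "x k powr (-\<delta>) * x k powr \<delta> = 1" using x[of k] by (simp add: powr_add[symmetric])
    \<comment> \<open>The two regimes separate here: no decay for x_k >= d, geometric decay
      below.\<close>
    also have "max (x k) d powr (-\<beta>) * x k powr \<beta> = (if d \<le> x k then 1 else (x k / d) powr \<beta>)"
      using x[of k] d0 by (auto simp: max_def powr_add[symmetric] powr_minus powr_divide divide_simps)
    also have "ennreal (K * 2 powr \<beta> * (if d \<le> x k then 1 else (x k / d) powr \<beta>) * (1 * (if d \<le> x k then X k else Y)))
        = ennreal ((K * 2 powr \<beta>) * (if d \<le> x k then X k else 0)) + ennreal ((K * 2 powr \<beta> * Y) * (if d \<le> x k then 0 else (x k / d) powr \<beta>))"
      by (simp add: mult_ac)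
    finally show "(\<integral>\<^sup>+t. ennreal (B k) * indicator (I k) t \<partial>\<mu>)
      \<le> ennreal ((K * 2 powr \<beta>) * (if d \<le> x k then X k else 0)) + ennreal ((K * 2 powr \<beta> * Y) * (if d \<le> x k then 0 else (x k / d) powr \<beta>))" .
  qed auto
  also have "\<dots> = (\<Sum>k. ennreal ((K * 2 powr \<beta>) * (if d \<le> x k then X k else 0)))
      + (\<Sum>k. ennreal ((K * 2 powr \<beta> * Y) * (if d \<le> x k then 0 else (x k / d) powr \<beta>)))"
    by (rule suminf_add[symmetric]) auto
  also have "(\<Sum>k. ennreal ((K * 2 powr \<beta>) * (if d \<le> x k then X k else 0))) = (\<Sum>k\<in>{k. d \<le> x k}. ennreal ((K * 2 powr \<beta>) * X k))"
    by (subst suminf_finite[OF fin]) auto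
  also have "\<dots> = ennreal (K * 2 powr \<beta> * (\<Sum>k\<in>{k. d \<le> x k}. X k))"
    using K X0 by (subst sum_ennreal) (auto simp: sum_distrib_left)
  also have "\<dots> + (\<Sum>k. ennreal ((K * 2 powr \<beta> * Y) * (if d \<le> x k then 0 else (x k / d) powr \<beta>)))
     \<le> ennreal (K * 2 powr \<beta> * (\<Sum>k\<in>{k. d \<le> x k}. X k)) + ennreal ((K * 2 powr \<beta> * Y) / (1 - (1 / 2) powr \<beta>))"
    unfolding x_def by (intro add_left_mono suminf_dyadic_tail d0 \<beta>) (use K Y0 in auto)
  also have "\<dots> = ennreal (K * 2 powr \<beta> * ((\<Sum>k\<in>{k. d \<le> x k}. X k) + Y / (1 - (1 / 2) powr \<beta>)))"
    using K X0 Y0 half_powr_less_one[OF \<beta>]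
    by (subst ennreal_plus[symmetric]) (auto simp: distrib_left intro!: mult_nonneg_nonneg sum_nonneg)
  finally show ?thesis by (simp add: x_def)
qed

section \<open>The norm estimate\<close>

lemma le_powr_inverse:
  fixes v a p :: real
  assumes "0 \<le> v" "0 < p" "v powr p \<le> a"
  shows "v \<le> a powr (1 / p)"
proof -
  have "v = (v powr p) powr (1 / p)" using assms by (simp add: powr_powr)
  also have "\<dots> \<le> a powr (1 / p)" using assms by (intro powr_mono2) auto
  finally show ?thesis .
qed

text \<open>If x lies in the regions with indices k0 <= k, then 2^(-k0) <= 4(1 - |x|^2) <= 8 |1 -
  \<langle>x,\<xi>\<rangle>| <= 48 * 2^(-k). As 48 < 2^6, the index k is one of the six from k0
  on.\<close>

lemma dyadic_region_overlap:
  assumes \<xi>: "norm \<xi> = 1" and x: "norm x < 1"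
  shows "(\<Sum>k. indicator {x. (1 / 2) ^ k \<le> 4 * (1 - (norm x)\<^sup>2) \<and> norm (1 - herm x \<xi>) \<le> 6 * (1 / 2) ^ k} x) \<le> (6 :: ennreal)"
proof -
  let ?Q = "\<lambda>k :: nat. {x. (1 / 2) ^ k \<le> 4 * (1 - (norm x)\<^sup>2) \<and> norm (1 - herm x \<xi>) \<le> 6 * (1 / 2) ^ k}"
  show ?thesis
  proof (cases "\<exists>k. x \<in> ?Q k")
    case False
    then have "(\<lambda>k. indicator (?Q k) x :: ennreal) = (\<lambda>_. 0)" by auto
    then show ?thesis by simp
  next
    case True
    define k0 where "k0 = (LEAST k. x \<in> ?Q k)"
    have k0: "x \<in> ?Q k0" unfolding k0_def by (rule LeastI_ex[OF True])
    have in_range: "k \<in> {k0..<k0 + 6}" if k: "x \<in> ?Q k" for k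
    proof -
      have ge: "k0 \<le> k" unfolding k0_def by (rule Least_le[of "\<lambda>k. x \<in> ?Q k", OF k])
      have "1 - (norm x)\<^sup>2 \<le> 2 * (1 - norm x)"
        using zero_le_power2[of "1 - norm x"] by (simp add: power2_eq_square algebra_simps)
      also have "\<dots> \<le> 2 * norm (1 - herm x \<xi>)" using herm_ball(2)[OF \<xi> x] by simp
      finally have "(1 / 2) ^ k0 \<le> 48 * (1 / 2 :: real) ^ k" using k k0 by auto
      also have "(1 / 2 :: real) ^ k = (1 / 2) ^ k0 * (1 / 2) ^ (k - k0)" using ge by (simp flip: power_add)
      finally have "1 \<le> 48 * (1 / 2 :: real) ^ (k - k0)" by simp
      moreover have "(1 / 2 :: real) ^ (k - k0) \<le> (1 / 2) ^ 6" if "6 \<le> k - k0"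
        using that by (intro power_decreasing) auto
      moreover have "(1 / 2 :: real) ^ 6 = 1 / 64" by (simp add: power_divide)
      ultimately have "\<not> 6 \<le> k - k0" by linarith
      then show ?thesis using ge by auto
    qed
    have "(\<Sum>k. indicator (?Q k) x :: ennreal) = (\<Sum>k\<in>{k0..<k0 + 6}. indicator (?Q k) x)"
    proof (rule suminf_finite)
      fix k assume "k \<notin> {k0..<k0 + 6}"
      then have "x \<notin> ?Q k" using in_range by blast
      then show "indicator (?Q k) x = (0 :: ennreal)" by (rule indicator_simps(2))
    qed simp
    also have "\<dots> \<le> (\<Sum>k\<in>{k0..<k0 + 6}. 1)" by (intro sum_mono) (simp add: indicator_def)
    finally show ?thesis by simp
  qed
qed

text \<open>C depends on \<mu> only through K, and not on \<xi> or f. Pointwise, the q-th power of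
  the operator is bounded by two integrable majorants, G for the pieces with x_k >= d and S for the
  others. The normalization of f supplies masses at most 1 and a growth bound with a fixed
  constant.\<close>

lemma cesaro_estimate:
  fixes \<alpha> \<beta> \<delta> p q K :: real
  assumes \<alpha>: "\<alpha> > -1" and \<beta>: "\<beta> > 0" and p: "0 < p" and pq: "p \<le> q" and K: "0 < K"
  defines "N \<equiv> CARD('n) + 1 + \<alpha>"
  assumes \<delta>: "\<delta> = N * (1 / p - 1 / q)"
  obtains C where "C > 0" "\<And>\<mu> (\<xi> :: complex ^ 'n) (f :: complex ^ 'n \<Rightarrow> complex). norm \<xi> = 1 \<Longrightarrow> borel_measure_01 \<mu> \<Longrightarrow>
    (\<And>r. 0 \<le> r \<Longrightarrow> r < 1 \<Longrightarrow> emeasure \<mu> {r..<1} \<le> ennreal (K * (1 - r) powr (\<beta> + \<delta>))) \<Longrightarrow>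
    holo_on f (ball 0 1) \<Longrightarrow>
    (\<integral>\<^sup>+x. ennreal (norm (f x) powr p) * indicator (ball 0 1) x \<partial>weighted_lborel \<alpha>) \<le> 1 \<Longrightarrow>
    (\<integral>\<^sup>+x. ennreal (norm (cesaro \<mu> \<beta> \<xi> f x) powr q) * indicator (ball 0 1) x \<partial>weighted_lborel \<alpha>) \<le> ennreal C"
proof -
  have q: "0 < q" using p pq by simp
  have N: "0 < N" using \<alpha> by (simp add: N_def)
  have pqi: "1 / q \<le> 1 / p" using p pq by (simp add: frac_le)
  obtain K1 where K1: "K1 > 0" "\<And>(f :: complex ^ 'n \<Rightarrow> complex) \<xi> w. holo_on f (ball 0 1) \<Longrightarrow> norm \<xi> = 1 \<Longrightarrow> norm w < 1 \<Longrightarrow>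
    ennreal (norm (f w) powr p) * ennreal ((1 - norm w) powr N)
     \<le> ennreal K1 * (\<integral>\<^sup>+x. ennreal (norm (f x) powr p) * indicator (ball 0 1) x *
         indicator {x. 1 - norm w \<le> 2 * (1 - (norm x)\<^sup>2) \<and> norm (1 - herm x \<xi>) \<le> 3 * norm (1 - herm w \<xi>)} x \<partial>weighted_lborel \<alpha>)"
    using submean_aniso[OF p, where \<alpha> = \<alpha>] unfolding N_def by blast
  obtain C5 where C5: "C5 > 0" "\<And>f :: complex ^ 'n \<Rightarrow> complex. holo_on f (ball 0 1) \<Longrightarrow>
    \<exists>S. S \<in> borel_measurable borel
      \<and> (\<forall>z t. norm z < 1 \<longrightarrow> 0 \<le> t \<longrightarrow> t < 1 \<longrightarrow> ennreal (norm (f (t *\<^sub>R z)) powr p) \<le> S z)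
      \<and> (\<integral>\<^sup>+z. S z \<partial>weighted_lborel \<alpha>) \<le> ennreal C5 * (\<integral>\<^sup>+x. ennreal (norm (f x) powr p) * indicator (ball 0 1) x \<partial>weighted_lborel \<alpha>)"
    using radial_area_bound[OF \<alpha> p] by blast
  obtain C4 where C4: "C4 > 0" "\<And>(\<xi> :: complex ^ 'n) s. norm \<xi> = 1 \<Longrightarrow> s > 0 \<Longrightarrow>
    (\<integral>\<^sup>+z. ennreal (norm (1 - herm z \<xi>) powr (-(N / 2))) * indicator {z. norm (1 - herm z \<xi>) \<le> s} z \<partial>weighted_lborel \<alpha>)
      \<le> ennreal (C4 * s powr (N - N / 2))"
  proof -
    have "0 \<le> N / 2" "N / 2 < CARD('n) + 1 + \<alpha>" using N by (auto simp: N_def)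
    from weighted_lborel_koranyi_inside[OF \<alpha> this] that show thesis unfolding N_def by blast
  qed
  define \<rho>b where "\<rho>b = 1 - (1 / 2 :: real) powr \<beta>"
  have \<rho>b: "\<rho>b > 0" using half_powr_less_one[OF \<beta>] by (simp add: \<rho>b_def)
  \<comment> \<open>C1 belongs to the submean bound on the regions at \<xi>, C2 to the Hardy
    inequality, C3 to the growth bound raised to 1/p - 1/q. The factor \<open>2 powr N\<close> pays
    for replacing 1 - |w| by x_k / 2.\<close>
  define C1 where "C1 = (K1 * 2 powr N) powr (1 / p)"
  define C2 where "C2 = (1 / (1 - (1 / 2 :: real) powr (N / (2 * q)))) powr q"
  define C3 where "C3 = (K1 * 2 powr N) powr (1 / p - 1 / q)"
  define M where "M = K * 2 powr \<beta> * (C1 + C3 / \<rho>b)"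
  have C123: "C1 \<ge> 0" "C2 \<ge> 0" "C3 \<ge> 0" by (simp_all add: C1_def C2_def C3_def)
  have "C1 > 0" using K1 by (simp add: C1_def)
  then have Mpos: "M > 0"
    unfolding M_def using K C123 \<rho>b by (intro mult_pos_pos add_pos_nonneg) auto
  then have M0: "M \<ge> 0" by simp
  define M' where "M' = (2 * M) powr q"
  \<comment> \<open>The summand 1 ensures that C is positive.\<close>
  define C where "C = M' * (6 * C2 * C4 + C5) + 1"
  show thesis
  proof (rule that)
    show "C > 0" unfolding C_def M'_def using C123 C4 C5 by (intro add_nonneg_pos mult_nonneg_nonneg) auto
    fix \<mu> and \<xi> :: "complex ^ 'n" and f :: "complex ^ 'n \<Rightarrow> complex"
    assume \<xi>: "norm \<xi> = 1" and \<mu>: "borel_measure_01 \<mu>"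
      and \<mu>K: "\<And>r. 0 \<le> r \<Longrightarrow> r < 1 \<Longrightarrow> emeasure \<mu> {r..<1} \<le> ennreal (K * (1 - r) powr (\<beta> + \<delta>))"
      and f: "holo_on f (ball 0 1)"
      and f1: "(\<integral>\<^sup>+x. ennreal (norm (f x) powr p) * indicator (ball 0 1) x \<partial>weighted_lborel \<alpha>) \<le> 1"
    define F where "F x = ennreal (norm (f x) powr p) * indicator (ball 0 1) x" for x
    have [measurable]: "F \<in> borel_measurable borel"
      unfolding F_def by (rule holo_on_measurable_powr[OF f])
    have Fm [measurable]: "F \<in> borel_measurable (weighted_lborel \<alpha>)" by (simp add: measurable_cong_sets[OF sets_weighted_lborel refl])
    let ?d = "\<lambda>z. norm (1 - herm z \<xi>)"
    define x where "x k = (1 / 2 :: real) ^ k" for k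
    have x: "x k > 0" for k by (simp add: x_def)
    \<comment> \<open>For w = tz with 1 - |w| > x_k / 2 and d(w) <= 2 x_k, the set in the submean
      inequality satisfies x_k / 2 <= 2(1 - |y|^2) and d(y) <= 3 * 2 x_k; hence the constants 4 and
      6.\<close>
    define Q where "Q k = {y. x k \<le> 4 * (1 - (norm y)\<^sup>2) \<and> ?d y \<le> 6 * x k}" for k
    have Q [measurable]: "Q k \<in> sets borel" for k unfolding Q_def by measurable
    have Q' [measurable]: "Q k \<in> sets (weighted_lborel \<alpha>)" for k by (simp add: sets_weighted_lborel)
    define \<Phi> where "\<Phi> k = (\<integral>\<^sup>+y. F y * indicator (Q k) y \<partial>weighted_lborel \<alpha>)" for k
    have \<Phi>sum: "(\<Sum>k. \<Phi> k) \<le> 6"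
    proof -
      have "(\<Sum>k. \<Phi> k) = (\<integral>\<^sup>+y. (\<Sum>k. F y * indicator (Q k) y) \<partial>weighted_lborel \<alpha>)"
        unfolding \<Phi>_def by (rule nn_integral_suminf[symmetric]) measurable
      also have "\<dots> \<le> (\<integral>\<^sup>+y. F y * 6 \<partial>weighted_lborel \<alpha>)"
      proof (rule nn_integral_mono)
        fix y
        show "(\<Sum>k. F y * indicator (Q k) y) \<le> F y * 6"
        proof (cases "norm y < 1")
          case True
          then have "(\<Sum>k. indicator (Q k) y :: ennreal) \<le> 6"
            using dyadic_region_overlap[OF \<xi> True] by (simp add: Q_def x_def)
          then show ?thesis by (simp add: ennreal_suminf_cmult mult_left_mono)
        qed (simp add: F_def)
      qed
      also have "\<dots> = (\<integral>\<^sup>+y. F y \<partial>weighted_lborel \<alpha>) * 6" by (rule nn_integral_multc) measurable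
      also have "\<dots> \<le> 1 * 6" using f1 unfolding F_def by (intro mult_right_mono) auto
      finally show ?thesis by simp
    qed
    have \<Phi>1: "\<Phi> k \<le> 1" for k
    proof -
      have "\<Phi> k \<le> (\<integral>\<^sup>+y. F y \<partial>weighted_lborel \<alpha>)" unfolding \<Phi>_def by (intro nn_integral_mono) (auto simp: indicator_def)
      then show ?thesis using f1 unfolding F_def by (rule order_trans)
    qed
    define \<phi> where "\<phi> k = enn2real (\<Phi> k)" for k
    have \<phi>: "\<Phi> k = ennreal (\<phi> k)" for k
    proof -
      have "\<Phi> k < top" using \<Phi>1[of k] by (rule le_less_trans) simp
      then show ?thesis by (simp add: \<phi>_def)
    qed
    have \<phi>0: "0 \<le> \<phi> k" "\<phi> k \<le> 1" for k
    proof -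
      show "0 \<le> \<phi> k" by (simp add: \<phi>_def)
      then show "\<phi> k \<le> 1" using \<Phi>1[of k] unfolding \<phi> by simp
    qed
    obtain S where S [measurable]: "S \<in> borel_measurable borel"
      and Sf: "\<And>z t. norm z < 1 \<Longrightarrow> 0 \<le> t \<Longrightarrow> t < 1 \<Longrightarrow> ennreal (norm (f (t *\<^sub>R z)) powr p) \<le> S z"
      and SI: "(\<integral>\<^sup>+z. S z \<partial>weighted_lborel \<alpha>) \<le> ennreal C5 * (\<integral>\<^sup>+x. F x \<partial>weighted_lborel \<alpha>)"
      using C5(2)[OF f] unfolding F_def by blast
    \<comment> \<open>The right side of the Hardy inequality, with the condition d <= x_k written as
      an indicator so that it can be integrated term by term.\<close>
    define G where "G z = (\<Sum>k. ennreal (C2 * x k powr (-N / 2)) * \<Phi> k * (ennreal (?d z powr (-(N / 2))) * indicator {z. ?d z \<le> x k} z))" for z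
    have key: "ennreal (norm (cesaro \<mu> \<beta> \<xi> f z) powr q) \<le> ennreal M' * (G z + S z)" if z: "norm z < 1" for z
    proof (cases "S z = top")
      \<comment> \<open>An infinite majorant bounds everything because M' > 0.\<close>
      case True
      then show ?thesis using Mpos by (simp add: ennreal_mult_top M'_def)
    next
      case False
      then obtain \<sigma> where \<sigma>: "S z = ennreal \<sigma>" "0 \<le> \<sigma>" by (cases "S z") auto
      define d where "d = ?d z"
      have d0: "0 < d" using herm_ball[OF \<xi> z] by (simp add: d_def)
      have h: "norm (herm z \<xi>) < 1" by (rule herm_ball[OF \<xi> z])
      let ?J = "{k. d \<le> (1 / 2) ^ k}"
      have fin: "finite ?J" by (rule finite_dyadic_ge[OF d0])
      define X where "X k = C1 * (x k powr (-N / q) * \<phi> k powr (1 / q))" for k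
      define H where "H = (\<Sum>k\<in>?J. x k powr (-N / q) * \<phi> k powr (1 / q))"
      define T where "T = (\<Sum>k\<in>?J. x k powr (-N / 2) * \<phi> k)"
      have H0: "0 \<le> H" and T0: "0 \<le> T" unfolding H_def T_def using \<phi>0 by (auto intro!: sum_nonneg)
      have sub: "norm (f w) powr p * (x k / 2) powr N \<le> norm (f w) powr p * (1 - norm w) powr N"
        if "x (Suc k) < 1 - norm w" for w k
        using that N x[of k] by (intro mult_left_mono powr_mono2) (auto simp: x_def)
      have tz: "norm (t *\<^sub>R z) < 1 \<and> 1 - t \<le> 1 - norm (t *\<^sub>R z)" if "0 \<le> t" "t < 1" for t
      proof -
        have "t * norm z \<le> t * 1" using that z by (intro mult_left_mono) auto
        then show ?thesis using that by simp
      qed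
      have half: "a * (x k / 2) powr N \<le> b \<Longrightarrow> a \<le> 2 powr N * (x k powr (-N) * b)" for a b k
      proof -
        assume le: "a * (x k / 2) powr N \<le> b"
        have "2 powr N * x k powr (-N) * (x k / 2) powr N = 1"
          using x[of k] by (simp add: powr_divide powr_minus)
        then have "a = (2 powr N * x k powr (-N)) * (a * (x k / 2) powr N)" by (simp add: mult_ac)
        also have "\<dots> \<le> (2 powr N * x k powr (-N)) * b" using le by (intro mult_left_mono) auto
        finally show ?thesis by (simp add: mult.assoc)
      qed
      have Xbd: "x k powr \<delta> * norm (f (t *\<^sub>R z)) \<le> X k"
        if k: "d \<le> x k" "0 \<le> t" "x (Suc k) < 1 - t" "1 - t \<le> x k" for k t
      proof -
        let ?w = "t *\<^sub>R z"
        have t1: "t < 1" using k x[of "Suc k"] by linarith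
        have w: "norm ?w < 1" "x (Suc k) < 1 - norm ?w" using tz[OF k(2) t1] k(3) by auto
        have dw: "?d ?w \<le> 2 * x k"
          using radial_distance(3)[OF h k(2) t1] k by (simp add: herm_scaleR_left d_def)
        have "ennreal (norm (f ?w) powr p) * ennreal ((1 - norm ?w) powr N)
          \<le> ennreal K1 * (\<integral>\<^sup>+y. F y * indicator {y. 1 - norm ?w \<le> 2 * (1 - (norm y)\<^sup>2) \<and> ?d y \<le> 3 * ?d ?w} y \<partial>weighted_lborel \<alpha>)"
          using K1(2)[OF f \<xi> w(1)] unfolding F_def .
        also have "\<dots> \<le> ennreal K1 * \<Phi> k"
          unfolding \<Phi>_def using w dw
          by (intro mult_left_mono nn_integral_mono) (auto simp: indicator_def Q_def x_def)
        also have "\<dots> = ennreal (K1 * \<phi> k)" using K1 by (simp add: \<phi> \<phi>0 ennreal_mult)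
        finally have "norm (f ?w) powr p * (1 - norm ?w) powr N \<le> K1 * \<phi> k"
          using K1 \<phi>0 by (simp flip: ennreal_mult)
        then have "norm (f ?w) powr p * (x k / 2) powr N \<le> K1 * \<phi> k" using sub[OF w(2)] by linarith
        then have "norm (f ?w) powr p \<le> 2 powr N * (x k powr (-N) * (K1 * \<phi> k))" by (rule half)
        then have "norm (f ?w) powr p \<le> (K1 * 2 powr N) * (x k powr (-N) * \<phi> k)" by (simp add: mult_ac)
        then have "norm (f ?w) \<le> ((K1 * 2 powr N) * (x k powr (-N) * \<phi> k)) powr (1 / p)"
          using p by (intro le_powr_inverse) auto
        also have "\<dots> = C1 * (x k powr (-N / p) * \<phi> k powr (1 / p))"
          using K1 \<phi>0 by (simp add: powr_mult C1_def powr_powr)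
        \<comment> \<open>This uses p <= q: the exponent of a number in [0,1] may be lowered from
          1/p to 1/q.\<close>
        also have "\<dots> \<le> C1 * (x k powr (-N / p) * \<phi> k powr (1 / q))"
          using \<phi>0 pqi C123 by (intro mult_left_mono powr_mono') auto
        finally have "x k powr \<delta> * norm (f ?w) \<le> x k powr \<delta> * (C1 * (x k powr (-N / p) * \<phi> k powr (1 / q)))"
          by (rule mult_left_mono) simp
        also have "\<dots> = C1 * ((x k powr \<delta> * x k powr (-N / p)) * \<phi> k powr (1 / q))" by (simp add: mult_ac)
        also have "x k powr \<delta> * x k powr (-N / p) = x k powr (-N / q)"
          using x[of k] by (simp add: powr_add[symmetric] \<delta> algebra_simps)
        finally show ?thesis by (simp add: X_def)
      qed
      have Ybd: "x k powr \<delta> * norm (f (t *\<^sub>R z)) \<le> C3 * \<sigma> powr (1 / q)"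
        if k: "0 \<le> t" "x (Suc k) < 1 - t" "1 - t \<le> x k" for k t
      proof -
        let ?w = "t *\<^sub>R z"
        have t1: "t < 1" using k x[of "Suc k"] by linarith
        have w: "norm ?w < 1" "x (Suc k) < 1 - norm ?w" using tz[OF k(1) t1] k(2) by auto
        have "ennreal (norm (f ?w) powr p) * ennreal ((1 - norm ?w) powr N)
          \<le> ennreal K1 * (\<integral>\<^sup>+y. F y * indicator {y. 1 - norm ?w \<le> 2 * (1 - (norm y)\<^sup>2) \<and> ?d y \<le> 3 * ?d ?w} y \<partial>weighted_lborel \<alpha>)"
          using K1(2)[OF f \<xi> w(1)] unfolding F_def .
        also have "\<dots> \<le> ennreal K1 * (\<integral>\<^sup>+y. F y \<partial>weighted_lborel \<alpha>)"
          by (intro mult_left_mono nn_integral_mono) (auto simp: indicator_def)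
        also have "\<dots> \<le> ennreal K1 * 1" using f1 unfolding F_def by (intro mult_left_mono) auto
        finally have "norm (f ?w) powr p * (1 - norm ?w) powr N \<le> K1"
          using K1 by (simp flip: ennreal_mult)
        then have "norm (f ?w) powr p * (x k / 2) powr N \<le> K1" using sub[OF w(2)] by linarith
        then have "norm (f ?w) powr p \<le> 2 powr N * (x k powr (-N) * K1)" by (rule half)
        then have g1: "norm (f ?w) powr p \<le> (K1 * 2 powr N) * x k powr (-N)" by (simp add: mult_ac)
        have g2: "norm (f ?w) powr p \<le> \<sigma>" using Sf[OF z k(1) t1] \<sigma> by simp
        define v where "v = norm (f ?w) powr p"
        have e: "1 / p - 1 / q \<ge> 0" using pqi by simp
        have "norm (f ?w) = v powr (1 / p)" using p by (simp add: v_def powr_powr)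
        \<comment> \<open>The growth bound is spent on the first factor and yields x_k^(-\<delta>);
          the majorant \<sigma>, uniform in t, bounds the second.\<close>
        also have "\<dots> = v powr (1 / p - 1 / q) * v powr (1 / q)" by (simp add: powr_add[symmetric])
        also have "\<dots> \<le> ((K1 * 2 powr N) * x k powr (-N)) powr (1 / p - 1 / q) * \<sigma> powr (1 / q)"
          using g1 g2 e q unfolding v_def[symmetric] by (intro mult_mono powr_mono2) (auto simp: v_def)
        also have "((K1 * 2 powr N) * x k powr (-N)) powr (1 / p - 1 / q) = C3 * x k powr (-\<delta>)"
          using K1 by (simp add: powr_mult powr_powr C3_def \<delta>)
        finally have "x k powr \<delta> * norm (f ?w) \<le> x k powr \<delta> * (C3 * x k powr (-\<delta>) * \<sigma> powr (1 / q))"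
          by (rule mult_left_mono) simp
        also have "\<dots> = (x k powr \<delta> * x k powr (-\<delta>)) * (C3 * \<sigma> powr (1 / q))" by (simp add: mult_ac)
        also have "x k powr \<delta> * x k powr (-\<delta>) = 1" using x[of k] by (simp add: powr_add[symmetric])
        finally show ?thesis by simp
      qed
      \<comment> \<open>This holds even before integrability is known: otherwise the Bochner
        integral has the default value 0.\<close>
      have "ennreal (norm (cesaro \<mu> \<beta> \<xi> f z)) \<le> (\<integral>\<^sup>+t. ennreal (norm (cesaro_kernel \<beta> \<xi> f z t)) \<partial>\<mu>)"
      proof (cases "integrable \<mu> (cesaro_kernel \<beta> \<xi> f z)")
        case True
        then show ?thesis unfolding cesaro_def by (rule integral_norm_bound_ennreal)
      next
        case False
        then show ?thesis by (simp add: cesaro_def not_integrable_integral_eq)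
      qed
      also have "\<dots> \<le> ennreal (K * 2 powr \<beta> * ((\<Sum>k\<in>?J. X k) + C3 * \<sigma> powr (1 / q) / (1 - (1 / 2) powr \<beta>)))"
        unfolding d_def
        by (rule kernel_integral_bound[OF z \<xi> \<beta> \<mu> _ \<mu>K])
          (use Xbd Ybd K C123 in \<open>auto simp: x_def X_def d_def\<close>)
      also have "\<dots> \<le> ennreal (M * (H + \<sigma> powr (1 / q)))"
      proof (rule ennreal_leI)
        have "(\<Sum>k\<in>?J. X k) = C1 * H" by (simp add: X_def H_def sum_distrib_left)
        moreover have "C1 * H \<le> (C1 + C3 / \<rho>b) * H" using C123 \<rho>b H0 by (intro mult_right_mono) auto
        moreover have "C3 * \<sigma> powr (1 / q) / \<rho>b \<le> (C1 + C3 / \<rho>b) * \<sigma> powr (1 / q)"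
          using C123 by (simp add: algebra_simps)
        ultimately have "(\<Sum>k\<in>?J. X k) + C3 * \<sigma> powr (1 / q) / \<rho>b \<le> (C1 + C3 / \<rho>b) * (H + \<sigma> powr (1 / q))"
          by (simp add: distrib_left)
        then have "K * 2 powr \<beta> * ((\<Sum>k\<in>?J. X k) + C3 * \<sigma> powr (1 / q) / \<rho>b) \<le> K * 2 powr \<beta> * ((C1 + C3 / \<rho>b) * (H + \<sigma> powr (1 / q)))"
          using K by (intro mult_left_mono) auto
        then show "K * 2 powr \<beta> * ((\<Sum>k\<in>?J. X k) + C3 * \<sigma> powr (1 / q) / (1 - (1 / 2) powr \<beta>)) \<le> M * (H + \<sigma> powr (1 / q))"
          by (simp add: M_def \<rho>b_def mult.assoc)
      qed
      finally have le: "norm (cesaro \<mu> \<beta> \<xi> f z) \<le> M * (H + \<sigma> powr (1 / q))"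
        using M0 H0 by (simp add: ennreal_le_iff)
      \<comment> \<open>Passing to the maximum gives a q-th power estimate valid for q < 1 and q >=
        1 alike.\<close>
      also have "\<dots> \<le> 2 * M * max H (\<sigma> powr (1 / q))"
      proof -
        have "H + \<sigma> powr (1 / q) \<le> 2 * max H (\<sigma> powr (1 / q))" by simp
        from mult_left_mono[OF this M0] show ?thesis by (simp add: mult_ac)
      qed
      finally have "norm (cesaro \<mu> \<beta> \<xi> f z) powr q \<le> (2 * M * max H (\<sigma> powr (1 / q))) powr q"
        using q by (intro powr_mono2) auto
      also have "\<dots> = M' * (max H (\<sigma> powr (1 / q))) powr q"
        using M0 H0 by (simp add: M'_def powr_mult)
      also have "\<dots> \<le> M' * (H powr q + \<sigma>)"
      proof (rule mult_left_mono)
        have "(\<sigma> powr (1 / q)) powr q = \<sigma>" using \<sigma> q by (simp add: powr_powr)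
        then show "(max H (\<sigma> powr (1 / q))) powr q \<le> H powr q + \<sigma>" using \<sigma> by (auto simp: max_def)
      qed (simp add: M'_def)
      also have "\<dots> \<le> M' * (C2 * (d powr (-N / 2) * T) + \<sigma>)"
        using dyadic_hardy[OF d0 N q, of \<phi>] \<phi>0 unfolding H_def T_def C2_def x_def
        by (intro mult_left_mono add_right_mono) (auto simp: M'_def)
      finally have fin1: "ennreal (norm (cesaro \<mu> \<beta> \<xi> f z) powr q) \<le> ennreal (M' * (C2 * (d powr (-N / 2) * T) + \<sigma>))"
        by (rule ennreal_leI)
      have "ennreal (C2 * (d powr (-N / 2) * T)) = (\<Sum>k\<in>?J. ennreal (C2 * x k powr (-N / 2) * \<phi> k * d powr (-N / 2)))"
        unfolding T_def using C123 \<phi>0 by (subst sum_ennreal) (auto simp: sum_distrib_left mult_ac)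
      also have "\<dots> = (\<Sum>k\<in>?J. ennreal (C2 * x k powr (-N / 2)) * \<Phi> k * (ennreal (?d z powr (-(N / 2))) * indicator {z. ?d z \<le> x k} z))"
        using C123 \<phi>0 by (intro sum.cong refl) (auto simp: \<phi> x_def d_def ennreal_mult)
      also have "\<dots> = G z"
        unfolding G_def by (rule suminf_finite[OF fin, symmetric]) (auto simp: x_def d_def)
      finally have "ennreal (M' * (C2 * (d powr (-N / 2) * T) + \<sigma>)) = ennreal M' * (G z + S z)"
        using C123 T0 \<sigma> by (simp add: ennreal_mult ennreal_plus M'_def)
      then show ?thesis using fin1 by simp
    qed
    have Gm: "G \<in> borel_measurable (weighted_lborel \<alpha>)" unfolding G_def by measurable
    have Sm: "S \<in> borel_measurable (weighted_lborel \<alpha>)" by measurable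
    \<comment> \<open>The integral of d^(-N/2) over d <= x_k is of order x_k^(N/2), which cancels
      x_k^(-N/2). Only the sum of the masses is left, finite by bounded overlap.\<close>
    have GI: "(\<integral>\<^sup>+z. G z \<partial>weighted_lborel \<alpha>) \<le> ennreal (6 * C2 * C4)"
    proof -
      have "(\<integral>\<^sup>+z. G z \<partial>weighted_lborel \<alpha>) = (\<Sum>k. \<integral>\<^sup>+z. ennreal (C2 * x k powr (-N / 2)) * \<Phi> k * (ennreal (?d z powr (-(N / 2))) * indicator {z. ?d z \<le> x k} z) \<partial>weighted_lborel \<alpha>)"
        unfolding G_def by (rule nn_integral_suminf) measurable
      also have "\<dots> \<le> (\<Sum>k. ennreal (C2 * C4) * \<Phi> k)"
      proof (intro suminf_le allI)
        fix k
        have "(\<integral>\<^sup>+z. ennreal (C2 * x k powr (-N / 2)) * \<Phi> k * (ennreal (?d z powr (-(N / 2))) * indicator {z. ?d z \<le> x k} z) \<partial>weighted_lborel \<alpha>)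
          = ennreal (C2 * x k powr (-N / 2)) * \<Phi> k * (\<integral>\<^sup>+z. ennreal (?d z powr (-(N / 2))) * indicator {z. ?d z \<le> x k} z \<partial>weighted_lborel \<alpha>)"
          by (rule nn_integral_cmult) measurable
        also have "\<dots> \<le> ennreal (C2 * x k powr (-N / 2)) * \<Phi> k * ennreal (C4 * x k powr (N - N / 2))"
          by (intro mult_left_mono C4 \<xi> x) auto
        also have "\<dots> = ennreal (C2 * C4 * (x k powr (-N / 2) * x k powr (N - N / 2))) * \<Phi> k"
          using C123 C4 by (simp add: ennreal_mult mult_ac)
        also have "x k powr (-N / 2) * x k powr (N - N / 2) = 1" using x[of k] by (simp add: powr_add[symmetric])
        finally show "(\<integral>\<^sup>+z. ennreal (C2 * x k powr (-N / 2)) * \<Phi> k * (ennreal (?d z powr (-(N / 2))) * indicator {z. ?d z \<le> x k} z) \<partial>weighted_lborel \<alpha>)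
          \<le> ennreal (C2 * C4) * \<Phi> k" by simp
      qed auto
      also have "\<dots> = ennreal (C2 * C4) * (\<Sum>k. \<Phi> k)" by simp
      also have "\<dots> \<le> ennreal (C2 * C4) * 6" using \<Phi>sum by (intro mult_left_mono) auto
      also have "\<dots> = ennreal (6 * C2 * C4)"
        using C123 C4 by (simp add: ennreal_mult mult_ac)
      finally show ?thesis .
    qed
    have "(\<integral>\<^sup>+z. ennreal (norm (cesaro \<mu> \<beta> \<xi> f z) powr q) * indicator (ball 0 1) z \<partial>weighted_lborel \<alpha>)
        \<le> (\<integral>\<^sup>+z. ennreal M' * (G z + S z) \<partial>weighted_lborel \<alpha>)"
      by (intro nn_integral_mono) (use key in \<open>auto simp: indicator_def\<close>)
    also have "\<dots> = ennreal M' * ((\<integral>\<^sup>+z. G z \<partial>weighted_lborel \<alpha>) + (\<integral>\<^sup>+z. S z \<partial>weighted_lborel \<alpha>))"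
      using Gm Sm by (simp add: nn_integral_cmult nn_integral_add)
    also have "\<dots> \<le> ennreal M' * (ennreal (6 * C2 * C4) + ennreal C5 * 1)"
    proof (intro mult_left_mono add_mono GI)
      show "(\<integral>\<^sup>+z. S z \<partial>weighted_lborel \<alpha>) \<le> ennreal C5 * 1"
        using SI mult_left_mono[OF f1, of "ennreal C5"] unfolding F_def by (rule order_trans) simp
    qed simp
    also have "\<dots> = ennreal (M' * (6 * C2 * C4 + C5))"
      using C123 C4 C5 by (simp add: ennreal_mult ennreal_plus M'_def)
    also have "\<dots> \<le> ennreal C" unfolding C_def by (intro ennreal_leI) simp
    finally show "(\<integral>\<^sup>+x. ennreal (norm (cesaro \<mu> \<beta> \<xi> f x) powr q) * indicator (ball 0 1) x \<partial>weighted_lborel \<alpha>) \<le> ennreal C" .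
  qed
qed

section \<open>Integrals of holomorphic families\<close>

text \<open>Taylor's formula of order one; Cauchy's inequality on discs of radius \<rho> bounds the
  second derivative, which explains the doubled radius in the hypotheses.\<close>

lemma holomorphic_second_order_bound:
  assumes h: "\<phi> holomorphic_on ball 0 (2 * \<rho>)" and B: "\<And>\<zeta>. \<zeta> \<in> ball 0 (2 * \<rho>) \<Longrightarrow> norm (\<phi> \<zeta>) \<le> B"
    and \<zeta>: "norm \<zeta> < \<rho>"
  shows "norm (\<phi> \<zeta> - (\<phi> 0 + deriv \<phi> 0 * \<zeta>)) \<le> 2 * B / \<rho>\<^sup>2 * (norm \<zeta>)\<^sup>2"
proof -
  have \<rho>: "0 < \<rho>" using \<zeta> norm_ge_zero[of \<zeta>] by linarith
  have sub: "cball x \<rho> \<subseteq> ball 0 (2 * \<rho>)" if "x \<in> ball 0 \<rho>" for x :: complex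
  proof
    fix y assume "y \<in> cball x \<rho>"
    then show "y \<in> ball 0 (2 * \<rho>)"
      using that norm_triangle_sub[of y x] by (simp add: dist_norm norm_minus_commute)
  qed
  have "norm ((deriv ^^ 0) \<phi> \<zeta> - (\<Sum>i\<le>1. (deriv ^^ i) \<phi> 0 * (\<zeta> - 0) ^ i / fact i))
      \<le> 2 * B / \<rho>\<^sup>2 * norm (\<zeta> - 0) ^ Suc 1 / fact 1"
  proof (rule complex_Taylor[where S = "ball 0 \<rho>"])
    fix i :: nat and x :: complex assume x: "x \<in> ball 0 \<rho>" "i \<le> 1"
    have "(deriv ^^ i) \<phi> holomorphic_on ball 0 (2 * \<rho>)"
      by (rule holomorphic_higher_deriv[OF h]) simp
    then have "((deriv ^^ i) \<phi> has_field_derivative (deriv ^^ Suc i) \<phi> x) (at x)"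
      using x \<rho> by (auto intro!: holomorphic_derivI[of _ "ball 0 (2 * \<rho>)"])
    then show "((deriv ^^ i) \<phi> has_field_derivative (deriv ^^ Suc i) \<phi> x) (at x within ball 0 \<rho>)"
      by (rule has_field_derivative_at_within)
  next
    fix x :: complex assume x: "x \<in> ball 0 \<rho>"
    have "norm ((deriv ^^ 2) \<phi> x) \<le> fact 2 * B / \<rho> ^ 2"
    proof (rule Cauchy_inequality[OF _ _ \<rho>])
      show "\<phi> holomorphic_on ball x \<rho>" by (rule holomorphic_on_subset[OF h]) (use sub[OF x] ball_subset_cball in blast)
      show "continuous_on (cball x \<rho>) \<phi>"
        by (rule continuous_on_subset[OF holomorphic_on_imp_continuous_on[OF h] sub[OF x]])
      fix y assume "norm (x - y) = \<rho>"
      then have "y \<in> cball x \<rho>" by (simp add: dist_norm)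
      then show "norm (\<phi> y) \<le> B" using sub[OF x] B by blast
    qed
    then show "norm ((deriv ^^ Suc 1) \<phi> x) \<le> 2 * B / \<rho>\<^sup>2" by (simp add: numeral_2_eq_2)
  qed (use \<zeta> \<rho> in auto)
  then show ?thesis by (simp add: power2_eq_square numeral_2_eq_2)
qed

text \<open>The one-variable estimate on the complex line through a in direction h. Its constant
  involves f only through the bound B, hence is uniform over a uniformly bounded family.\<close>

lemma holo_on_second_order_bound:
  fixes f :: "complex ^ 'n \<Rightarrow> complex"
  assumes f: "holo_on f (ball a (2 * \<rho>))" and B: "\<And>x. x \<in> ball a (2 * \<rho>) \<Longrightarrow> norm (f x) \<le> B"
    and D: "(f has_derivative D) (at a)" "\<And>c x. D (c *s x) = c * D x"
    and h: "norm h < \<rho>"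
  shows "norm (f (a + h) - f a - D h) \<le> 2 * B / \<rho>\<^sup>2 * (norm h)\<^sup>2"
proof (cases "h = 0")
  case True
  then show ?thesis using D(2)[of 0 0] by simp
next
  case False
  define v where "v = of_real (1 / norm h) *s h"
  have v: "norm v = 1" "h = of_real (norm h) *s v" using False by (simp_all add: v_def norm_vector_scalar_mult norm_divide)
  have in_ball: "a + \<zeta> *s v \<in> ball a (2 * \<rho>)" if "\<zeta> \<in> ball 0 (2 * \<rho>)" for \<zeta>
    using that v(1) by (simp add: dist_norm norm_vector_scalar_mult)
  let ?\<phi> = "\<lambda>\<zeta>. f (a + \<zeta> *s v)"
  have "?\<phi> holomorphic_on ball 0 (2 * \<rho>)" by (rule holo_on_slice[OF f in_ball])
  moreover have "norm (?\<phi> \<zeta>) \<le> B" if "\<zeta> \<in> ball 0 (2 * \<rho>)" for \<zeta> using B in_ball[OF that] by blast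
  moreover have "norm (complex_of_real (norm h)) < \<rho>" using h by simp
  ultimately have "norm (?\<phi> (of_real (norm h)) - (?\<phi> 0 + deriv ?\<phi> 0 * of_real (norm h)))
      \<le> 2 * B / \<rho>\<^sup>2 * (norm (complex_of_real (norm h)))\<^sup>2"
    by (rule holomorphic_second_order_bound)
  moreover have "deriv ?\<phi> 0 = D v"
    by (rule DERIV_imp_deriv, rule has_derivative_slice) (use D in auto)
  moreover have "D v * of_real (norm h) = D h"
    using D(2)[of "of_real (norm h)" v] v(2) by (simp add: mult.commute)
  ultimately show ?thesis using v(2) by (simp add: diff_diff_eq)
qed

text \<open>The quadratic remainder bound is uniform in t, so it survives integration over the
  finite measure M and shows that the integral of the derivatives is the derivative of the integral.
  Local bounds on K alone are enough; its derivatives need not be estimated separately.\<close>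

lemma holo_on_integral:
  fixes K :: "complex ^ 'n \<Rightarrow> 'a \<Rightarrow> complex"
  assumes M: "finite_measure M"
    and holo: "\<And>t. t \<in> space M \<Longrightarrow> holo_on (\<lambda>z. K z t) (ball 0 1)"
    and meas: "\<And>z. z \<in> ball 0 1 \<Longrightarrow> K z \<in> borel_measurable M"
    and bdd: "\<And>r. r < 1 \<Longrightarrow> \<exists>B. \<forall>z\<in>cball 0 r. \<forall>t\<in>space M. norm (K z t) \<le> B"
  shows "holo_on (\<lambda>z. LINT t|M. K z t) (ball 0 1)"
  unfolding holo_on_def
proof
  interpret finite_measure M by (rule M)
  fix a :: "complex ^ 'n" assume a: "a \<in> ball 0 1"
  \<comment> \<open>A quarter of the distance to the sphere, so that the ball of radius 2\<rho>
    about a has its closure in the unit ball.\<close>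
  define \<rho> where "\<rho> = (1 - norm a) / 4"
  have \<rho>: "0 < \<rho>" using a by (simp add: \<rho>_def)
  have sub: "norm x \<le> norm a + 2 * \<rho>" if "x \<in> ball a (2 * \<rho>)" for x
    using that norm_triangle_sub[of x a] by (simp add: dist_norm norm_minus_commute)
  have r1: "norm a + 2 * \<rho> < 1" using a by (simp add: \<rho>_def field_simps)
  obtain B where "\<forall>z\<in>cball 0 (norm a + 2 * \<rho>). \<forall>t\<in>space M. norm (K z t) \<le> B"
    using bdd[OF r1] by blast
  then have B: "norm (K z t) \<le> B" if "norm z \<le> norm a + 2 * \<rho>" "t \<in> space M" for z t
    using that by simp
  have B': "norm (K z t) \<le> \<bar>B\<bar>" if "norm z \<le> norm a + 2 * \<rho>" "t \<in> space M" for z t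
    using B[OF that] by linarith
  have sub1: "ball a (2 * \<rho>) \<subseteq> ball 0 1" using sub r1 by fastforce
  have integ: "integrable M (K z)" if "norm z \<le> norm a + 2 * \<rho>" for z
    using that r1 meas[of z] B[OF that] by (intro integrable_const_bound[of _ B]) auto
  have "\<forall>t\<in>space M. \<exists>D. ((\<lambda>z. K z t) has_derivative D) (at a)
      \<and> (\<forall>x y. D (x + y) = D x + D y) \<and> (\<forall>c x. D (c *s x) = c * D x)"
    using holo a unfolding holo_on_def by blast
  then obtain D where D: "\<And>t. t \<in> space M \<Longrightarrow> ((\<lambda>z. K z t) has_derivative D t) (at a)"
    "\<And>t x y. t \<in> space M \<Longrightarrow> D t (x + y) = D t x + D t y"
    "\<And>t c x. t \<in> space M \<Longrightarrow> D t (c *s x) = c * D t x"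
    by metis
  define C where "C = 2 * \<bar>B\<bar> / \<rho>\<^sup>2"
  have C: "0 \<le> C" by (simp add: C_def)
  have est: "norm (K (a + h) t - K a t - D t h) \<le> C * (norm h)\<^sup>2" if "norm h < \<rho>" "t \<in> space M" for h t
    unfolding C_def
    by (rule holo_on_second_order_bound[OF holo_on_subset[OF holo[OF that(2)] sub1] _ D(1)[OF that(2)] D(3)[OF that(2)] that(1)])
       (use B' sub that in auto)
  have anear: "norm (a + h) \<le> norm a + 2 * \<rho>" if "norm h < \<rho>" for h
    using norm_triangle_ineq[of a h] that \<rho> by linarith
  \<comment> \<open>D t was chosen separately for each t; measurability comes from writing it as a
    limit of difference quotients along h / (n + 1).\<close>
  have Dm: "(\<lambda>t. D t h) \<in> borel_measurable M" if h: "norm h < \<rho>" for h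
  proof -
    let ?h = "\<lambda>n :: nat. (1 / real (Suc n)) *\<^sub>R h"
    have nh: "norm (?h n) < \<rho>" for n
    proof -
      have "norm (?h n) = norm h / real (Suc n)" by simp
      also have "\<dots> \<le> norm h / 1" by (intro divide_left_mono) auto
      finally show ?thesis using h by simp
    qed
    show ?thesis
    proof (rule borel_measurable_LIMSEQ_metric)
      fix n
      show "(\<lambda>t. of_real (real (Suc n)) * (K (a + ?h n) t - K a t)) \<in> borel_measurable M"
        using meas[of a] meas[of "a + ?h n"] a anear[OF nh[of n]] r1 by (intro borel_measurable_times borel_measurable_diff) auto
    next
      fix t assume t: "t \<in> space M"
      have "\<forall>n. norm (of_real (real (Suc n)) * (K (a + ?h n) t - K a t) - D t h) \<le> C * (norm h)\<^sup>2 / real (Suc n)"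
      proof
        fix n
        have "D t (?h n) = of_real (1 / real (Suc n)) * D t h"
          using D(3)[OF t, of "of_real (1 / real (Suc n))" h] by (simp add: scaleR_eq_vector_scalar_mult)
        then have "of_real (real (Suc n)) * (K (a + ?h n) t - K a t) - D t h
            = of_real (real (Suc n)) * (K (a + ?h n) t - K a t - D t (?h n))"
          by (simp add: right_diff_distrib del: of_nat_Suc)
        then have "norm (of_real (real (Suc n)) * (K (a + ?h n) t - K a t) - D t h)
            = real (Suc n) * norm (K (a + ?h n) t - K a t - D t (?h n))"
          by (simp add: norm_mult del: of_nat_Suc)
        also have "\<dots> \<le> real (Suc n) * (C * (norm (?h n))\<^sup>2)"
          by (intro mult_left_mono est nh t) auto
        also have "\<dots> = C * (norm h)\<^sup>2 / real (Suc n)"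
          by (simp add: power2_eq_square field_simps del: of_nat_Suc)
        finally show "norm (of_real (real (Suc n)) * (K (a + ?h n) t - K a t) - D t h) \<le> C * (norm h)\<^sup>2 / real (Suc n)" .
      qed
      moreover have "(\<lambda>n. C * (norm h)\<^sup>2 / real (Suc n)) \<longlonglongrightarrow> 0"
        by (rule LIMSEQ_Suc[OF lim_const_over_n])
      ultimately have "(\<lambda>n. of_real (real (Suc n)) * (K (a + ?h n) t - K a t) - D t h) \<longlonglongrightarrow> 0"
        by (rule Lim_null_comparison[OF always_eventually])
      then show "(\<lambda>n. of_real (real (Suc n)) * (K (a + ?h n) t - K a t)) \<longlonglongrightarrow> D t h"
        by (simp add: LIM_zero_iff)
    qed
  qed
  have Di_small: "integrable M (\<lambda>t. D t h)" if h: "norm h < \<rho>" for h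
  proof (rule integrable_const_bound[of _ "C * (norm h)\<^sup>2 + 2 * \<bar>B\<bar>"])
    have "norm (D t h) \<le> C * (norm h)\<^sup>2 + 2 * \<bar>B\<bar>" if t: "t \<in> space M" for t
    proof -
      have e: "D t h = (K (a + h) t - K a t) - (K (a + h) t - K a t - D t h)" by simp
      have "norm (D t h) \<le> norm (K (a + h) t - K a t) + norm (K (a + h) t - K a t - D t h)"
        by (subst e) (rule norm_triangle_ineq4)
      also have "\<dots> \<le> (norm (K (a + h) t) + norm (K a t)) + C * (norm h)\<^sup>2"
        by (intro add_mono norm_triangle_ineq4 est h t)
      also have "\<dots> \<le> (\<bar>B\<bar> + \<bar>B\<bar>) + C * (norm h)\<^sup>2"
        by (intro add_mono B' t anear h order_refl) (use \<rho> in auto)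
      finally show ?thesis by simp
    qed
    then show "AE t in M. norm (D t h) \<le> C * (norm h)\<^sup>2 + 2 * \<bar>B\<bar>" by auto
  qed (rule Dm[OF h])
  \<comment> \<open>The remainder estimate covers only short h; homogeneity of D t extends
    integrability to all h.\<close>
  have Di: "integrable M (\<lambda>t. D t h)" for h
  proof -
    obtain s :: real where s: "s > 0" "norm (s *\<^sub>R h) < \<rho>"
    proof (rule that)
      show "\<rho> / (2 * (norm h + 1)) > 0" using \<rho> by (simp add: add_nonneg_pos)
      have "\<rho> * norm h < \<rho> * (2 * (norm h + 1))" using \<rho> by (intro mult_strict_left_mono) (auto intro: add_nonneg_pos)
      then show "norm ((\<rho> / (2 * (norm h + 1))) *\<^sub>R h) < \<rho>"
        using \<rho> norm_ge_zero[of h] by (simp add: pos_divide_less_eq add_nonneg_pos)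
    qed
    have "integrable M (\<lambda>t. of_real (1 / s) * D t (s *\<^sub>R h))" using Di_small[OF s(2)] by simp
    moreover have "of_real (1 / s) * D t (s *\<^sub>R h) = D t h" if "t \<in> space M" for t
      using s D(3)[OF that, of "of_real s" h] by (simp add: scaleR_eq_vector_scalar_mult)
    ultimately show ?thesis by (simp cong: Bochner_Integration.integrable_cong)
  qed
  define E where "E h = (LINT t|M. D t h)" for h
  have E_add: "E (x + y) = E x + E y" for x y
  proof -
    have "E (x + y) = (LINT t|M. D t x + D t y)"
      unfolding E_def by (intro Bochner_Integration.integral_cong) (auto simp: D)
    then show ?thesis using Di by (simp add: E_def)
  qed
  have E_scale: "E (c *s x) = c * E x" for c x
  proof -
    have "E (c *s x) = (LINT t|M. c * D t x)"
      unfolding E_def by (intro Bochner_Integration.integral_cong) (auto simp: D)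
    then show ?thesis by (simp add: E_def)
  qed
  have "linear E" by (rule linearI) (auto simp: E_add E_scale scaleR_eq_vector_scalar_mult scaleR_conv_of_real[where 'a=complex])
  then have bl: "bounded_linear E" by (simp add: linear_conv_bounded_linear)
  let ?F = "\<lambda>z. LINT t|M. K z t"
  have Fest: "norm (?F (a + h) - ?F a - E h) \<le> C * (norm h)\<^sup>2 * measure M (space M)" if h: "norm h < \<rho>" for h
  proof -
    have i1: "integrable M (K (a + h))" "integrable M (K a)" using integ anear[OF h] \<rho> by auto
    have "?F (a + h) - ?F a - E h = (LINT t|M. K (a + h) t - K a t - D t h)"
      unfolding E_def using i1 Di by simp
    also have "norm \<dots> \<le> (LINT t|M. norm (K (a + h) t - K a t - D t h))"
      by (rule integral_norm_bound)
    also have "\<dots> \<le> (LINT t|M. C * (norm h)\<^sup>2)"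
      using i1 Di est[OF h] by (intro integral_mono integrable_norm Bochner_Integration.integrable_diff) auto
    also have "\<dots> = C * (norm h)\<^sup>2 * measure M (space M)" by (simp add: mult.commute)
    finally show ?thesis .
  qed
  have "(\<lambda>h. norm (?F (a + h) - ?F a - E h) / norm h) \<midarrow>0\<rightarrow> 0"
  proof (rule Lim_null_comparison)
    show "eventually (\<lambda>h. norm (norm (?F (a + h) - ?F a - E h) / norm h) \<le> C * measure M (space M) * norm h) (at 0)"
      unfolding eventually_at
    proof (intro exI[of _ \<rho>] conjI \<rho> ballI impI)
      fix h :: "complex ^ 'n" assume "h \<noteq> 0 \<and> dist h 0 < \<rho>"
      then have h: "norm h < \<rho>" "norm h > 0" by auto
      from Fest[OF h(1)] show "norm (norm (?F (a + h) - ?F a - E h) / norm h) \<le> C * measure M (space M) * norm h"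
        using h by (simp add: pos_divide_le_eq power2_eq_square mult_ac)
    qed
    show "((\<lambda>h. C * measure M (space M) * norm h) \<longlongrightarrow> 0) (at (0 :: complex ^ 'n))"
      by (auto intro!: tendsto_eq_intros)
  qed
  with bl have "(?F has_derivative E) (at a)" by (simp add: has_derivative_at)
  then show "\<exists>D. (?F has_derivative D) (at a) \<and> (\<forall>x y. D (x + y) = D x + D y) \<and> (\<forall>c x. D (c *s x) = c * D x)"
    using E_add E_scale by blast
qed

lemma holo_on_herm: "holo_on (\<lambda>z. c + herm (r *\<^sub>R z) w) S"
  unfolding holo_on_def
proof
  fix z
  have "linear (\<lambda>z. herm (r *\<^sub>R z) w)"
    by (rule linearI) (auto simp: scaleR_eq_vector_scalar_mult herm_scale_left herm_add_left vector_add_ldistrib scaleR_conv_of_real[where 'a=complex])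
  then have "((\<lambda>z. c + herm (r *\<^sub>R z) w) has_derivative (\<lambda>z. herm (r *\<^sub>R z) w)) (at z)"
    by (auto intro!: derivative_eq_intros bounded_linear_imp_has_derivative simp: linear_conv_bounded_linear)
  then show "\<exists>D. ((\<lambda>z. c + herm (r *\<^sub>R z) w) has_derivative D) (at z) \<and> (\<forall>x y. D (x + y) = D x + D y) \<and> (\<forall>c x. D (c *s x) = c * D x)"
    by (intro exI[of _ "\<lambda>z. herm (r *\<^sub>R z) w"]) (auto simp: scaleR_eq_vector_scalar_mult herm_scale_left herm_add_left vector_add_ldistrib)
qed

text \<open>The number 1 - t\<langle>z,\<xi>\<rangle> has positive real part, so the principal
  branch is holomorphic there, and on |z| <= r its modulus is at least (1 - r)/2 for all t. With
  \<mu> finite, integration of a holomorphic family applies.\<close>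

lemma cesaro_holo_on:
  fixes \<xi> :: "complex ^ 'n"
  assumes \<xi>: "norm \<xi> = 1" and \<beta>: "\<beta> > 0" and \<mu>: "borel_measure_01 \<mu>" and fin: "emeasure \<mu> {0..<1} < \<infinity>"
    and f: "holo_on f (ball 0 1)"
  shows "cesaro_well_defined \<mu> \<beta> \<xi> f" and "holo_on (cesaro \<mu> \<beta> \<xi> f) (ball 0 1)"
proof -
  have sets\<mu>: "sets \<mu> = sets (restrict_space borel {0..<1})" using \<mu> by (simp add: borel_measure_01_def)
  have sp: "space \<mu> = {0..<1}" using sets_eq_imp_space_eq[OF sets\<mu>] by (simp add: space_restrict_space)
  have fm: "finite_measure \<mu>" by (rule finite_measureI) (use fin sp in auto)
  have re: "0 < Re (1 - of_real t * herm z \<xi>)" if z: "norm z < 1" and t: "0 \<le> t" "t < 1" for z t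
  proof -
    have "Re (of_real t * herm z \<xi>) \<le> norm (of_real t * herm z \<xi>)" by (rule complex_Re_le_cmod)
    also have "\<dots> = t * norm (herm z \<xi>)" using t by (simp add: norm_mult)
    also have "\<dots> \<le> 1 * norm (herm z \<xi>)" using t by (intro mult_right_mono) auto
    also have "\<dots> < 1" using herm_ball(1)[OF \<xi> z] by simp
    finally show ?thesis by simp
  qed
  have tz: "t *\<^sub>R z \<in> ball 0 1" if "norm z < 1" "0 \<le> t" "t < 1" for t z
  proof -
    have "t * norm z \<le> t * 1" using that by (intro mult_left_mono) auto
    then show ?thesis using that by simp
  qed
  have holo: "holo_on (\<lambda>z. cesaro_kernel \<beta> \<xi> f z t) (ball 0 1)" if "t \<in> space \<mu>" for t
  proof -
    have t: "0 \<le> t" "t < 1" using that by (auto simp: sp)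
    have 1: "holo_on (\<lambda>z. f (0 + t *\<^sub>R z)) (ball 0 1)"
      by (rule holo_on_affine[OF f]) (use tz[OF _ t] in \<open>auto simp: scaleR_eq_vector_scalar_mult norm_vector_scalar_mult vec_eq_iff algebra_simps\<close>)
    have "(\<lambda>w. 1 / w powr complex_of_real \<beta>) holomorphic_on {w. 0 < Re w}"
      by (intro holomorphic_intros) (auto simp: complex_nonpos_Reals_iff)
    moreover have "open {w. 0 < Re w}" by (rule open_halfspace_Re_gt)
    ultimately have "holo_on (\<lambda>z. 1 / (1 + herm ((-t) *\<^sub>R z) \<xi>) powr complex_of_real \<beta>) (ball 0 1)"
      by (intro holo_on_comp_holomorphic[OF holo_on_herm])
         (use re[OF _ t] in \<open>auto simp: herm_scaleR_left simp del: scaleR_minus_left\<close>)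
    from holo_on_mult[OF 1 this] show ?thesis
      by (simp add: cesaro_kernel_def herm_scaleR_left divide_inverse del: scaleR_minus_left)
  qed
  have meas: "cesaro_kernel \<beta> \<xi> f z \<in> borel_measurable \<mu>" if "z \<in> ball 0 1" for z
  proof -
    have z: "norm z < 1" using that by simp
    have "continuous_on {0..<1} (\<lambda>t. f (t *\<^sub>R z))"
      by (rule continuous_on_compose2[OF holo_on_imp_continuous_on[OF f]])
         (use tz[OF z] in \<open>auto intro!: continuous_intros\<close>)
    moreover have "continuous_on {0..<1} (\<lambda>t. (1 - complex_of_real t * herm z \<xi>) powr complex_of_real \<beta>)"
    proof (rule continuous_on_powr_complex)
      show "{0..<1} \<subseteq> {t. 0 \<le> Re (1 - complex_of_real t * herm z \<xi>) \<or> Im (1 - complex_of_real t * herm z \<xi>) \<noteq> 0}"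
        using re[OF z] by (auto intro: less_imp_le)
    qed (use \<beta> in \<open>auto intro!: continuous_intros\<close>)
    moreover have "(1 - complex_of_real t * herm z \<xi>) powr complex_of_real \<beta> \<noteq> 0" if "t \<in> {0..<1}" for t
      using re[OF z, of t] that by (metis atLeastLessThan_iff less_irrefl powr_eq_0_iff zero_complex.sel(1))
    ultimately have "continuous_on {0..<1} (cesaro_kernel \<beta> \<xi> f z)"
      unfolding cesaro_kernel_def by (intro continuous_on_divide) auto
    then show ?thesis
      using borel_measurable_continuous_on_restrict by (simp add: measurable_cong_sets[OF sets\<mu> refl])
  qed
  have bdd: "\<exists>B. \<forall>z\<in>cball 0 r. \<forall>t\<in>space \<mu>. norm (cesaro_kernel \<beta> \<xi> f z t) \<le> B" if r: "r < 1" for r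
  proof -
    have sub: "cball (0 :: complex ^ 'n) r \<subseteq> ball 0 1" using r by auto
    have "bounded (f ` cball 0 r)"
      by (intro compact_imp_bounded compact_continuous_image continuous_on_subset[OF holo_on_imp_continuous_on[OF f] sub]) simp
    then obtain B where "\<forall>x\<in>cball 0 r. norm (f x) \<le> B" by (auto simp: bounded_iff)
    then have B: "norm (f x) \<le> B" if "x \<in> cball 0 r" for x using that by blast
    have "norm (cesaro_kernel \<beta> \<xi> f z t) \<le> B / ((1 - r) / 2) powr \<beta>" if z: "z \<in> cball 0 r" and t: "t \<in> space \<mu>" for z t
    proof -
      have t: "0 \<le> t" "t < 1" using t by (auto simp: sp)
      have z1: "norm z < 1" using z r by simp
      have "t * norm z \<le> 1 * norm z" using t by (intro mult_right_mono) auto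
      then have "norm (f (t *\<^sub>R z)) \<le> B" using z t by (intro B) auto
      moreover have "(1 - r) / 2 \<le> norm (1 - of_real t * herm z \<xi>)"
        using radial_distance(2)[OF herm_ball(1)[OF \<xi> z1] t] herm_ball(2)[OF \<xi> z1] z by simp
      then have "((1 - r) / 2) powr \<beta> \<le> norm (1 - of_real t * herm z \<xi>) powr \<beta>"
        using r \<beta> by (intro powr_mono2) auto
      ultimately show ?thesis
        unfolding norm_cesaro_kernel using r by (intro frac_le) (auto intro: order_trans[OF norm_ge_zero])
    qed
    then show ?thesis by blast
  qed
  show "holo_on (cesaro \<mu> \<beta> \<xi> f) (ball 0 1)"
    unfolding cesaro_def[abs_def] by (rule holo_on_integral[OF fm holo meas bdd])
  interpret finite_measure \<mu> by (rule fm)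
  show "cesaro_well_defined \<mu> \<beta> \<xi> f"
    unfolding cesaro_well_defined_def
  proof
    fix z :: "complex ^ 'n" assume z: "z \<in> ball 0 1"
    have "norm z < 1" using z by simp
    from bdd[OF this] obtain B where "\<forall>w\<in>cball 0 (norm z). \<forall>t\<in>space \<mu>. norm (cesaro_kernel \<beta> \<xi> f w t) \<le> B"
      by blast
    then have "\<forall>t\<in>space \<mu>. norm (cesaro_kernel \<beta> \<xi> f z t) \<le> B" by simp
    then show "integrable \<mu> (cesaro_kernel \<beta> \<xi> f z)" using meas[OF z] by (intro integrable_const_bound[of _ B]) auto
  qed
qed

section \<open>Bergman spaces and the characterization\<close>

text \<open>Extended-valued, so that it is defined for all f, and the value infinity expresses that
  f is outside the space.\<close>

definition bergman_integral :: "real \<Rightarrow> real \<Rightarrow> (complex ^ 'n \<Rightarrow> complex) \<Rightarrow> ennreal" where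
  "bergman_integral \<alpha> p f = (\<integral>\<^sup>+z. ennreal (norm (f z) powr p) * indicator (ball 0 1) z \<partial>weighted_lborel \<alpha>)"

lemma sets_weighted_volume:
  "sets (weighted_volume \<alpha> :: (complex ^ 'n) measure) = sets (restrict_space borel (ball 0 1))"
  unfolding weighted_volume_def ball_volume_def
  by (simp add: sets_restrict_space)

text \<open>The factor \<kappa> is the normalizing constant of the weight divided by the Lebesgue
  volume of the ball. The cut-off in the measurability hypothesis accounts for functions that are
  arbitrary outside the ball.\<close>

lemma nn_integral_weighted_volume:
  assumes \<alpha>: "\<alpha> > -1"
  obtains \<kappa> where "\<kappa> > 0" "\<And>g :: complex ^ 'n \<Rightarrow> ennreal. (\<lambda>z. g z * indicator (ball 0 1) z) \<in> borel_measurable borel \<Longrightarrow>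
    (\<integral>\<^sup>+z. g z \<partial>weighted_volume \<alpha>) = ennreal \<kappa> * (\<integral>\<^sup>+z. g z * indicator (ball 0 1) z \<partial>weighted_lborel \<alpha>)"
proof -
  define V where "V = unit_ball_vol (DIM(complex ^ 'n))"
  have V: "V > 0" "emeasure lborel (ball (0 :: complex ^ 'n) 1) = ennreal V"
    by (simp_all add: V_def unit_ball_vol_pos emeasure_ball)
  have [measurable]: "ball (0 :: complex ^ 'n) 1 \<in> sets borel" by simp
  define c where "c = weight_const CARD('n) \<alpha>"
  have c: "c > 0" unfolding c_def weight_const_def using \<alpha> by (intro divide_pos_pos mult_pos_pos Gamma_real_pos) auto
  let ?w = "\<lambda>z :: complex ^ 'n. ennreal (c * (1 - (norm z)\<^sup>2) powr \<alpha>)"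
  have wm: "?w \<in> borel_measurable borel" by measurable
  show thesis
  proof (rule that)
    show "c / V > 0" using c V by simp
    fix g :: "complex ^ 'n \<Rightarrow> ennreal" assume gm: "(\<lambda>z. g z * indicator (ball 0 1) z) \<in> borel_measurable borel"
    have s: "sets (uniform_measure lborel (ball (0 :: complex ^ 'n) 1)) = sets borel" by simp
    have g_ball: "g \<in> borel_measurable ball_volume"
      unfolding ball_volume_def using gm by (subst borel_measurable_restrict_space_iff_ennreal) auto
    have w_ball: "?w \<in> borel_measurable ball_volume"
      unfolding ball_volume_def by (rule measurable_restrict_space1) (simp add: measurable_cong_sets[OF s refl])
    have "(\<integral>\<^sup>+z. g z \<partial>weighted_volume \<alpha>) = (\<integral>\<^sup>+z. ?w z * g z \<partial>ball_volume)"
      unfolding weighted_volume_def c_def[symmetric] by (rule nn_integral_density[OF w_ball g_ball])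
    also have "\<dots> = (\<integral>\<^sup>+z. ?w z * g z * indicator (ball 0 1) z \<partial>uniform_measure lborel (ball 0 1))"
      unfolding ball_volume_def by (rule nn_integral_restrict_space) simp
    also have "\<dots> = (\<integral>\<^sup>+z. ?w z * g z * indicator (ball 0 1) z * indicator (ball 0 1) z \<partial>lborel) / emeasure lborel (ball (0 :: complex ^ 'n) 1)"
    proof (rule nn_integral_uniform_measure)
      have "(\<lambda>z. ?w z * (g z * indicator (ball 0 1) z)) \<in> borel_measurable borel"
        using wm gm by (rule borel_measurable_times_ennreal)
      then show "(\<lambda>z. ?w z * g z * indicator (ball 0 1) z) \<in> borel_measurable lborel" by (simp add: mult.assoc)
    qed simp
    also have "(\<integral>\<^sup>+z. ?w z * g z * indicator (ball 0 1) z * indicator (ball 0 1) z \<partial>lborel)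
       = (\<integral>\<^sup>+z. ennreal c * (ennreal ((1 - (norm z)\<^sup>2) powr \<alpha>) * indicator (ball 0 1) z * (g z * indicator (ball 0 1) z)) \<partial>lborel)"
      using c by (intro nn_integral_cong) (auto simp: ennreal_mult indicator_def mult.assoc)
    also have "\<dots> = ennreal c * (\<integral>\<^sup>+z. ennreal ((1 - (norm z)\<^sup>2) powr \<alpha>) * indicator (ball 0 1) z * (g z * indicator (ball 0 1) z) \<partial>lborel)"
      using borel_measurable_times_ennreal[OF measurable_weighted_lborel_weight gm] by (intro nn_integral_cmult) simp
    also have "\<dots> = ennreal c * (\<integral>\<^sup>+z. g z * indicator (ball 0 1) z \<partial>weighted_lborel \<alpha>)"
      using gm by (subst nn_integral_weighted_lborel) auto
    also have "ennreal c * (\<integral>\<^sup>+z. g z * indicator (ball 0 1) z \<partial>weighted_lborel \<alpha>) / emeasure lborel (ball (0 :: complex ^ 'n) 1)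
        = ennreal (c / V) * (\<integral>\<^sup>+z. g z * indicator (ball 0 1) z \<partial>weighted_lborel \<alpha>)"
    proof -
      have "ennreal (c / V) = ennreal c * inverse (ennreal V)"
        using c V by (simp add: divide_inverse ennreal_mult inverse_ennreal)
      then show ?thesis using V by (simp add: divide_ennreal_def mult_ac)
    qed
    finally show "(\<integral>\<^sup>+z. g z \<partial>weighted_volume \<alpha>) = ennreal (c / V) * (\<integral>\<^sup>+z. g z * indicator (ball 0 1) z \<partial>weighted_lborel \<alpha>)" .
  qed
qed

text \<open>One \<kappa> serves all exponents, so it can be used for source and target space
  together.\<close>

lemma bergman_characterization:
  assumes \<alpha>: "\<alpha> > -1"
  obtains \<kappa> where "\<kappa> > 0"
    "\<And>p (f :: complex ^ 'n \<Rightarrow> complex). 0 < p \<Longrightarrow> f \<in> bergman_space p \<alpha> \<longleftrightarrow> holo_on f (ball 0 1) \<and> bergman_integral \<alpha> p f < \<infinity>"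
    "\<And>p (f :: complex ^ 'n \<Rightarrow> complex). 0 < p \<Longrightarrow> holo_on f (ball 0 1) \<Longrightarrow> bergman_norm p \<alpha> f = (\<kappa> * enn2real (bergman_integral \<alpha> p f)) powr (1 / p)"
proof -
  obtain \<kappa> where \<kappa>: "\<kappa> > 0" "\<And>g :: complex ^ 'n \<Rightarrow> ennreal. (\<lambda>z. g z * indicator (ball 0 1) z) \<in> borel_measurable borel \<Longrightarrow>
    (\<integral>\<^sup>+z. g z \<partial>weighted_volume \<alpha>) = ennreal \<kappa> * (\<integral>\<^sup>+z. g z * indicator (ball 0 1) z \<partial>weighted_lborel \<alpha>)"
    using nn_integral_weighted_volume[OF \<alpha>] by blast
  have eq: "(\<integral>\<^sup>+z. ennreal (norm (f z) powr p) \<partial>weighted_volume \<alpha>) = ennreal \<kappa> * bergman_integral \<alpha> p f"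
    if "holo_on f (ball 0 1)" for f :: "complex ^ 'n \<Rightarrow> complex" and p
    unfolding bergman_integral_def by (rule \<kappa>(2)[OF holo_on_measurable_powr[OF that]])
  have meas: "(\<lambda>z. norm (f z) powr p) \<in> borel_measurable (weighted_volume \<alpha>)"
    if "holo_on f (ball 0 1)" for f :: "complex ^ 'n \<Rightarrow> complex" and p
  proof -
    have "f \<in> borel_measurable (restrict_space borel (ball 0 1))"
      by (rule borel_measurable_continuous_on_restrict[OF holo_on_imp_continuous_on[OF that]])
    then have [measurable]: "f \<in> borel_measurable (weighted_volume \<alpha>)"
      by (simp add: measurable_cong_sets[OF sets_weighted_volume refl])
    show ?thesis by measurable
  qed
  show thesis
  proof (rule that[OF \<kappa>(1)])
    fix p :: real and f :: "complex ^ 'n \<Rightarrow> complex" assume p: "0 < p"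
    show "f \<in> bergman_space p \<alpha> \<longleftrightarrow> holo_on f (ball 0 1) \<and> bergman_integral \<alpha> p f < \<infinity>"
    proof (cases "holo_on f (ball 0 1)")
      case True
      have "integrable (weighted_volume \<alpha>) (\<lambda>z. norm (f z) powr p) \<longleftrightarrow> (\<integral>\<^sup>+z. ennreal (norm (f z) powr p) \<partial>weighted_volume \<alpha>) < \<infinity>"
        using meas[OF True, of p] by (simp add: integrable_iff_bounded)
      also have "\<dots> \<longleftrightarrow> bergman_integral \<alpha> p f < \<infinity>"
        unfolding eq[OF True] using \<kappa>(1) by (auto simp: ennreal_mult_less_top)
      finally show ?thesis using True by (simp add: bergman_space_def holomorphic_ball_iff_holo_on)
    qed (simp add: bergman_space_def holomorphic_ball_iff_holo_on)
    assume f: "holo_on f (ball 0 1)"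
    have "(LINT z|weighted_volume \<alpha>. norm (f z) powr p) = enn2real (ennreal \<kappa> * bergman_integral \<alpha> p f)"
      unfolding eq[OF f, symmetric] by (rule integral_eq_nn_integral[OF meas[OF f]]) simp
    then show "bergman_norm p \<alpha> f = (\<kappa> * enn2real (bergman_integral \<alpha> p f)) powr (1 / p)"
      using \<kappa>(1) by (simp add: bergman_norm_def enn2real_mult)
  qed
qed

lemma bergman_integral_scale:
  assumes f: "holo_on f (ball 0 1)" and c: "c > 0"
  shows "bergman_integral \<alpha> p (\<lambda>z. f z / of_real c) = ennreal (c powr (-p)) * bergman_integral \<alpha> p f"
proof -
  have "(\<lambda>z. ennreal (norm (f z) powr p) * indicator (ball 0 1) z) \<in> borel_measurable (weighted_lborel \<alpha>)"
    using holo_on_measurable_powr[OF f] by (simp add: measurable_cong_sets[OF sets_weighted_lborel refl])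
  then have "ennreal (c powr (-p)) * bergman_integral \<alpha> p f = (\<integral>\<^sup>+z. ennreal (c powr (-p)) * (ennreal (norm (f z) powr p) * indicator (ball 0 1) z) \<partial>weighted_lborel \<alpha>)"
    unfolding bergman_integral_def by (rule nn_integral_cmult[symmetric])
  also have "\<dots> = bergman_integral \<alpha> p (\<lambda>z. f z / of_real c)"
    unfolding bergman_integral_def
  proof (rule nn_integral_cong)
    fix z
    have "norm (f z / of_real c) = norm (f z) / c" using c by (simp add: norm_divide)
    then have "norm (f z / of_real c) powr p = c powr (-p) * norm (f z) powr p"
      using c by (simp add: powr_divide powr_minus_divide)
    then have "ennreal (norm (f z / of_real c) powr p) = ennreal (c powr (-p)) * ennreal (norm (f z) powr p)"
      by (simp add: ennreal_mult)
    then show "ennreal (c powr (-p)) * (ennreal (norm (f z) powr p) * indicator (ball 0 1) z)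
        = ennreal (norm (f z / of_real c) powr p) * indicator (ball 0 1) z"
      by (simp only: mult.assoc)
  qed
  finally show ?thesis by simp
qed

lemma ennreal_divide_le_cancel:
  fixes y K :: real
  assumes "y > 0" "K \<ge> 0"
  shows "a / ennreal y \<le> ennreal K \<longleftrightarrow> a \<le> ennreal (K * y)"
proof (cases a)
  case (real x)
  then show ?thesis using assms by (simp add: divide_ennreal pos_divide_le_eq)
next
  case top
  then show ?thesis using assms by (simp add: ennreal_top_divide top_unique)
qed

section \<open>Sufficiency of the Carleson condition\<close>

lemma cesaro_bounded_if_carleson:
  fixes \<xi> :: "complex ^ 'n" and \<alpha> \<beta> p q l :: real
  assumes \<xi>: "norm \<xi> = 1" and \<alpha>: "\<alpha> > -1" and \<beta>: "\<beta> > 0" and p: "0 < p" "p \<le> q"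
    and \<mu>: "borel_measure_01 \<mu>" and l: "l = \<beta> + (real CARD('n) + 1 + \<alpha>) * (1 / p - 1 / q)"
    and car: "carleson_measure l \<mu>"
  shows "cesaro_bounded \<mu> \<beta> \<xi> \<alpha> p q"
proof -
  have q: "0 < q" using p by simp
  define \<delta> where "\<delta> = (CARD('n) + 1 + \<alpha>) * (1 / p - 1 / q)"
  have l': "l = \<beta> + \<delta>" by (simp add: l \<delta>_def)
  have "(SUP r\<in>{0..<1}. emeasure \<mu> {r..<1} / ennreal ((1 - r) powr l)) < top"
    using car by (simp add: carleson_measure_def)
  then obtain K0 where K0: "(SUP r\<in>{0..<1}. emeasure \<mu> {r..<1} / ennreal ((1 - r) powr l)) = ennreal K0" "K0 \<ge> 0"
    unfolding less_top_ennreal by blast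
  define K where "K = K0 + 1"
  have K: "K > 0" using K0 by (simp add: K_def)
  have \<mu>K: "emeasure \<mu> {r..<1} \<le> ennreal (K * (1 - r) powr (\<beta> + \<delta>))" if r: "0 \<le> r" "r < 1" for r
  proof -
    have "emeasure \<mu> {r..<1} / ennreal ((1 - r) powr l) \<le> ennreal K0"
      unfolding K0(1)[symmetric] using r by (intro SUP_upper) auto
    also have "\<dots> \<le> ennreal K" unfolding K_def by (intro ennreal_leI) simp
    finally show ?thesis using r K by (subst (asm) ennreal_divide_le_cancel) (auto simp: l')
  qed
  \<comment> \<open>The Carleson condition at r = 0 makes \<mu> finite, which well-definedness and
    holomorphy of the image rely on.\<close>
  have fin: "emeasure \<mu> {0..<1} < \<infinity>" using le_less_trans[OF \<mu>K[of 0] ennreal_less_top] by simp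
  obtain \<kappa> where \<kappa>: "\<kappa> > 0"
    "\<And>p (f :: complex ^ 'n \<Rightarrow> complex). 0 < p \<Longrightarrow> f \<in> bergman_space p \<alpha> \<longleftrightarrow> holo_on f (ball 0 1) \<and> bergman_integral \<alpha> p f < \<infinity>"
    "\<And>p (f :: complex ^ 'n \<Rightarrow> complex). 0 < p \<Longrightarrow> holo_on f (ball 0 1) \<Longrightarrow> bergman_norm p \<alpha> f = (\<kappa> * enn2real (bergman_integral \<alpha> p f)) powr (1 / p)"
    using bergman_characterization[OF \<alpha>] by blast
  obtain C where C: "C > 0" "\<And>\<mu> (\<xi> :: complex ^ 'n) (f :: complex ^ 'n \<Rightarrow> complex). norm \<xi> = 1 \<Longrightarrow> borel_measure_01 \<mu> \<Longrightarrow>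
    (\<And>r. 0 \<le> r \<Longrightarrow> r < 1 \<Longrightarrow> emeasure \<mu> {r..<1} \<le> ennreal (K * (1 - r) powr (\<beta> + \<delta>))) \<Longrightarrow>
    holo_on f (ball 0 1) \<Longrightarrow> bergman_integral \<alpha> p f \<le> 1 \<Longrightarrow> bergman_integral \<alpha> q (cesaro \<mu> \<beta> \<xi> f) \<le> ennreal C"
    using cesaro_estimate[OF \<alpha> \<beta> p K \<delta>_def, folded bergman_integral_def] by blast
  define A where "A = (\<kappa> * C) powr (1 / q)"
  have A: "A > 0" using \<kappa>(1) C(1) by (simp add: A_def)
  have main: "cesaro_well_defined \<mu> \<beta> \<xi> f \<and> cesaro \<mu> \<beta> \<xi> f \<in> bergman_space q \<alpha> \<and>
      bergman_norm q \<alpha> (cesaro \<mu> \<beta> \<xi> f) \<le> A / \<kappa> powr (1 / p) * bergman_norm p \<alpha> f" if fb: "f \<in> bergman_space p \<alpha>" for f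
  proof -
    have f: "holo_on f (ball 0 1)" "bergman_integral \<alpha> p f < \<infinity>" using fb \<kappa>(2)[OF p(1)] by auto
    then obtain i where i: "bergman_integral \<alpha> p f = ennreal i" "i \<ge> 0" by (cases "bergman_integral \<alpha> p f") auto
    have wd: "cesaro_well_defined \<mu> \<beta> \<xi> f" and holo: "holo_on (cesaro \<mu> \<beta> \<xi> f) (ball 0 1)"
      using cesaro_holo_on[OF \<xi> \<beta> \<mu> fin f(1)] by auto
    \<comment> \<open>Dividing f by any c above \<open>i powr (1 / p)\<close>, rather than by that
      number itself, also covers f = 0; afterwards c tends to it.\<close>
    have bd: "bergman_integral \<alpha> q (cesaro \<mu> \<beta> \<xi> f) \<le> ennreal (C * c powr q)" if c: "i powr (1 / p) < c" for c
    proof -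
      have c0: "c > 0" using c powr_ge_zero[of i "1 / p"] by linarith
      have "i = (i powr (1 / p)) powr p" using i p by (simp add: powr_powr)
      also have "\<dots> \<le> c powr p" using c p by (intro powr_mono2) auto
      finally have ic: "i \<le> c powr p" .
      let ?g = "\<lambda>z. f z / of_real c"
      have "bergman_integral \<alpha> p ?g = ennreal (c powr (-p)) * ennreal i" using bergman_integral_scale[OF f(1) c0] i by simp
      also have "\<dots> \<le> 1"
        using ic c0 i by (simp add: powr_minus divide_simps flip: ennreal_mult)
      finally have g1: "bergman_integral \<alpha> p ?g \<le> 1" .
      have g: "holo_on ?g (ball 0 1)"
        using holo_on_mult[OF f(1) holo_on_const[of "1 / of_real c"]] by simp
      have "cesaro \<mu> \<beta> \<xi> ?g = (\<lambda>z. cesaro \<mu> \<beta> \<xi> f z / of_real c)"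
      proof
        fix z
        have "cesaro_kernel \<beta> \<xi> ?g z = (\<lambda>t. cesaro_kernel \<beta> \<xi> f z t / of_real c)"
          by (simp add: cesaro_kernel_def fun_eq_iff)
        then show "cesaro \<mu> \<beta> \<xi> ?g z = cesaro \<mu> \<beta> \<xi> f z / of_real c" by (simp add: cesaro_def)
      qed
      then have "ennreal (c powr (-q)) * bergman_integral \<alpha> q (cesaro \<mu> \<beta> \<xi> f) \<le> ennreal C"
        using C(2)[OF \<xi> \<mu> \<mu>K g g1] bergman_integral_scale[OF holo c0] by simp
      then have "ennreal (c powr q) * (ennreal (c powr (-q)) * bergman_integral \<alpha> q (cesaro \<mu> \<beta> \<xi> f)) \<le> ennreal (c powr q) * ennreal C"
        by (rule mult_left_mono) simp
      moreover have "ennreal (c powr q) * ennreal (c powr (-q)) = 1"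
        using c0 by (simp add: powr_add[symmetric] flip: ennreal_mult)
      ultimately show ?thesis using C(1) by (simp add: mult.assoc[symmetric] mult.commute flip: ennreal_mult)
    qed
    have "bergman_integral \<alpha> q (cesaro \<mu> \<beta> \<xi> f) < \<infinity>"
      using le_less_trans[OF bd[of "i powr (1 / p) + 1"] ennreal_less_top] by simp
    then have Cq: "cesaro \<mu> \<beta> \<xi> f \<in> bergman_space q \<alpha>" using holo \<kappa>(2)[OF q] by blast
    have "bergman_norm q \<alpha> (cesaro \<mu> \<beta> \<xi> f) / A \<le> i powr (1 / p)"
    proof (rule dense_ge)
      fix c assume c: "i powr (1 / p) < c"
      have c0: "c > 0" using c powr_ge_zero[of i "1 / p"] by linarith
      have "enn2real (bergman_integral \<alpha> q (cesaro \<mu> \<beta> \<xi> f)) \<le> C * c powr q"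
        using enn2real_mono[OF bd[OF c]] C(1) by simp
      then have "\<kappa> * enn2real (bergman_integral \<alpha> q (cesaro \<mu> \<beta> \<xi> f)) \<le> \<kappa> * (C * c powr q)" using \<kappa>(1) by (intro mult_left_mono) auto
      then have "(\<kappa> * enn2real (bergman_integral \<alpha> q (cesaro \<mu> \<beta> \<xi> f))) powr (1 / q) \<le> (\<kappa> * (C * c powr q)) powr (1 / q)"
        using q \<kappa>(1) by (intro powr_mono2) auto
      also have "\<kappa> * (C * c powr q) = (\<kappa> * C) * c powr q" by simp
      also have "((\<kappa> * C) * c powr q) powr (1 / q) = A * c"
        using q c0 \<kappa>(1) C(1) by (simp add: powr_mult A_def powr_powr)
      finally show "bergman_norm q \<alpha> (cesaro \<mu> \<beta> \<xi> f) / A \<le> c"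
        using \<kappa>(3)[OF q holo] A by (simp add: pos_divide_le_eq mult.commute)
    qed
    moreover have "bergman_norm p \<alpha> f = \<kappa> powr (1 / p) * i powr (1 / p)"
      using \<kappa>(3)[OF p(1) f(1)] i \<kappa>(1) by (simp add: powr_mult)
    ultimately have "bergman_norm q \<alpha> (cesaro \<mu> \<beta> \<xi> f) \<le> A / \<kappa> powr (1 / p) * bergman_norm p \<alpha> f"
      using A \<kappa>(1) by (simp add: pos_divide_le_eq mult.commute)
    then show ?thesis using wd Cq by blast
  qed
  then show ?thesis unfolding cesaro_bounded_def by blast
qed

section \<open>Necessity of the Carleson condition\<close>

text \<open>Since |1 - a\<langle>z,\<xi>\<rangle>| is at least half the maximum of 1 - a and d(z),
  the integral is of the type computed outside Koranyi regions, with \<gamma> = sp above the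
  critical exponent. A natural number s avoids a choice of branch.\<close>

lemma test_function_bergman_integral:
  fixes \<alpha> p :: real and s :: nat
  assumes \<alpha>: "\<alpha> > -1" and p: "0 < p" and s: "CARD('n) + 1 + \<alpha> < s * p"
  obtains C where "C > 0" "\<And>(\<xi> :: complex ^ 'n) a. norm \<xi> = 1 \<Longrightarrow> 0 \<le> a \<Longrightarrow> a < 1 \<Longrightarrow>
    holo_on (\<lambda>z. 1 / (1 - of_real a * herm z \<xi>) ^ s) (ball 0 1) \<and>
    bergman_integral \<alpha> p (\<lambda>z. 1 / (1 - of_real a * herm z \<xi>) ^ s) \<le> ennreal (C * (1 - a) powr (CARD('n) + 1 + \<alpha> - s * p))"
proof -
  define N where "N = CARD('n) + 1 + \<alpha>"
  define \<gamma> where "\<gamma> = s * p"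
  obtain C where C: "C > 0" "\<And>(\<xi> :: complex ^ 'n) s. norm \<xi> = 1 \<Longrightarrow> s > 0 \<Longrightarrow>
    (\<integral>\<^sup>+z. ennreal (max s (norm (1 - herm z \<xi>)) powr (-\<gamma>)) \<partial>weighted_lborel \<alpha>) \<le> ennreal (C * s powr (N - \<gamma>))"
    using weighted_lborel_koranyi_outside[OF \<alpha> s] unfolding N_def \<gamma>_def by blast
  have \<gamma>0: "\<gamma> > 0" using s \<alpha> unfolding \<gamma>_def by linarith
  show thesis
  proof (rule that)
    show "2 powr \<gamma> * C > 0" using C by simp
    fix \<xi> :: "complex ^ 'n" and a :: real assume \<xi>: "norm \<xi> = 1" and a: "0 \<le> a" "a < 1"
    let ?f = "\<lambda>z. 1 / (1 - of_real a * herm z \<xi>) ^ s"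
    have low: "max (1 - a) (norm (1 - herm z \<xi>)) / 2 \<le> norm (1 - of_real a * herm z \<xi>)" if "norm z < 1" for z
      using radial_distance(1,2)[OF herm_ball(1)[OF \<xi> that] a] a by auto
    have nz: "1 - of_real a * herm z \<xi> \<noteq> 0" if "norm z < 1" for z
    proof
      assume "1 - of_real a * herm z \<xi> = 0"
      then show False using low[OF that] a by simp
    qed
    have "(\<lambda>w. 1 / w ^ s) holomorphic_on (- {0})" by (intro holomorphic_intros) auto
    then have "holo_on (\<lambda>z. 1 / (1 + herm ((-a) *\<^sub>R z) \<xi>) ^ s) (ball 0 1)"
      by (intro holo_on_comp_holomorphic[OF holo_on_herm])
         (use nz in \<open>auto simp: herm_scaleR_left simp del: scaleR_minus_left\<close>)
    then have holo: "holo_on ?f (ball 0 1)" by (simp add: herm_scaleR_left del: scaleR_minus_left)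
    have "bergman_integral \<alpha> p ?f \<le> (\<integral>\<^sup>+z. ennreal (2 powr \<gamma>) * ennreal (max (1 - a) (norm (1 - herm z \<xi>)) powr (-\<gamma>)) \<partial>weighted_lborel \<alpha>)"
      unfolding bergman_integral_def
    proof (rule nn_integral_mono)
      fix z
      show "ennreal (norm (?f z) powr p) * indicator (ball 0 1) z \<le> ennreal (2 powr \<gamma>) * ennreal (max (1 - a) (norm (1 - herm z \<xi>)) powr (-\<gamma>))"
      proof (cases "norm z < 1")
        case True
        define b where "b = norm (1 - of_real a * herm z \<xi>)"
        define m where "m = max (1 - a) (norm (1 - herm z \<xi>))"
        have b: "m / 2 \<le> b" "0 < m" using low[OF True] a by (auto simp: b_def m_def)
        then have b0: "b > 0" by linarith
        have "norm (?f z) = 1 / b ^ s" by (simp add: b_def norm_divide norm_power)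
        also have "\<dots> = b powr (- real s)" using b0 by (simp add: powr_minus_divide powr_realpow)
        finally have "norm (?f z) powr p = (b powr (- real s)) powr p" by (rule arg_cong)
        also have "\<dots> = b powr (-\<gamma>)" by (simp add: powr_powr \<gamma>_def)
        also have "\<dots> \<le> (m / 2) powr (-\<gamma>)" using b \<gamma>0 by (intro powr_mono2') auto
        also have "\<dots> = 2 powr \<gamma> * m powr (-\<gamma>)" using b by (simp add: powr_divide powr_minus divide_simps)
        finally have "ennreal (norm (?f z) powr p) \<le> ennreal (2 powr \<gamma> * m powr (-\<gamma>))" by (rule ennreal_leI)
        also have "\<dots> = ennreal (2 powr \<gamma>) * ennreal (m powr (-\<gamma>))" by (rule ennreal_mult) auto
        finally show ?thesis using True unfolding m_def by simp
      qed simp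
    qed
    also have "\<dots> = ennreal (2 powr \<gamma>) * (\<integral>\<^sup>+z. ennreal (max (1 - a) (norm (1 - herm z \<xi>)) powr (-\<gamma>)) \<partial>weighted_lborel \<alpha>)"
      by (rule nn_integral_cmult) measurable
    also have "\<dots> \<le> ennreal (2 powr \<gamma>) * ennreal (C * (1 - a) powr (N - \<gamma>))"
      using C(2)[OF \<xi>, of "1 - a"] a by (intro mult_left_mono) auto
    also have "\<dots> = ennreal (2 powr \<gamma> * C * (1 - a) powr (N - \<gamma>))" using C by (simp add: mult.assoc flip: ennreal_mult)
    finally show "holo_on ?f (ball 0 1) \<and> bergman_integral \<alpha> p ?f \<le> ennreal (2 powr \<gamma> * C * (1 - a) powr (CARD('n) + 1 + \<alpha> - s * p))"
      using holo by (simp add: N_def \<gamma>_def)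
  qed
qed

text \<open>At the point a\<xi> the whole integrand is real and positive, so the integral has no
  cancellation and restricting it to t >= a gives a lower bound. For these t both denominators are
  of the order of powers of 1 - a.\<close>

lemma cesaro_test_function_lower:
  fixes \<xi> :: "complex ^ 'n" and s :: nat and \<beta> a :: real
  assumes \<xi>: "norm \<xi> = 1" and \<beta>: "\<beta> > 0" and \<mu>: "borel_measure_01 \<mu>" and a: "0 \<le> a" "a < 1"
  defines "f \<equiv> \<lambda>z. 1 / (1 - of_real a * herm z \<xi>) ^ s"
  assumes int: "integrable \<mu> (cesaro_kernel \<beta> \<xi> f (a *\<^sub>R \<xi>))"
  shows "emeasure \<mu> {a..<1} \<le> ennreal (3 ^ s * 2 powr \<beta> * (1 - a) powr (s + \<beta>) * norm (cesaro \<mu> \<beta> \<xi> f (a *\<^sub>R \<xi>)))"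
proof -
  have sets\<mu>: "sets \<mu> = sets (restrict_space borel {0..<1})" using \<mu> by (simp add: borel_measure_01_def)
  have sp: "space \<mu> = {0..<1}" using sets_eq_imp_space_eq[OF sets\<mu>] by (simp add: space_restrict_space)
  define k where "k t = 1 / ((1 - a * (t * a)) ^ s * (1 - t * a) powr \<beta>)" for t
  have h: "herm \<xi> \<xi> = 1" by (simp add: herm_self \<xi>)
  have ta: "t * a < 1" "a * (t * a) < 1" "t * a \<ge> 0" if "t \<in> {0..<1}" for t
  proof -
    have "t * a \<le> t * 1" using that a by (intro mult_left_mono) auto
    then show 1: "t * a < 1" using that by simp
    show 0: "t * a \<ge> 0" using that a by simp
    have "a * (t * a) \<le> 1 * (t * a)" using a 0 by (intro mult_right_mono) auto
    then show "a * (t * a) < 1" using 1 by simp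
  qed
  have ker: "cesaro_kernel \<beta> \<xi> f (a *\<^sub>R \<xi>) t = complex_of_real (k t)" if t: "t \<in> space \<mu>" for t
  proof -
    have e1: "1 - complex_of_real t * herm (a *\<^sub>R \<xi>) \<xi> = complex_of_real (1 - t * a)" by (simp add: herm_scaleR_left h)
    have e2: "complex_of_real (1 - t * a) powr of_real \<beta> = of_real ((1 - t * a) powr \<beta>)"
      using ta[of t] t by (intro powr_of_real) (auto simp: sp)
    have e3: "f (t *\<^sub>R a *\<^sub>R \<xi>) = complex_of_real (1 / (1 - a * (t * a)) ^ s)"
      by (simp add: f_def herm_scaleR_left h)
    have "cesaro_kernel \<beta> \<xi> f (a *\<^sub>R \<xi>) t = of_real (1 / (1 - a * (t * a)) ^ s) / of_real ((1 - t * a) powr \<beta>)"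
      unfolding cesaro_kernel_def e1 e2 e3 ..
    also have "\<dots> = of_real (k t)" unfolding k_def of_real_divide[symmetric] divide_divide_eq_left ..
    finally show ?thesis .
  qed
  have k0: "0 \<le> k t" if "t \<in> space \<mu>" for t using ta[of t] that by (auto simp: k_def sp)
  have "integrable \<mu> (\<lambda>t. complex_of_real (k t))"
    using int ker by (simp cong: Bochner_Integration.integrable_cong)
  then have ki: "integrable \<mu> k" by (simp add: complex_of_real_integrable_eq)
  have "cesaro \<mu> \<beta> \<xi> f (a *\<^sub>R \<xi>) = (LINT t|\<mu>. complex_of_real (k t))"
    unfolding cesaro_def using ker by (intro Bochner_Integration.integral_cong) auto
  also have "\<dots> = of_real (LINT t|\<mu>. k t)" by (rule integral_complex_of_real)
  finally have nc: "norm (cesaro \<mu> \<beta> \<xi> f (a *\<^sub>R \<xi>)) = (LINT t|\<mu>. k t)"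
    using k0 by (simp add: integral_nonneg_AE)
  define m where "m = 3 ^ s * 2 powr \<beta> * (1 - a) powr (s + \<beta>)"
  have m0: "m > 0" using a by (simp add: m_def)
  \<comment> \<open>The factors 3 and 2 come from 1 - t a^2 <= 1 - a^3 <= 3(1 - a) and 1 - ta <= 1 -
    a^2 <= 2(1 - a).\<close>
  have km: "1 / m \<le> k t" if t: "a \<le> t" "t < 1" for t
  proof -
    have t0: "t \<in> {0..<1}" using t a by auto
    have "a * a \<le> t * a" using t a by (intro mult_right_mono) auto
    moreover have a2: "1 - a * a = (1 - a) * (1 + a)" by (simp add: algebra_simps)
    moreover have "(1 - a) * (1 + a) \<le> (1 - a) * 2" using a by (intro mult_left_mono) auto
    ultimately have b1: "1 - t * a \<le> 2 * (1 - a)" by linarith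
    have "a * (a * a) \<le> a * (t * a)" using \<open>a * a \<le> t * a\<close> a by (intro mult_left_mono) auto
    moreover have "1 - a * (a * a) = (1 - a) * (1 + a + a * a)" by (simp add: algebra_simps)
    moreover have "(1 - a) * (1 + a + a * a) \<le> (1 - a) * 3"
    proof (rule mult_left_mono)
      have "a * a \<le> 1 * 1" using a by (intro mult_mono) auto
      then show "1 + a + a * a \<le> 3" using a by linarith
    qed (use a in auto)
    ultimately have b2: "1 - a * (t * a) \<le> 3 * (1 - a)" by linarith
    have "(1 - a * (t * a)) ^ s * (1 - t * a) powr \<beta> \<le> (3 * (1 - a)) ^ s * (2 * (1 - a)) powr \<beta>"
      using b1 b2 ta[OF t0] \<beta> by (intro mult_mono power_mono powr_mono2) auto
    also have "\<dots> = m"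
    proof -
      have "(1 - a) powr (s + \<beta>) = (1 - a) ^ s * (1 - a) powr \<beta>"
        using a by (simp add: powr_add powr_realpow)
      then show ?thesis using a by (simp only: m_def power_mult_distrib powr_mult mult_ac)
    qed
    finally show ?thesis
      unfolding k_def using ta[OF t0] by (intro divide_left_mono mult_pos_pos) (auto simp: m0)
  qed
  have am: "{a..<1} \<in> sets \<mu>" unfolding sets\<mu> using a by (auto simp: sets_restrict_space_iff)
  have "ennreal (1 / m) * emeasure \<mu> {a..<1} = (\<integral>\<^sup>+t. ennreal (1 / m) * indicator {a..<1} t \<partial>\<mu>)"
    by (rule nn_integral_cmult_indicator[OF am, symmetric])
  also have "\<dots> \<le> (\<integral>\<^sup>+t. ennreal (k t) \<partial>\<mu>)"
    by (intro nn_integral_mono) (use km in \<open>auto simp: indicator_def intro!: ennreal_leI\<close>)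
  also have "\<dots> = ennreal (LINT t|\<mu>. k t)"
    using k0 by (intro nn_integral_eq_integral ki) auto
  finally have "ennreal m * (ennreal (1 / m) * emeasure \<mu> {a..<1}) \<le> ennreal m * ennreal (LINT t|\<mu>. k t)"
    by (rule mult_left_mono) simp
  moreover have "ennreal m * ennreal (1 / m) = 1" using m0 by (simp flip: ennreal_mult)
  ultimately have "emeasure \<mu> {a..<1} \<le> ennreal m * ennreal (LINT t|\<mu>. k t)" by (simp add: mult.assoc[symmetric])
  also have "\<dots> = ennreal (m * (LINT t|\<mu>. k t))" using m0 by (simp add: ennreal_mult')
  finally show ?thesis by (simp add: nc m_def)
qed

text \<open>With y = 1 - a, the lower bound for the kernel gives y^(s + \<beta>), the norm of the
  test function y^(N/p - s), and the growth bound in the target space y^(-N/q). The exponents add up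
  to l, independently of s.\<close>

lemma carleson_if_cesaro_bounded:
  fixes \<xi> :: "complex ^ 'n" and \<alpha> \<beta> p q l :: real
  assumes \<xi>: "norm \<xi> = 1" and \<alpha>: "\<alpha> > -1" and \<beta>: "\<beta> > 0" and p: "0 < p" "p \<le> q"
    and \<mu>: "borel_measure_01 \<mu>" and l: "l = \<beta> + (real CARD('n) + 1 + \<alpha>) * (1 / p - 1 / q)"
    and bdd: "cesaro_bounded \<mu> \<beta> \<xi> \<alpha> p q"
  shows "carleson_measure l \<mu>"
proof -
  have q: "0 < q" using p by simp
  define N where "N = CARD('n) + 1 + \<alpha>"
  \<comment> \<open>For s > N/p the norm of the test function is governed by its peak at
    \<xi>.\<close>
  obtain s :: nat where "N / p < real s" using reals_Archimedean2 by blast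
  then have s: "CARD('n) + 1 + \<alpha> < s * p" using p by (simp add: N_def pos_divide_less_eq)
  obtain \<kappa> where \<kappa>: "\<kappa> > 0"
    "\<And>p (f :: complex ^ 'n \<Rightarrow> complex). 0 < p \<Longrightarrow> f \<in> bergman_space p \<alpha> \<longleftrightarrow> holo_on f (ball 0 1) \<and> bergman_integral \<alpha> p f < \<infinity>"
    "\<And>p (f :: complex ^ 'n \<Rightarrow> complex). 0 < p \<Longrightarrow> holo_on f (ball 0 1) \<Longrightarrow> bergman_norm p \<alpha> f = (\<kappa> * enn2real (bergman_integral \<alpha> p f)) powr (1 / p)"
    using bergman_characterization[OF \<alpha>] by blast
  obtain T where T: "T > 0" "\<And>(\<xi> :: complex ^ 'n) a. norm \<xi> = 1 \<Longrightarrow> 0 \<le> a \<Longrightarrow> a < 1 \<Longrightarrow>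
    holo_on (\<lambda>z. 1 / (1 - of_real a * herm z \<xi>) ^ s) (ball 0 1) \<and>
    bergman_integral \<alpha> p (\<lambda>z. 1 / (1 - of_real a * herm z \<xi>) ^ s) \<le> ennreal (T * (1 - a) powr (N - s * p))"
    using test_function_bergman_integral[OF \<alpha> p(1) s] unfolding N_def by blast
  obtain G where G: "G > 0" "\<And>(f :: complex ^ 'n \<Rightarrow> complex) \<xi> w. holo_on f (ball 0 1) \<Longrightarrow> norm \<xi> = 1 \<Longrightarrow> norm w < 1 \<Longrightarrow>
    ennreal (norm (f w) powr q) * ennreal ((1 - norm w) powr N)
     \<le> ennreal G * (\<integral>\<^sup>+x. ennreal (norm (f x) powr q) * indicator (ball 0 1) x *
         indicator {x. 1 - norm w \<le> 2 * (1 - (norm x)\<^sup>2) \<and> norm (1 - herm x \<xi>) \<le> 3 * norm (1 - herm w \<xi>)} x \<partial>weighted_lborel \<alpha>)"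
    using submean_aniso[OF q, where \<alpha> = \<alpha>] unfolding N_def by blast
  have map: "cesaro_well_defined \<mu> \<beta> \<xi> f \<and> cesaro \<mu> \<beta> \<xi> f \<in> bergman_space q \<alpha>" if "f \<in> bergman_space p \<alpha>" for f
    using bdd that unfolding cesaro_bounded_def by blast
  obtain B where B: "\<forall>f\<in>bergman_space p \<alpha>. bergman_norm q \<alpha> (cesaro \<mu> \<beta> \<xi> f) \<le> B * bergman_norm p \<alpha> f"
    using bdd unfolding cesaro_bounded_def by blast
  \<comment> \<open>The operator bound B is not known to be nonnegative, hence its absolute
    value.\<close>
  define A where "A = 3 ^ s * 2 powr \<beta> * ((G / \<kappa>) powr (1 / q) * (\<bar>B\<bar> * (\<kappa> * T) powr (1 / p)))"
  have A0: "A \<ge> 0" using G \<kappa>(1) by (simp add: A_def)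
  have "emeasure \<mu> {a..<1} / ennreal ((1 - a) powr l) \<le> ennreal A" if a: "0 \<le> a" "a < 1" for a
  proof -
    let ?f = "\<lambda>z. 1 / (1 - of_real a * herm z \<xi>) ^ s"
    define y where "y = 1 - a"
    have y: "y > 0" using a by (simp add: y_def)
    have f: "holo_on ?f (ball 0 1)" "bergman_integral \<alpha> p ?f \<le> ennreal (T * y powr (N - s * p))"
      using T(2)[OF \<xi> a] by (auto simp: y_def)
    from le_less_trans[OF f(2) ennreal_less_top] have "bergman_integral \<alpha> p ?f < \<infinity>" by simp
    then have fb: "?f \<in> bergman_space p \<alpha>" using f(1) \<kappa>(2)[OF p(1)] by blast
    define g where "g = cesaro \<mu> \<beta> \<xi> ?f"
    have g: "holo_on g (ball 0 1)" "bergman_integral \<alpha> q g < \<infinity>" using map[OF fb] \<kappa>(2)[OF q] by (auto simp: g_def)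
    then obtain j where j: "bergman_integral \<alpha> q g = ennreal j" "j \<ge> 0" by (cases "bergman_integral \<alpha> q g") auto
    have w: "norm (a *\<^sub>R \<xi>) < 1" "1 - norm (a *\<^sub>R \<xi>) = y" using a \<xi> by (auto simp: y_def)
    have "cesaro_well_defined \<mu> \<beta> \<xi> ?f" using map[OF fb] by blast
    then have "integrable \<mu> (cesaro_kernel \<beta> \<xi> ?f (a *\<^sub>R \<xi>))"
      unfolding cesaro_well_defined_def using w(1) by auto
    from cesaro_test_function_lower[OF \<xi> \<beta> \<mu> a this]
    have low: "emeasure \<mu> {a..<1} \<le> ennreal (3 ^ s * 2 powr \<beta> * y powr (s + \<beta>) * norm (g (a *\<^sub>R \<xi>)))"
      by (simp add: g_def y_def)
    have "bergman_norm p \<alpha> ?f \<le> (\<kappa> * T) powr (1 / p) * y powr (N / p - s)"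
    proof -
      have "enn2real (bergman_integral \<alpha> p ?f) \<le> T * y powr (N - s * p)"
        using enn2real_mono[OF f(2)] T(1) by simp
      then have "\<kappa> * enn2real (bergman_integral \<alpha> p ?f) \<le> (\<kappa> * T) * y powr (N - s * p)"
        using \<kappa>(1) by (simp add: mult.assoc)
      then have "(\<kappa> * enn2real (bergman_integral \<alpha> p ?f)) powr (1 / p) \<le> ((\<kappa> * T) * y powr (N - s * p)) powr (1 / p)"
        using p \<kappa>(1) by (intro powr_mono2) auto
      also have "\<dots> = (\<kappa> * T) powr (1 / p) * y powr ((N - s * p) * (1 / p))"
        using \<kappa>(1) T(1) by (simp add: powr_mult powr_powr)
      also have "(N - s * p) * (1 / p) = N / p - s" using p by (simp add: field_simps)
      finally show ?thesis using \<kappa>(3)[OF p(1) f(1)] by simp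
    qed
    then have "\<bar>B\<bar> * bergman_norm p \<alpha> ?f \<le> \<bar>B\<bar> * ((\<kappa> * T) powr (1 / p) * y powr (N / p - s))"
      by (rule mult_left_mono) simp
    moreover have "B * bergman_norm p \<alpha> ?f \<le> \<bar>B\<bar> * bergman_norm p \<alpha> ?f"
      by (intro mult_right_mono) (auto simp: bergman_norm_def)
    moreover have "bergman_norm q \<alpha> g \<le> B * bergman_norm p \<alpha> ?f"
      unfolding g_def by (rule bspec[OF B fb])
    ultimately have gn: "bergman_norm q \<alpha> g \<le> \<bar>B\<bar> * ((\<kappa> * T) powr (1 / p) * y powr (N / p - s))"
      by (meson order_trans)
    have "norm (g (a *\<^sub>R \<xi>)) powr q * y powr N \<le> G * j"
    proof -
      have "ennreal (norm (g (a *\<^sub>R \<xi>)) powr q) * ennreal (y powr N)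
        \<le> ennreal G * (\<integral>\<^sup>+x. ennreal (norm (g x) powr q) * indicator (ball 0 1) x *
           indicator {x. y \<le> 2 * (1 - (norm x)\<^sup>2) \<and> norm (1 - herm x \<xi>) \<le> 3 * norm (1 - herm (a *\<^sub>R \<xi>) \<xi>)} x \<partial>weighted_lborel \<alpha>)"
        using G(2)[OF g(1) \<xi> w(1)] unfolding w(2) .
      also have "\<dots> \<le> ennreal G * bergman_integral \<alpha> q g"
        unfolding bergman_integral_def by (intro mult_left_mono nn_integral_mono) (auto simp: indicator_def)
      finally show ?thesis using j G(1) by (simp flip: ennreal_mult)
    qed
    then have "(norm (g (a *\<^sub>R \<xi>)) powr q * y powr N) * y powr (-N) \<le> (G * j) * y powr (-N)"
      by (rule mult_right_mono) simp
    then have "norm (g (a *\<^sub>R \<xi>)) powr q \<le> (G * j) * y powr (-N)"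
      using y by (simp add: mult.assoc powr_add[symmetric])
    then have "norm (g (a *\<^sub>R \<xi>)) \<le> ((G * j) * y powr (-N)) powr (1 / q)"
      using q by (intro le_powr_inverse) auto
    also have "((G * j) * y powr (-N)) powr (1 / q) = (G / \<kappa>) powr (1 / q) * bergman_norm q \<alpha> g * y powr (-N / q)"
    proof -
      have "(G * j) * y powr (-N) = ((G / \<kappa>) * (\<kappa> * j)) * y powr (-N)" using \<kappa>(1) by simp
      then have "((G * j) * y powr (-N)) powr (1 / q) = (G / \<kappa>) powr (1 / q) * (\<kappa> * j) powr (1 / q) * (y powr (-N)) powr (1 / q)"
        by (simp only: powr_mult)
      then show ?thesis using \<kappa>(3)[OF q g(1)] j by (simp add: powr_powr)
    qed
    also have "\<dots> \<le> (G / \<kappa>) powr (1 / q) * (\<bar>B\<bar> * ((\<kappa> * T) powr (1 / p) * y powr (N / p - s))) * y powr (-N / q)"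
      using gn by (intro mult_right_mono mult_left_mono) auto
    finally have "3 ^ s * 2 powr \<beta> * y powr (s + \<beta>) * norm (g (a *\<^sub>R \<xi>))
      \<le> 3 ^ s * 2 powr \<beta> * y powr (s + \<beta>) * ((G / \<kappa>) powr (1 / q) * (\<bar>B\<bar> * ((\<kappa> * T) powr (1 / p) * y powr (N / p - s))) * y powr (-N / q))"
      by (rule mult_left_mono) simp
    also have "\<dots> = A * (y powr (s + \<beta>) * y powr (N / p - s) * y powr (-N / q))"
      by (simp only: A_def mult_ac)
    also have "y powr (s + \<beta>) * y powr (N / p - s) * y powr (-N / q) = y powr l"
    proof -
      have "l = \<beta> + N * (1 / p - 1 / q)" by (simp add: l N_def)
      then have "s + \<beta> + (N / p - s) + - N / q = l"
        by (simp add: right_diff_distrib)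
      then show ?thesis by (simp only: powr_add[symmetric])
    qed
    finally have "ennreal (3 ^ s * 2 powr \<beta> * y powr (s + \<beta>) * norm (g (a *\<^sub>R \<xi>))) \<le> ennreal (A * y powr l)"
      by (rule ennreal_leI)
    with low have "emeasure \<mu> {a..<1} \<le> ennreal (A * y powr l)" by (rule order_trans)
    moreover have "y powr l > 0" using y by simp
    ultimately have "emeasure \<mu> {a..<1} / ennreal (y powr l) \<le> ennreal A"
      using ennreal_divide_le_cancel A0 by blast
    then show ?thesis by (simp only: y_def)
  qed
  then have "(SUP r\<in>{0..<1}. emeasure \<mu> {r..<1} / ennreal ((1 - r) powr l)) \<le> ennreal A"
    by (intro SUP_least) auto
  from le_less_trans[OF this ennreal_less_top] show ?thesis unfolding carleson_measure_def by simp
qed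

theorem theorem1p1:
  fixes \<xi> :: "complex ^ 'n" and \<alpha> \<beta> p q l :: real and \<mu> :: "real measure"
  assumes "\<xi> \<in> sphere 0 1"
    and "\<alpha> > -1"
    and "\<beta> > 0"
    and "0 < p" and "p \<le> q"
    and "borel_measure_01 \<mu>"
    and "l = \<beta> + (real CARD('n) + 1 + \<alpha>) * (1 / p - 1 / q)"
  shows "cesaro_bounded \<mu> \<beta> \<xi> \<alpha> p q \<longleftrightarrow> carleson_measure l \<mu>"
proof -
  have "norm \<xi> = 1" using assms(1) by simp
  note facts = this assms(2-7)
  show ?thesis
  proof
    show "carleson_measure l \<mu>" if "cesaro_bounded \<mu> \<beta> \<xi> \<alpha> p q"
      by (rule carleson_if_cesaro_bounded[OF facts that])
    show "cesaro_bounded \<mu> \<beta> \<xi> \<alpha> p q" if "carleson_measure l \<mu>"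
      by (rule cesaro_bounded_if_carleson[OF facts that])
  qed
qed

end
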